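(* Let $V_H=\mathrm{span}\{\phi_p\}\subset (V_h)^m$ be a (finite-dimensional) multiscale finite element space, and let $g_i$, $i=1,\dots,m$, be square-integrable inflow data on $\Gamma_i^-$. Then the problem: find $u_H=(u_{H,1},\dots,u_{H,m})\in V_H$ such that $$a(u_H,w)+l(u_H,w)=F(w)\qquad \forall w\in V_H$$ has a unique solution, and this solution satisfies $$\sum_{i=1}^{m}\alpha_i\Big(\frac14\sum_{e\in\mathcal E_H}\int_e|\mathbf v_i\cdot\mathbf n|\,[u_{H,i}]^2+\int_\Omega\epsilon\,u_{H,i}^2\Big)+\int_\Omega\frac{1}{\epsilon a^\delta}\sum_{i,j=1}^m a_{ij}u_{H,j}u_{H,i}\;\le\;\sum_{i=1}^m\alpha_i\sum_{e\in\Gamma_i^-}\int_e|\mathbf v_i\cdot\mathbf n|\,g_i^2 .$$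
   Context: Setting. $\Omega\subset\mathbb R^2$ is a bounded connected domain with Lipschitz boundary, partitioned (conformingly) into closed rectangular coarse elements $K_j$ forming $\mathcal T^H$ (mesh size $H$); $\mathcal T^h$ is a rectangular refinement of $\mathcal T^H$ (mesh size $h$). $\mathcal E_H$ is the set of all edges of coarse elements and $\mathcal E_H^0\subset\mathcal E_H$ the set of those in the interior of $\Omega$. $\mathbf v_1,\dots,\mathbf v_m\in S^1$ are quadrature velocities with weights $\alpha_i>0$, $\sum_i\alpha_i=1$. $\epsilon>0$ is a constant and $a^\delta:\Omega\to\mathbb R$ is measurable with $0<c_0\le a^\delta\le c_1$ for some constants. Set $a_{ii}=\alpha_i-\alpha_i^2$ and $a_{ij}=-\alpha_i\alpha_j$ for $i\ne j$. Fine space: $V_h=\{v\in L^2(\Omega): v|_\tau\in Q_1(\tau)\ \forall\tau\in\mathcal T^h,\ v|_K\in C^0(K)\ \forall K\in\mathcal T^H\}$ ($Q_1$ = bilinear polynomials). Functions may jump across coarse edges; all gradients are taken elementwise. Edge notation: for the $i$-th component, $\Gamma_i^{\pm}$ is the set of coarse edges on $\partial\Omega$ with $\pm\mathbf v_i\cdot\mathbf n>0$, $\mathbf n$ the outward unit normal of $\Omega$. For $e\in\mathcal E_H^0$ shared by two coarse elements, the upwind element (with respect to $\mathbf v_i$) is the one whose outward unit normal $\mathbf n^+$ on $e$ satisfies $\mathbf v_i\cdot\mathbf n^+>0$ (arbitrary choice if $\mathbf v_i\cdot\mathbf n^+=0$); $w^+$ is the trace from the upwind element, $w^-$ the trace from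 the other one, and $\mathbf n^-=-\mathbf n^+$. The jump is $[w]=w^+\mathbf n^++w^-\mathbf n^-$ on $e\in\mathcal E_H^0$ and $[w]=w\mathbf n$ on boundary edges; $[w]^2$ means $|[w]|^2$. Forms: $a(u,w)=\sum_{i=1}^m\alpha_i a_i(u_i,w_i)$ with $$a_i(u_i,w_i)=-\int_\Omega u_i\nabla w_i\cdot\mathbf v_i+\sum_{e\in\mathcal E_H^0}\int_e u_i^+[w_i]\cdot\mathbf v_i+\sum_{e\in\Gamma_i^+}\int_e u_iw_i\,\mathbf v_i\cdot\mathbf n,$$ $$l(u,w)=\int_\Omega\frac{1}{\epsilon a^\delta}\sum_{i,j=1}^m a_{ij}u_jw_i+\sum_{i=1}^m\alpha_i\int_\Omega\epsilon u_iw_i,\qquad F(w)=-\sum_{i=1}^m\alpha_i\sum_{e\in\Gamma_i^-}\int_e g_iw_i\,\mathbf v_i\cdot\mathbf n .$$ *)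

theory Defs
  imports "HOL-Analysis.Analysis"
begin

type_synonym plane = "real \<times> real"

definition lipschitz_domain :: "plane set \<Rightarrow> bool" where
  "lipschitz_domain \<Omega> \<longleftrightarrow> open \<Omega> \<and> connected \<Omega> \<and> \<Omega> \<noteq> {} \<and>
     (\<forall>x\<in>frontier \<Omega>. \<exists>r>0. \<exists>(R :: plane \<Rightarrow> plane) L (\<gamma> :: real \<Rightarrow> real). orthogonal_transformation R \<and>
        L-lipschitz_on UNIV \<gamma> \<and> \<Omega> \<inter> ball x r = {y \<in> ball x r. \<gamma> (fst (R y)) < snd (R y)})"

definition square_integrable_on :: "'a::euclidean_space set \<Rightarrow> ('a \<Rightarrow> real) \<Rightarrow> bool" where
  "square_integrable_on S f \<longleftrightarrow>
     set_borel_measurable lebesgue S f \<and> set_integrable lebesgue S (\<lambda>x. (f x)\<^sup>2)"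


(* Members of a division are closed boxes, i.e. axis-parallel rectangles, with pairwise disjoint
   interiors; a division also allows degenerate boxes, which are excluded here. *)

definition rectangular_mesh :: "plane set \<Rightarrow> plane set set \<Rightarrow> bool" where
  "rectangular_mesh \<Omega> T \<longleftrightarrow> T division_of closure \<Omega> \<and> (\<forall>K\<in>T. interior K \<noteq> {})"

definition conforming :: "plane set set \<Rightarrow> bool" where
  "conforming T \<longleftrightarrow> (\<forall>K\<in>T. \<forall>K'\<in>T. (K \<inter> K') face_of K \<and> (K \<inter> K') face_of K')"

definition mesh_refines :: "plane set set \<Rightarrow> plane set set \<Rightarrow> bool" where
  "mesh_refines T' T \<longleftrightarrow> (\<forall>\<tau>\<in>T'. \<exists>K\<in>T. \<tau> \<subseteq> K)"


definition mesh_edges :: "plane set set \<Rightarrow> plane set set" where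
  "mesh_edges T = {e. \<exists>K\<in>T. e edge_of K}"

definition interior_edges :: "plane set \<Rightarrow> plane set set \<Rightarrow> plane set set" where
  "interior_edges \<Omega> T = {e \<in> mesh_edges T. rel_interior e \<subseteq> \<Omega>}"

definition boundary_edges :: "plane set \<Rightarrow> plane set set \<Rightarrow> plane set set" where
  "boundary_edges \<Omega> T = {e \<in> mesh_edges T. e \<subseteq> frontier \<Omega>}"

definition adjacent :: "plane set set \<Rightarrow> plane set \<Rightarrow> plane set set" where
  "adjacent T e = {K \<in> T. e edge_of K}"

definition outward_normal :: "plane set \<Rightarrow> plane set \<Rightarrow> plane" where
  "outward_normal K e = (THE n. norm n = 1 \<and> (\<forall>x\<in>e. \<forall>y\<in>K. n \<bullet> (y - x) \<le> 0))"

(* On a boundary edge, the outward normal of the domain is that of the only adjacent element. *)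

definition boundary_normal :: "plane set set \<Rightarrow> plane set \<Rightarrow> plane" where
  "boundary_normal T e = outward_normal (the_elem (adjacent T e)) e"

definition inflow_edges :: "plane set \<Rightarrow> plane set set \<Rightarrow> plane \<Rightarrow> plane set set" where
  "inflow_edges \<Omega> T v = {e \<in> boundary_edges \<Omega> T. v \<bullet> boundary_normal T e < 0}"

definition outflow_edges :: "plane set \<Rightarrow> plane set set \<Rightarrow> plane \<Rightarrow> plane set set" where
  "outflow_edges \<Omega> T v = {e \<in> boundary_edges \<Omega> T. v \<bullet> boundary_normal T e > 0}"

(* Edges are axis-parallel segments, i.e. degenerate boxes, so the lower and upper bounds of an
   edge are its two endpoints; the integral is with respect to arc length. *)

definition edge_param :: "plane set \<Rightarrow> real \<Rightarrow> plane" where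
  "edge_param e = linepath (interval_lowerbound e) (interval_upperbound e)"

definition edge_integral :: "plane set \<Rightarrow> (plane \<Rightarrow> real) \<Rightarrow> real" where
  "edge_integral e f = dist (interval_lowerbound e) (interval_upperbound e) *
     (LINT t:{0..1}|lebesgue. f (edge_param e t))"

definition edge_square_integrable :: "plane set \<Rightarrow> (plane \<Rightarrow> real) \<Rightarrow> bool" where
  "edge_square_integrable e f \<longleftrightarrow> square_integrable_on {0..1} (\<lambda>t. f (edge_param e t))"


definition bilinear_polys :: "(plane \<Rightarrow> real) set" where
  "bilinear_polys = {\<lambda>(x, y). a + b * x + c * y + d * x * y | a b c d. True}"

(* Every class of functions modulo null sets is represented by functions that are regular in the
   interior of each element; the values on the coarse edges and outside the domain remain
   arbitrary. *)

definition fine_space :: "plane set \<Rightarrow> plane set set \<Rightarrow> plane set set \<Rightarrow> (plane \<Rightarrow> real) set" where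
  "fine_space \<Omega> TH Th = {w. square_integrable_on \<Omega> w \<and>
     (\<forall>\<tau>\<in>Th. \<exists>q\<in>bilinear_polys. \<forall>x\<in>interior \<tau>. w x = q x) \<and>
     (\<forall>K\<in>TH. \<exists>f. continuous_on K f \<and> (\<forall>x\<in>interior K. w x = f x))}"

definition span_family :: "'p set \<Rightarrow> ('p \<Rightarrow> 'm \<Rightarrow> plane \<Rightarrow> real) \<Rightarrow> ('m \<Rightarrow> plane \<Rightarrow> real) set" where
  "span_family P \<phi> = {\<lambda>i x. \<Sum>p\<in>P. c p * \<phi> p i x | c. True}"

definition trace_from :: "plane set \<Rightarrow> (plane \<Rightarrow> real) \<Rightarrow> plane \<Rightarrow> real" where
  "trace_from K w x = Lim (at x within interior K) w"

definition boundary_trace :: "plane set set \<Rightarrow> plane set \<Rightarrow> (plane \<Rightarrow> real) \<Rightarrow> plane \<Rightarrow> real" where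
  "boundary_trace T e = trace_from (the_elem (adjacent T e))"


(* U e is the upwind element of the interior edge e; both elements qualify when the velocity is
   tangential to e. *)

definition upwind_choice ::
  "plane set \<Rightarrow> plane set set \<Rightarrow> plane \<Rightarrow> (plane set \<Rightarrow> plane set) \<Rightarrow> bool" where
  "upwind_choice \<Omega> T v U \<longleftrightarrow>
     (\<forall>e\<in>interior_edges \<Omega> T. U e \<in> adjacent T e \<and> v \<bullet> outward_normal (U e) e \<ge> 0)"

definition upwind_trace ::
  "(plane set \<Rightarrow> plane set) \<Rightarrow> plane set \<Rightarrow> (plane \<Rightarrow> real) \<Rightarrow> plane \<Rightarrow> real" where
  "upwind_trace U e = trace_from (U e)"

definition downwind_trace ::
  "plane set set \<Rightarrow> (plane set \<Rightarrow> plane set) \<Rightarrow> plane set \<Rightarrow> (plane \<Rightarrow> real) \<Rightarrow> plane \<Rightarrow> real" where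
  "downwind_trace T U e = trace_from (the_elem (adjacent T e - {U e}))"

definition upwind_normal :: "(plane set \<Rightarrow> plane set) \<Rightarrow> plane set \<Rightarrow> plane" where
  "upwind_normal U e = outward_normal (U e) e"

definition edge_normal ::
  "plane set \<Rightarrow> plane set set \<Rightarrow> (plane set \<Rightarrow> plane set) \<Rightarrow> plane set \<Rightarrow> plane" where
  "edge_normal \<Omega> T U e =
     (if e \<in> interior_edges \<Omega> T then upwind_normal U e else boundary_normal T e)"

definition jump ::
  "plane set \<Rightarrow> plane set set \<Rightarrow> (plane set \<Rightarrow> plane set) \<Rightarrow> plane set \<Rightarrow>
   (plane \<Rightarrow> real) \<Rightarrow> plane \<Rightarrow> plane" where
  "jump \<Omega> T U e w x =
     (if e \<in> interior_edges \<Omega> T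
      then upwind_trace U e w x *\<^sub>R upwind_normal U e
         + downwind_trace T U e w x *\<^sub>R (- upwind_normal U e)
      else boundary_trace T e w x *\<^sub>R boundary_normal T e)"


definition scattering_coeff :: "('m \<Rightarrow> real) \<Rightarrow> 'm \<Rightarrow> 'm \<Rightarrow> real" where
  "scattering_coeff \<alpha> i j = (if i = j then \<alpha> i - (\<alpha> i)\<^sup>2 else - (\<alpha> i * \<alpha> j))"

(* The directional derivative of w is elementwise, over the interiors of the fine elements. *)

definition transport_form_component ::
  "plane set \<Rightarrow> plane set set \<Rightarrow> plane set set \<Rightarrow> plane \<Rightarrow> (plane set \<Rightarrow> plane set) \<Rightarrow>
   (plane \<Rightarrow> real) \<Rightarrow> (plane \<Rightarrow> real) \<Rightarrow> real" where
  "transport_form_component \<Omega> TH Th v U u w =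
     - (\<Sum>\<tau>\<in>Th. LINT x:interior \<tau>|lebesgue. u x * frechet_derivative w (at x) v)
     + (\<Sum>e\<in>interior_edges \<Omega> TH. edge_integral e (\<lambda>x. upwind_trace U e u x * (jump \<Omega> TH U e w x \<bullet> v)))
     + (\<Sum>e\<in>outflow_edges \<Omega> TH v. edge_integral e
          (\<lambda>x. boundary_trace TH e u x * boundary_trace TH e w x * (v \<bullet> boundary_normal TH e)))"

definition transport_form ::
  "plane set \<Rightarrow> plane set set \<Rightarrow> plane set set \<Rightarrow> ('m::finite \<Rightarrow> plane) \<Rightarrow> ('m \<Rightarrow> plane set \<Rightarrow> plane set) \<Rightarrow>
   ('m \<Rightarrow> real) \<Rightarrow> ('m \<Rightarrow> plane \<Rightarrow> real) \<Rightarrow> ('m \<Rightarrow> plane \<Rightarrow> real) \<Rightarrow> real" where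
  "transport_form \<Omega> TH Th v U \<alpha> u w =
     (\<Sum>i\<in>UNIV. \<alpha> i * transport_form_component \<Omega> TH Th (v i) (U i) (u i) (w i))"

definition scattering_form ::
  "plane set \<Rightarrow> ('m::finite \<Rightarrow> real) \<Rightarrow> real \<Rightarrow> (plane \<Rightarrow> real) \<Rightarrow>
   ('m \<Rightarrow> plane \<Rightarrow> real) \<Rightarrow> ('m \<Rightarrow> plane \<Rightarrow> real) \<Rightarrow> real" where
  "scattering_form \<Omega> \<alpha> \<epsilon> a u w =
     (LINT x:\<Omega>|lebesgue. 1 / (\<epsilon> * a x) *
        (\<Sum>i\<in>UNIV. \<Sum>j\<in>UNIV. scattering_coeff \<alpha> i j * u j x * w i x))
     + (\<Sum>i\<in>UNIV. \<alpha> i * (LINT x:\<Omega>|lebesgue. \<epsilon> * u i x * w i x))"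

definition inflow_functional ::
  "plane set \<Rightarrow> plane set set \<Rightarrow> ('m::finite \<Rightarrow> plane) \<Rightarrow> ('m \<Rightarrow> real) \<Rightarrow>
   ('m \<Rightarrow> plane \<Rightarrow> real) \<Rightarrow> ('m \<Rightarrow> plane \<Rightarrow> real) \<Rightarrow> real" where
  "inflow_functional \<Omega> TH v \<alpha> g w =
     - (\<Sum>i\<in>UNIV. \<alpha> i * (\<Sum>e\<in>inflow_edges \<Omega> TH (v i). edge_integral e
          (\<lambda>x. g i x * boundary_trace TH e (w i) x * (v i \<bullet> boundary_normal TH e))))"

definition discrete_solution ::
  "plane set \<Rightarrow> plane set set \<Rightarrow> plane set set \<Rightarrow> ('m::finite \<Rightarrow> plane) \<Rightarrow> ('m \<Rightarrow> plane set \<Rightarrow> plane set) \<Rightarrow>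
   ('m \<Rightarrow> real) \<Rightarrow> real \<Rightarrow> (plane \<Rightarrow> real) \<Rightarrow> ('m \<Rightarrow> plane \<Rightarrow> real) \<Rightarrow> ('m \<Rightarrow> plane \<Rightarrow> real) set \<Rightarrow>
   ('m \<Rightarrow> plane \<Rightarrow> real) \<Rightarrow> bool" where
  "discrete_solution \<Omega> TH Th v U \<alpha> \<epsilon> a g V u \<longleftrightarrow> u \<in> V \<and>
     (\<forall>w\<in>V. transport_form \<Omega> TH Th v U \<alpha> u w + scattering_form \<Omega> \<alpha> \<epsilon> a u w
            = inflow_functional \<Omega> TH v \<alpha> g w)"

end

theory Submission
  imports Defs
begin

text \<open>
  Testing with \<open>w = u\<close>: on a coarse element the divergence theorem turns \<open>- \<integral> w \<nabla>w \<bullet> v\<close> into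
  \<open>- 1/2 \<integral> w\<^sup>2 v \<bullet> n\<close> over the element boundary. An interior edge is met by exactly two elements
  with opposite normals, so with the upwind term it contributes
  \<open>w\<^sup>+ (w\<^sup>+ - w\<^sup>-) - ((w\<^sup>+)\<^sup>2 - (w\<^sup>-)\<^sup>2) / 2 = (w\<^sup>+ - w\<^sup>-)\<^sup>2 / 2\<close> times \<open>v \<bullet> n\<^sup>+ \<ge> 0\<close>; a boundary edge
  contributes \<open>\<bar>v \<bullet> n\<bar> w\<^sup>2 / 2\<close>. The scattering term is nonnegative because it is the variance of
  \<open>u\<close> under the weights \<open>\<alpha>\<close>. Hence the form vanishes at \<open>u\<close> only if \<open>u = 0\<close> almost everywhere,
  which gives solvability and uniqueness, and Young's inequality
  \<open>\<bar>g w\<bar> \<le> g\<^sup>2 + w\<^sup>2 / 4\<close> on the inflow edges gives the estimate.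
\<close>

subsection \<open>Linear systems\<close>

text \<open>Two obstacles shape the development. First, functions are concrete representatives,
  arbitrary on the coarse edges, so a null function need not be the zero function and uniqueness can
  only mean equality almost everywhere. The form is thus definite only modulo null functions, and a
  null fine function has to be invisible to the form and to the data. It is: continuity on each
  element turns vanishing almost everywhere into vanishing in the element interiors, and elementwise
  derivatives and traces look nowhere else. Second, that an interior edge belongs to exactly two
  elements is proved, not assumed. It rests on three facts: the graph property of the boundary
  excludes slits, conformity makes intersections of elements common faces, and a rectangle contains
  the half disc behind each of its sides. The constant 1/4 in the estimate is what remains of the
  1/2 in the energy identity after Young's inequality has consumed 1/4.\<close>

text \<open>
  The spanning family may be linearly dependent, so the matrix can be singular; it suffices that
  every isotropic vector lies in the kernel and annihilates the right-hand side.
\<close>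

lemma finite_system_solvable:
  fixes M :: "'p \<Rightarrow> 'p \<Rightarrow> real" and F :: "'p \<Rightarrow> real"
  assumes "finite P"
    and "\<And>d. (\<Sum>p\<in>P. \<Sum>q\<in>P. d p * M p q * d q) = 0 \<Longrightarrow> (\<forall>p\<in>P. (\<Sum>q\<in>P. M p q * d q) = 0)"
    and "\<And>d. (\<Sum>p\<in>P. \<Sum>q\<in>P. d p * M p q * d q) = 0 \<Longrightarrow> (\<Sum>q\<in>P. F q * d q) = 0"
  shows "\<exists>c. \<forall>q\<in>P. (\<Sum>p\<in>P. c p * M p q) = F q"
  using assms
proof (induction P arbitrary: F rule: finite_induct)
  case empty
  then show ?case by simp
next
  case (insert r P)
  \<comment> \<open>Padding \<open>d\<close> by 0 at \<open>r\<close> passes both hypotheses from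
    \<open>insert r P\<close> to \<open>P\<close>. The conclusion of \<open>ker\<close> retains the
    row \<open>p = r\<close>; this is what admits \<open>- M r\<close> as a right-hand side for the
    induction hypothesis.\<close>
  have ker: "\<forall>p\<in>insert r P. (\<Sum>q\<in>P. M p q * d q) = 0"
    and kerF: "F' = F \<Longrightarrow> (\<Sum>q\<in>P. F' q * d q) = 0"
    if "(\<Sum>p\<in>P. \<Sum>q\<in>P. d p * M p q * d q) = 0" for d F'
  proof -
    let ?d = "d(r := 0)"
    have upd: "(\<Sum>q\<in>insert r P. f q * ?d q) = (\<Sum>q\<in>P. f q * d q)" for f :: "'p \<Rightarrow> real"
    proof -
      have "(\<Sum>q\<in>P. f q * ?d q) = (\<Sum>q\<in>P. f q * d q)"
        by (rule sum.cong) (use insert.hyps in auto)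
      then show ?thesis using insert.hyps by simp
    qed
    have "(\<Sum>p\<in>insert r P. \<Sum>q\<in>insert r P. ?d p * M p q * ?d q) = (\<Sum>p\<in>P. \<Sum>q\<in>P. d p * M p q * d q)"
    proof -
      have "(\<Sum>p\<in>insert r P. \<Sum>q\<in>insert r P. ?d p * M p q * ?d q)
          = (\<Sum>p\<in>insert r P. \<Sum>q\<in>P. ?d p * M p q * d q)"
        by (intro sum.cong refl upd)
      also have "\<dots> = (\<Sum>p\<in>P. \<Sum>q\<in>P. ?d p * M p q * d q)"
        using insert.hyps by simp
      also have "\<dots> = (\<Sum>p\<in>P. \<Sum>q\<in>P. d p * M p q * d q)"
        by (intro sum.cong refl) (use insert.hyps in auto)
      finally show ?thesis .
    qed
    with that have z: "(\<Sum>p\<in>insert r P. \<Sum>q\<in>insert r P. ?d p * M p q * ?d q) = 0" by simp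
    show "\<forall>p\<in>insert r P. (\<Sum>q\<in>P. M p q * d q) = 0"
      using insert.prems(1)[OF z] unfolding upd .
    show "(\<Sum>q\<in>P. F' q * d q) = 0" if "F' = F"
      using insert.prems(2)[OF z] that unfolding upd by simp
  qed
  obtain c0 where c0: "\<forall>q\<in>P. (\<Sum>p\<in>P. c0 p * M p q) = F q"
    using insert.IH[of F] ker kerF by auto
  have "\<exists>c. \<forall>q\<in>P. (\<Sum>p\<in>P. c p * M p q) = - M r q"
    by (rule insert.IH) (use ker in \<open>auto simp: sum_negf\<close>)
  then obtain c1 where c1: "\<forall>q\<in>P. (\<Sum>p\<in>P. c1 p * M p q) = - M r q" by blast
  \<comment> \<open>\<open>z\<close> is a row vector with entry 1 at \<open>r\<close> whose product
    with \<open>M\<close> vanishes in all columns of \<open>P\<close>. Hence \<open>s\<close> below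
    is both the remaining entry of that product and the value of the quadratic form at
    \<open>z\<close>; for an invertible \<open>P\<close> block it is the Schur complement.\<close>
  define z where "z = c1(r := 1)"
  have zP: "(\<Sum>p\<in>P. f p * z p) = (\<Sum>p\<in>P. f p * c1 p)" "(\<Sum>p\<in>P. z p * f p) = (\<Sum>p\<in>P. c1 p * f p)"
    for f :: "'p \<Rightarrow> real"
    by (rule sum.cong; use insert.hyps in \<open>auto simp: z_def\<close>)+
  have zr: "z r = 1" by (simp add: z_def)
  have zq: "(\<Sum>p\<in>insert r P. z p * M p q) = 0" if "q \<in> P" for q
    using insert.hyps c1 that by (simp add: zP zr)
  define s where "s = (\<Sum>p\<in>insert r P. z p * M p r)"
  have zz: "(\<Sum>p\<in>insert r P. \<Sum>q\<in>insert r P. z p * M p q * z q) = s"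
  proof -
    have "(\<Sum>p\<in>insert r P. \<Sum>q\<in>insert r P. z p * M p q * z q)
        = (\<Sum>q\<in>insert r P. (\<Sum>p\<in>insert r P. z p * M p q) * z q)"
      by (subst sum.swap) (simp add: sum_distrib_right)
    also have "\<dots> = (\<Sum>p\<in>insert r P. z p * M p r) * z r + (\<Sum>q\<in>P. (\<Sum>p\<in>insert r P. z p * M p q) * z q)"
      using insert.hyps by (rule sum.insert)
    also have "(\<Sum>q\<in>P. (\<Sum>p\<in>insert r P. z p * M p q) * z q) = 0"
      by (rule sum.neutral) (use zq in auto)
    also have "(\<Sum>p\<in>insert r P. z p * M p r) * z r + 0 = s"
      by (simp add: s_def zr del: sum.insert)
    finally show ?thesis .
  qed
  \<comment> \<open>Adding a multiple of \<open>z\<close> to \<open>c0\<close> leaves the equations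
    in \<open>P\<close> intact, so a nonzero \<open>s\<close> acts as the pivot of the last
    equation.\<close>
  define t where "t = (if s = 0 then 0 else (F r - (\<Sum>p\<in>P. c0 p * M p r)) / s)"
  define c where "c = (\<lambda>p. (if p = r then 0 else c0 p) + t * z p)"
  have cq: "(\<Sum>p\<in>insert r P. c p * M p q)
      = (\<Sum>p\<in>P. c0 p * M p q) + t * (\<Sum>p\<in>insert r P. z p * M p q)" for q
  proof -
    have "(\<Sum>p\<in>P. (if p = r then 0 else c0 p) * M p q) = (\<Sum>p\<in>P. c0 p * M p q)"
      by (rule sum.cong) (use insert.hyps in auto)
    then show ?thesis
      using insert.hyps
      by (simp add: c_def algebra_simps sum.distrib sum_distrib_left)
  qed
  have "(\<Sum>p\<in>insert r P. c p * M p r) = F r"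
  proof (cases "s = 0")
    case False
    then show ?thesis unfolding cq by (simp add: t_def s_def[symmetric])
  next
    \<comment> \<open>Now \<open>z\<close> is isotropic, hence killed by the rows in
      \<open>P\<close> and by \<open>F\<close>. Pairing \<open>c0\<close> with these relations shows
      that the last equation already holds for \<open>c0\<close>.\<close>
    case True
    have 1: "(\<Sum>q\<in>insert r P. M p q * z q) = 0" if "p \<in> P" for p
      using insert.prems(1)[of z] zz True that by simp
    have 2: "(\<Sum>q\<in>insert r P. F q * z q) = 0"
      using insert.prems(2)[of z] zz True by simp
    have "0 = (\<Sum>p\<in>P. c0 p * (\<Sum>q\<in>insert r P. M p q * z q))"
      using 1 by simp
    also have "\<dots> = (\<Sum>q\<in>insert r P. (\<Sum>p\<in>P. c0 p * M p q) * z q)"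
      by (simp only: sum_distrib_left sum_distrib_right) (subst sum.swap, simp add: mult_ac)
    also have "\<dots> = (\<Sum>p\<in>P. c0 p * M p r) + (\<Sum>q\<in>P. F q * z q)"
      using insert.hyps c0 by (simp add: zr)
    also have "(\<Sum>q\<in>P. F q * z q) = - F r"
      using 2 insert.hyps by (simp add: zr)
    finally show ?thesis unfolding cq using True by (simp add: s_def[symmetric])
  qed
  moreover have "(\<Sum>p\<in>insert r P. c p * M p q) = F q" if "q \<in> P" for q
    unfolding cq using c0 zq that by simp
  ultimately show ?case by auto
qed

subsection \<open>Rectangles, edges and meshes\<close>

text \<open>Near a boundary point the domain is one side of a graph, so the other side supplies
  points off the closure. This excludes slits, where an edge shared by two elements could lie in the
  frontier.\<close>

lemma interior_closure_lipschitz_domain: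
  assumes "lipschitz_domain \<Omega>"
  shows "interior (closure \<Omega>) = \<Omega>"
proof
  have op: "open \<Omega>" using assms by (simp add: lipschitz_domain_def)
  then show "\<Omega> \<subseteq> interior (closure \<Omega>)"
    by (simp add: closure_subset interior_maximal)
  show "interior (closure \<Omega>) \<subseteq> \<Omega>"
  proof
    fix x assume x: "x \<in> interior (closure \<Omega>)"
    show "x \<in> \<Omega>"
    proof (rule ccontr)
      assume xn: "x \<notin> \<Omega>"
      then have "x \<in> frontier \<Omega>"
        using x op by (simp add: frontier_def interior_open) (meson interior_subset subsetD)
      then have "\<exists>r>0. \<exists>(R :: plane \<Rightarrow> plane) L (\<gamma> :: real \<Rightarrow> real). orthogonal_transformation R \<and>
        L-lipschitz_on UNIV \<gamma> \<and> \<Omega> \<inter> ball x r = {y \<in> ball x r. \<gamma> (fst (R y)) < snd (R y)}"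
        using assms by (simp add: lipschitz_domain_def)
      then obtain r L and R :: "plane \<Rightarrow> plane" and \<gamma> :: "real \<Rightarrow> real" where r: "r > 0" and R: "orthogonal_transformation R"
        and lip: "L-lipschitz_on UNIV \<gamma>"
        and eq: "\<Omega> \<inter> ball x r = {y \<in> ball x r. \<gamma> (fst (R y)) < snd (R y)}"
        by (elim exE conjE) (rule that)
      have cont\<gamma>: "continuous_on UNIV \<gamma>"
        using lip by (rule lipschitz_on_continuous_on)
      have linR: "linear R" using R by (simp add: orthogonal_transformation_def)
      have contR: "continuous_on UNIV R"
        using linR by (simp add: linear_continuous_on linear_conv_bounded_linear)
      obtain d where d: "R d = (0, 1)"
        using orthogonal_transformation_surj[OF R] by (metis surj_def)
      have nd: "norm d = 1"
        using R d by (metis norm_Pair1 norm_one orthogonal_transformation_norm norm_Pair2)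
      have ge: "snd (R x) \<le> \<gamma> (fst (R x))"
      proof (rule ccontr)
        assume "\<not> ?thesis"
        then have "x \<in> {y \<in> ball x r. \<gamma> (fst (R y)) < snd (R y)}" using r by simp
        with eq xn show False by blast
      qed
      obtain s where s: "s > 0" "ball x s \<subseteq> closure \<Omega>"
        using x by (auto simp: mem_interior)
      define t where "t = min r s / 2"
      have t: "t > 0" "t < r" "t < s" using r s by (auto simp: t_def)
      \<comment> \<open>\<open>x\<close> lies on or below the graph and \<open>d\<close> is the
        vertical direction of the local coordinates, so \<open>y\<close> is strictly below the graph
        but still in the ball contained in the closure.\<close>
      define y where "y = x - t *\<^sub>R d"
      have dy: "dist x y = t" using nd t by (simp add: y_def dist_norm)
      define W where "W = ball x r \<inter> {y. snd (R y) < \<gamma> (fst (R y))}"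
      have "open {y. snd (R y) < \<gamma> (fst (R y))}"
        by (intro open_Collect_less continuous_intros continuous_on_compose2[OF cont\<gamma>]
            continuous_on_compose2[OF continuous_on_fst] continuous_on_snd contR) auto
      then have "open W" unfolding W_def by (rule open_Int[OF open_ball])
      moreover have "y \<in> W"
        using ge t dy linR d by (simp add: W_def y_def linear_diff linear_scale)
      moreover have "W \<inter> \<Omega> = {}"
        using eq unfolding W_def by (auto simp: set_eq_iff) (metis not_less_iff_gr_or_eq)
      ultimately have "y \<notin> closure \<Omega>"
        by (metis disjoint_iff open_Int_closure_eq_empty)
      then show False using s dy t by auto
    qed
  qed
qed

section \<open>Edges and outward normals of a single rectangle\<close>

lemma face_of_Icc_iff:
  fixes a b :: real
  assumes "a < b"
  shows "F face_of {a..b} \<longleftrightarrow> F = {} \<or> F = {a} \<or> F = {b} \<or> F = {a..b}"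
proof
  assume F: "F face_of {a..b}"
  show "F = {} \<or> F = {a} \<or> F = {b} \<or> F = {a..b}"
  proof (cases "F = {a..b}")
    case False
    have sub: "F \<subseteq> {a..b}" by (rule face_of_imp_subset[OF F])
    have "F \<inter> {a<..<b} = {}"
    proof (rule ccontr)
      assume "F \<inter> {a<..<b} \<noteq> {}"
      then have "{a..b} \<subseteq> F"
        using subset_of_face_of[OF F, of "{a..b}"] assms by (simp add: rel_interior_real_box)
      with sub False show False by blast
    qed
    then have "F \<subseteq> {a, b}" using sub by force
    moreover have "F \<noteq> {a, b}"
    proof
      assume "F = {a, b}"
      then have "convex {a, b}" using face_of_imp_convex[OF F] by simp
      then have "midpoint a b \<in> {a, b}"
        by (simp only: convex_contains_segment) (meson insertI1 insert_iff midpoint_in_closed_segment subsetD)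
      then show False using assms by (auto simp: midpoint_def)
    qed
    ultimately show ?thesis by blast
  qed auto
next
  assume "F = {} \<or> F = {a} \<or> F = {b} \<or> F = {a..b}"
  moreover have "{a} face_of {a..b}" "{b} face_of {a..b}"
    using assms by (auto simp: face_of_singleton extreme_point_of_def open_segment_eq_real_ivl split: if_splits)
  moreover have "{a..b} face_of {a..b}" by (simp add: face_of_refl)
  ultimately show "F face_of {a..b}" by auto
qed

definition rectangle_edges :: "real \<Rightarrow> real \<Rightarrow> real \<Rightarrow> real \<Rightarrow> plane set set" where
  "rectangle_edges a b c d = {{a} \<times> {c..d}, {b} \<times> {c..d}, {a..b} \<times> {c}, {a..b} \<times> {d}}"

lemma aff_dim_rectangle:
  fixes a b c d :: real
  shows "aff_dim ({a} \<times> {c}) = 0" "c < d \<Longrightarrow> aff_dim ({a} \<times> {c..d}) = 1"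
   "a < b \<Longrightarrow> aff_dim ({a..b} \<times> {c}) = 1" "a < b \<Longrightarrow> c < d \<Longrightarrow> aff_dim ({a..b} \<times> {c..d}) = 2"
proof -
  show "aff_dim ({a} \<times> {c}) = 0" by simp
  show "aff_dim ({a} \<times> {c..d}) = 1" if "c < d"
  proof -
    have "{a} \<times> {c..d} = closed_segment (a, c) (a, d)"
      using that by (auto simp: closed_segment_PairD closed_segment_eq_real_ivl closed_segment_same_fst)
    then show ?thesis using that by (simp add: segment_convex_hull aff_dim_convex_hull aff_dim_2)
  qed
  show "aff_dim ({a..b} \<times> {c}) = 1" if "a < b"
  proof -
    have "{a..b} \<times> {c} = closed_segment (a, c) (b, c)"
      using that by (auto simp: closed_segment_eq_real_ivl closed_segment_same_snd)
    then show ?thesis using that by (simp add: segment_convex_hull aff_dim_convex_hull aff_dim_2)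
  qed
  show "aff_dim ({a..b} \<times> {c..d}) = 2" if "a < b" "c < d"
  proof -
    have "interior ({a..b} \<times> {c..d}) \<noteq> {}" using that by (simp add: interior_Times)
    then show ?thesis using aff_dim_nonempty_interior by force
  qed
qed

text \<open>Faces of a product are products of faces. Of the nine nonempty candidates, affine
  dimension 1 leaves the four sides.\<close>

lemma edge_of_rectangle_iff:
  fixes a b c d :: real
  assumes "a < b" "c < d"
  shows "e edge_of {a..b} \<times> {c..d} \<longleftrightarrow> e \<in> rectangle_edges a b c d"
proof
  assume e: "e edge_of {a..b} \<times> {c..d}"
  then obtain F G where FG: "F face_of {a..b}" "G face_of {c..d}" "e = F \<times> G"
    unfolding edge_of_def face_of_Times_decomp by blast
  moreover have "aff_dim e = 1" using e by (simp add: edge_of_def)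
  ultimately show "e \<in> rectangle_edges a b c d"
    using aff_dim_rectangle assms unfolding face_of_Icc_iff[OF assms(1)] face_of_Icc_iff[OF assms(2)] rectangle_edges_def
    by auto
next
  assume "e \<in> rectangle_edges a b c d"
  then show "e edge_of {a..b} \<times> {c..d}"
    unfolding edge_of_def rectangle_edges_def
    using assms by (auto simp: aff_dim_rectangle face_of_Times face_of_Icc_iff)
qed

text \<open>Sums over edges range over a set, so they expand into four terms only when no two sides
  coincide.\<close>

lemma rectangle_edges_distinct:
  fixes a b c d :: real
  assumes "a < b" "c < d"
  shows "{a} \<times> {c..d} \<noteq> {b} \<times> {c..d}" "{a} \<times> {c..d} \<noteq> {a..b} \<times> {c}" "{a} \<times> {c..d} \<noteq> {a..b} \<times> {d}"
    "{b} \<times> {c..d} \<noteq> {a..b} \<times> {c}" "{b} \<times> {c..d} \<noteq> {a..b} \<times> {d}" "{a..b} \<times> {c} \<noteq> {a..b} \<times> {d}"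
proof -
  have ne: "\<not> {c..d} \<subseteq> {c}" "\<not> {c..d} \<subseteq> {d}" "a \<noteq> b" "c \<noteq> d" "{a..b} \<noteq> {}" "{c..d} \<noteq> {}"
    using assms by (auto simp: subset_iff intro: exI[of _ c] exI[of _ d])
  then show "{a} \<times> {c..d} \<noteq> {b} \<times> {c..d}" "{a} \<times> {c..d} \<noteq> {a..b} \<times> {c}" "{a} \<times> {c..d} \<noteq> {a..b} \<times> {d}"
    "{b} \<times> {c..d} \<noteq> {a..b} \<times> {c}" "{b} \<times> {c..d} \<noteq> {a..b} \<times> {d}" "{a..b} \<times> {c} \<noteq> {a..b} \<times> {d}"
    unfolding times_eq_iff by auto
qed

lemma outward_normal_eqI:
  assumes "norm n = 1" "\<And>x y. x \<in> e \<Longrightarrow> y \<in> K \<Longrightarrow> n \<bullet> (y - x) \<le> 0"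
    and "\<And>m. norm m = 1 \<Longrightarrow> (\<And>x y. x \<in> e \<Longrightarrow> y \<in> K \<Longrightarrow> m \<bullet> (y - x) \<le> 0) \<Longrightarrow> m = n"
  shows "outward_normal K e = n"
  unfolding outward_normal_def
  by (rule the_equality) (use assms in blast)+

text \<open>The definite description in \<open>outward_normal\<close> has a unique solution:
  differences along the side, taken in both directions, kill the tangential component of a
  candidate, a point of the opposite side fixes its sign, and the unit norm its size.\<close>

lemma outward_normal_rectangle:
  fixes a b c d :: real
  assumes "a < b" "c < d"
  shows "outward_normal ({a..b} \<times> {c..d}) ({a} \<times> {c..d}) = (-1, 0)"
    "outward_normal ({a..b} \<times> {c..d}) ({b} \<times> {c..d}) = (1, 0)"
    "outward_normal ({a..b} \<times> {c..d}) ({a..b} \<times> {c}) = (0, -1)"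
    "outward_normal ({a..b} \<times> {c..d}) ({a..b} \<times> {d}) = (0, 1)"
proof -
  show "outward_normal ({a..b} \<times> {c..d}) ({a} \<times> {c..d}) = (-1, 0)"
  proof (rule outward_normal_eqI)
    fix m :: plane
    assume m: "norm m = 1" "\<And>x y. x \<in> {a} \<times> {c..d} \<Longrightarrow> y \<in> {a..b} \<times> {c..d} \<Longrightarrow> m \<bullet> (y - x) \<le> 0"
    obtain p q where pq: "m = (p, q)" by force
    have "q * (d - c) \<le> 0" "q * (c - d) \<le> 0" "p * (b - a) \<le> 0"
      using m(2)[of "(a, c)" "(a, d)"] m(2)[of "(a, d)" "(a, c)"] m(2)[of "(a, c)" "(b, c)"] assms
      by (auto simp: pq inner_prod_def)
    then have "q = 0" "p \<le> 0" using assms by (auto simp: mult_le_0_iff)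
    then show "m = (-1, 0)" using m(1) by (auto simp: pq)
  qed (auto simp: inner_prod_def)
  show "outward_normal ({a..b} \<times> {c..d}) ({b} \<times> {c..d}) = (1, 0)"
  proof (rule outward_normal_eqI)
    fix m :: plane
    assume m: "norm m = 1" "\<And>x y. x \<in> {b} \<times> {c..d} \<Longrightarrow> y \<in> {a..b} \<times> {c..d} \<Longrightarrow> m \<bullet> (y - x) \<le> 0"
    obtain p q where pq: "m = (p, q)" by force
    have "q * (d - c) \<le> 0" "q * (c - d) \<le> 0" "p * (a - b) \<le> 0"
      using m(2)[of "(b, c)" "(b, d)"] m(2)[of "(b, d)" "(b, c)"] m(2)[of "(b, c)" "(a, c)"] assms
      by (auto simp: pq inner_prod_def)
    then have "q = 0" "p \<ge> 0" using assms by (auto simp: mult_le_0_iff)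
    then show "m = (1, 0)" using m(1) by (auto simp: pq)
  qed (auto simp: inner_prod_def)
  show "outward_normal ({a..b} \<times> {c..d}) ({a..b} \<times> {c}) = (0, -1)"
  proof (rule outward_normal_eqI)
    fix m :: plane
    assume m: "norm m = 1" "\<And>x y. x \<in> {a..b} \<times> {c} \<Longrightarrow> y \<in> {a..b} \<times> {c..d} \<Longrightarrow> m \<bullet> (y - x) \<le> 0"
    obtain p q where pq: "m = (p, q)" by force
    have "p * (b - a) \<le> 0" "p * (a - b) \<le> 0" "q * (d - c) \<le> 0"
      using m(2)[of "(a, c)" "(b, c)"] m(2)[of "(b, c)" "(a, c)"] m(2)[of "(a, c)" "(a, d)"] assms
      by (auto simp: pq inner_prod_def)
    then have "p = 0" "q \<le> 0" using assms by (auto simp: mult_le_0_iff)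
    then show "m = (0, -1)" using m(1) by (auto simp: pq)
  qed (auto simp: inner_prod_def)
  show "outward_normal ({a..b} \<times> {c..d}) ({a..b} \<times> {d}) = (0, 1)"
  proof (rule outward_normal_eqI)
    fix m :: plane
    assume m: "norm m = 1" "\<And>x y. x \<in> {a..b} \<times> {d} \<Longrightarrow> y \<in> {a..b} \<times> {c..d} \<Longrightarrow> m \<bullet> (y - x) \<le> 0"
    obtain p q where pq: "m = (p, q)" by force
    have "p * (b - a) \<le> 0" "p * (a - b) \<le> 0" "q * (c - d) \<le> 0"
      using m(2)[of "(a, d)" "(b, d)"] m(2)[of "(b, d)" "(a, d)"] m(2)[of "(a, d)" "(a, c)"] assms
      by (auto simp: pq inner_prod_def)
    then have "p = 0" "q \<ge> 0" using assms by (auto simp: mult_le_0_iff)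
    then show "m = (0, 1)" using m(1) by (auto simp: pq)
  qed (auto simp: inner_prod_def)
qed

text \<open>The local picture at a relative interior point of a side: the half disc behind the side
  belongs to the rectangle. Whether elements overlap or cover a neighbourhood is decided with such
  half discs.\<close>

lemma rectangle_half_ball:
  fixes a b c d :: real
  assumes "a < b" "c < d" and K: "K = {a..b} \<times> {c..d}" and e: "e edge_of K" and x: "x \<in> rel_interior e"
  obtains r where "r > 0" "\<And>y. y \<in> ball x r \<Longrightarrow> outward_normal K e \<bullet> (y - x) \<le> 0 \<Longrightarrow> y \<in> K"
proof -
  note half = that
  obtain p q where pq: "x = (p, q)" by force
  have near: "\<bar>fst y - p\<bar> < r \<and> \<bar>snd y - q\<bar> < r" if "y \<in> ball x r" for y r
  proof -
    have "norm (fst (y - x)) \<le> norm (y - x)" "norm (snd (y - x)) \<le> norm (y - x)"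
      by (metis norm_fst_le norm_snd_le prod.collapse)+
    moreover have "norm (y - x) < r" using that by (simp add: dist_norm norm_minus_commute)
    ultimately show ?thesis by (auto simp: pq)
  qed
  \<comment> \<open>The Euclidean ball lies in the square of half-width \<open>r\<close>, so each
    side can be handled coordinatewise.\<close>
  have *: thesis
    if "r > 0" "outward_normal K e = (m, n)"
      "\<And>s t. \<bar>s - p\<bar> < r \<Longrightarrow> \<bar>t - q\<bar> < r \<Longrightarrow> m * (s - p) + n * (t - q) \<le> 0 \<Longrightarrow> a \<le> s \<and> s \<le> b \<and> c \<le> t \<and> t \<le> d" for r m n
  proof (rule half)
    fix y assume "y \<in> ball x r" "outward_normal K e \<bullet> (y - x) \<le> 0"
    then show "y \<in> K" using that(2) that(3)[of "fst y" "snd y"] near[of y r]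
      by (simp add: K pq inner_prod_def mem_Times_iff)
  qed (rule that(1))
  consider "e = {a} \<times> {c..d}" | "e = {b} \<times> {c..d}" | "e = {a..b} \<times> {c}" | "e = {a..b} \<times> {d}"
    using e edge_of_rectangle_iff[OF assms(1,2)] unfolding K rectangle_edges_def by blast
  then show thesis
  proof cases
    case 1
    then have "p = a" "c < q" "q < d" using x assms(2) by (auto simp: pq rel_interior_Times)
    \<comment> \<open>In this and the following cases the radius is the distance from
      \<open>x\<close> to the nearest of the other three side lines.\<close>
    then show ?thesis
      using assms(1) by (intro *[of "min (b - a) (min (q - c) (d - q))" "-1" 0])
        (auto simp: K 1 outward_normal_rectangle[OF assms(1,2)])
  next
    case 2
    then have "p = b" "c < q" "q < d" using x assms(2) by (auto simp: pq rel_interior_Times)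
    then show ?thesis
      using assms(1) by (intro *[of "min (b - a) (min (q - c) (d - q))" 1 0])
        (auto simp: K 2 outward_normal_rectangle[OF assms(1,2)])
  next
    case 3
    then have "q = c" "a < p" "p < b" using x assms(1) by (auto simp: pq rel_interior_Times)
    then show ?thesis
      using assms(2) by (intro *[of "min (d - c) (min (p - a) (b - p))" 0 "-1"])
        (auto simp: K 3 outward_normal_rectangle[OF assms(1,2)])
  next
    case 4
    then have "q = d" "a < p" "p < b" using x assms(1) by (auto simp: pq rel_interior_Times)
    then show ?thesis
      using assms(2) by (intro *[of "min (d - c) (min (p - a) (b - p))" 0 1])
        (auto simp: K 4 outward_normal_rectangle[OF assms(1,2)])
  qed
qed

lemma rectangle_edge_normal:
  fixes a b c d :: real
  assumes "a < b" "c < d" and K: "K = {a..b} \<times> {c..d}" and e: "e edge_of K"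
  shows "norm (outward_normal K e) = 1"
    and "\<And>x y. x \<in> e \<Longrightarrow> y \<in> K \<Longrightarrow> outward_normal K e \<bullet> (y - x) \<le> 0"
  using e unfolding K edge_of_rectangle_iff[OF assms(1,2)] rectangle_edges_def
  by (auto simp: outward_normal_rectangle[OF assms(1,2)])

lemma rectangular_mesh_rectangle:
  assumes "rectangular_mesh \<Omega> T" "K \<in> T"
  obtains a b c d where "a < b" "c < d" "K = {a..b} \<times> {c..d}"
proof -
  obtain l u where lu: "K = cbox l u"
    using assms unfolding rectangular_mesh_def by (auto dest: division_ofD(4))
  obtain a b c d where "l = (a, c)" "u = (b, d)" by force
  then have K: "K = {a..b} \<times> {c..d}" by (simp add: lu cbox_Pair_eq)
  have "interior K \<noteq> {}" using assms by (simp add: rectangular_mesh_def)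
  then have "a < b" "c < d" by (auto simp: K interior_Times)
  then show thesis using that K by blast
qed

section \<open>Interior and boundary edges of a conforming mesh\<close>

locale coarse_mesh =
  fixes \<Omega> :: "plane set" and T :: "plane set set"
  assumes lipschitz: "lipschitz_domain \<Omega>"
    and mesh: "rectangular_mesh \<Omega> T"
    and conf: "conforming T"
begin

lemma open_domain: "open \<Omega>"
  using lipschitz by (simp add: lipschitz_domain_def)

lemma interior_closure_domain: "interior (closure \<Omega>) = \<Omega>"
  by (rule interior_closure_lipschitz_domain[OF lipschitz])

lemma finite_mesh: "finite T"
  and Union_mesh: "\<Union>T = closure \<Omega>"
  and interior_element_ne: "K \<in> T \<Longrightarrow> interior K \<noteq> {}"
  and disjoint_interiors: "K \<in> T \<Longrightarrow> K' \<in> T \<Longrightarrow> K \<noteq> K' \<Longrightarrow> interior K \<inter> interior K' = {}"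
  using mesh unfolding rectangular_mesh_def by (auto dest: division_ofD)

lemma element_rectangle:
  assumes "K \<in> T"
  obtains a b c d where "a < b" "c < d" "K = {a..b} \<times> {c..d}"
  using rectangular_mesh_rectangle[OF mesh assms] .

lemma element_subset: "K \<in> T \<Longrightarrow> K \<subseteq> closure \<Omega>"
  using Union_mesh by blast

lemma closed_element: "K \<in> T \<Longrightarrow> closed K"
  by (metis element_rectangle closed_Times closed_real_atLeastAtMost)

lemma convex_element: "K \<in> T \<Longrightarrow> convex K"
  by (metis element_rectangle convex_Times convex_real_interval(5))

lemma closure_interior_element: "K \<in> T \<Longrightarrow> closure (interior K) = K"
  using convex_closure_interior[OF convex_element interior_element_ne] closed_element by simp

lemma interior_element_subset: "K \<in> T \<Longrightarrow> interior K \<subseteq> \<Omega>"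
  using interior_mono[OF element_subset] interior_closure_domain by simp

lemma edge_half_ball:
  assumes "K \<in> T" "e edge_of K" "x \<in> rel_interior e"
  obtains r where "r > 0" "\<And>y. y \<in> ball x r \<Longrightarrow> outward_normal K e \<bullet> (y - x) \<le> 0 \<Longrightarrow> y \<in> K"
  by (rule element_rectangle[OF assms(1)], rule rectangle_half_ball[OF _ _ _ assms(2,3)]) (auto intro: that)

lemma edge_normal_unit:
  assumes "K \<in> T" "e edge_of K"
  shows "norm (outward_normal K e) = 1" 
  by (rule element_rectangle[OF assms(1)], rule rectangle_edge_normal(1)[OF _ _ _ assms(2)])

lemma edge_normal_le:
  assumes "K \<in> T" "e edge_of K" "x \<in> e" "y \<in> K"
  shows "outward_normal K e \<bullet> (y - x) \<le> 0"
  by (rule element_rectangle[OF assms(1)], rule rectangle_edge_normal(2)[OF _ _ _ assms(2-4)])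

lemma edge_rel_interior_ne:
  assumes "e edge_of K"
  shows "rel_interior e \<noteq> {}"
proof -
  have "convex e" using assms face_of_imp_convex unfolding edge_of_def by blast
  moreover have "e \<noteq> {}" using assms unfolding edge_of_def by auto
  ultimately show ?thesis by (simp add: rel_interior_eq_empty)
qed

text \<open>If the normals were not opposite, the two half balls at a point of the edge would overlap.\<close>

lemma opposite_normals:
  assumes K: "K \<in> T" "e edge_of K" and K': "K' \<in> T" "e edge_of K'" and ne: "K \<noteq> K'"
  shows "outward_normal K' e = - outward_normal K e"
proof (rule ccontr)
  let ?n = "outward_normal K e" and ?n' = "outward_normal K' e"
  assume ass: "?n' \<noteq> - ?n"
  have unit: "norm ?n = 1" "norm ?n' = 1" using edge_normal_unit K K' by auto
  then have nn: "?n \<bullet> ?n = 1" "?n' \<bullet> ?n' = 1" by (simp_all add: dot_square_norm)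
  \<comment> \<open>The squared length of \<open>?n + ?n'\<close> is twice
    \<open>1 + ?n \<bullet> ?n'\<close>; when it is positive, the direction opposite to the sum
    points strictly into both half planes.\<close>
  have "0 < (?n + ?n') \<bullet> (?n + ?n')" using ass by (metis add.commute add_eq_0_iff inner_gt_zero_iff)
  then have pos: "1 + ?n \<bullet> ?n' > 0" by (simp add: inner_add inner_commute nn)
  obtain x where x: "x \<in> rel_interior e" using edge_rel_interior_ne[OF K(2)] by blast
  obtain r where r: "r > 0" "\<And>y. y \<in> ball x r \<Longrightarrow> ?n \<bullet> (y - x) \<le> 0 \<Longrightarrow> y \<in> K"
    using edge_half_ball[OF K x] by blast
  obtain r' where r': "r' > 0" "\<And>y. y \<in> ball x r' \<Longrightarrow> ?n' \<bullet> (y - x) \<le> 0 \<Longrightarrow> y \<in> K'"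
    using edge_half_ball[OF K' x] by blast
  let ?W = "ball x (min r r') \<inter> {y. ?n \<bullet> (y - x) < 0} \<inter> {y. ?n' \<bullet> (y - x) < 0}"
  have "open ?W"
    by (intro open_Int open_ball open_Collect_less continuous_intros)
  moreover have "?W \<subseteq> K" "?W \<subseteq> K'" using r r' by auto
  ultimately have "?W \<subseteq> interior K \<inter> interior K'" by (meson interior_maximal le_inf_iff)
  then have empty: "?W = {}" using disjoint_interiors[OF K(1) K'(1) ne] by blast
  \<comment> \<open>The sum of the two unit normals has length at most 2, so a quarter of the
    smaller radius keeps \<open>y\<close> inside both balls.\<close>
  define t where "t = min r r' / 4"
  have t: "t > 0" "4 * t \<le> r" "4 * t \<le> r'" using r(1) r'(1) by (auto simp: t_def)
  define y where "y = x - t *\<^sub>R (?n + ?n')"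
  have "norm (?n + ?n') \<le> 2" using norm_triangle_ineq[of ?n ?n'] unit by simp
  then have "t * norm (?n + ?n') \<le> t * 2" using t by (intro mult_left_mono) auto
  then have "t * norm (?n + ?n') < r" "t * norm (?n + ?n') < r'" using t by linarith+
  then have "dist x y < r" "dist x y < r'" using t(1) by (auto simp: y_def dist_norm)
  moreover have "?n \<bullet> (y - x) = - (t * (1 + ?n \<bullet> ?n'))" "?n' \<bullet> (y - x) = - (t * (1 + ?n \<bullet> ?n'))"
    by (simp_all add: y_def inner_add nn inner_commute algebra_simps)
  moreover have "t * (1 + ?n \<bullet> ?n') > 0" using t pos by simp
  ultimately have "y \<in> ?W" by simp
  then show False using empty by blast
qed

text \<open>Two half balls with opposite normals cover a full ball, which therefore lies in the
  closure of the domain; its centre is then in \<Omega> because \<Omega> is the interior of its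
  closure.\<close>

lemma shared_edge_interior:
  assumes K: "K \<in> T" "e edge_of K" and K': "K' \<in> T" "e edge_of K'" and ne: "K \<noteq> K'"
  shows "rel_interior e \<subseteq> \<Omega>"
proof
  fix x assume x: "x \<in> rel_interior e"
  obtain r where r: "r > 0" "\<And>y. y \<in> ball x r \<Longrightarrow> outward_normal K e \<bullet> (y - x) \<le> 0 \<Longrightarrow> y \<in> K"
    using edge_half_ball[OF K x] by blast
  obtain r' where r': "r' > 0" "\<And>y. y \<in> ball x r' \<Longrightarrow> outward_normal K' e \<bullet> (y - x) \<le> 0 \<Longrightarrow> y \<in> K'"
    using edge_half_ball[OF K' x] by blast
  have "ball x (min r r') \<subseteq> closure \<Omega>"
  proof
    fix y assume y: "y \<in> ball x (min r r')"
    have "outward_normal K e \<bullet> (y - x) \<le> 0 \<or> outward_normal K' e \<bullet> (y - x) \<le> 0"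
      unfolding opposite_normals[OF assms] inner_minus_left by linarith
    then have "y \<in> K \<or> y \<in> K'" using r(2)[of y] r'(2)[of y] y by auto
    then show "y \<in> closure \<Omega>" using element_subset K K' by blast
  qed
  moreover have "min r r' > 0" using r r' by simp
  ultimately have "x \<in> interior (closure \<Omega>)" unfolding mem_interior by blast
  then show "x \<in> \<Omega>" by (simp add: interior_closure_domain)
qed

text \<open>A point just across the edge lies in \<Omega>, hence in some other element. Conformity
  makes its intersection with \<open>K\<close> a proper face of \<open>K\<close> that contains
  \<open>e\<close>, hence of dimension 1 and equal to \<open>e\<close>.\<close>

lemma shared_edgeI:
  assumes K: "K \<in> T" "e edge_of K" and x: "x \<in> rel_interior e" "x \<in> \<Omega>"
  obtains K' where "K' \<in> T" "e edge_of K'" "K' \<noteq> K"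
proof -
  let ?n = "outward_normal K e"
  \<comment> \<open>Finitely many closed elements miss \<open>x\<close>; staying away from their
    union guarantees that the element found across the edge contains \<open>x\<close>.\<close>
  let ?C = "\<Union>{K' \<in> T. x \<notin> K'}"
  have "closed ?C" using finite_mesh closed_element by (intro closed_Union) auto
  then have "open (\<Omega> - ?C)" using open_domain by (rule open_Diff[rotated])
  moreover have "x \<in> \<Omega> - ?C" using x by blast
  ultimately obtain r where r: "r > 0" "ball x r \<subseteq> \<Omega> - ?C" by (meson open_contains_ball)
  define y where "y = x + (r/2) *\<^sub>R ?n"
  have un: "norm ?n = 1" by (rule edge_normal_unit[OF K])
  have "dist x y < r" using r un by (simp add: y_def dist_norm)
  then have y: "y \<in> \<Omega>" "y \<notin> ?C" using r by auto
  then obtain K' where K': "K' \<in> T" "y \<in> K'" using Union_mesh closure_subset by blast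
  then have xK': "x \<in> K'" using y by blast
  have "?n \<bullet> (y - x) > 0" using r un by (simp add: y_def dot_square_norm)
  moreover have xe: "x \<in> e" using x rel_interior_subset by blast
  ultimately have "y \<notin> K" using edge_normal_le[OF K] by (meson not_less)
  then have ne: "K' \<noteq> K" using K' by blast
  have f: "(K \<inter> K') face_of K" "(K \<inter> K') face_of K'"
    using conf K(1) K'(1) unfolding conforming_def by blast+
  have eK: "e face_of K" "aff_dim e = 1" using K unfolding edge_of_def by auto
  have "x \<in> K" using xe eK face_of_imp_subset by blast
  \<comment> \<open>A face that meets the relative interior of a convex subset contains the whole
    subset; one common point \<open>x\<close> is enough.\<close>
  then have esub: "e \<subseteq> K \<inter> K'"
    using subset_of_face_of[OF f(1) face_of_imp_subset[OF eK(1)]] x xK' by blast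
  have "K \<inter> K' \<noteq> K"
  proof
    assume "K \<inter> K' = K"
    then have "interior K \<subseteq> interior K'" by (metis inf.cobounded2 interior_mono)
    then show False using disjoint_interiors[OF K(1) K'(1)] ne interior_element_ne[OF K(1)] by blast
  qed
  then have "aff_dim (K \<inter> K') < aff_dim K"
    using face_of_aff_dim_lt[OF convex_element[OF K(1)] f(1)] by blast
  moreover have "aff_dim K \<le> 2" using aff_dim_le_DIM[of K] by simp
  ultimately have "aff_dim (K \<inter> K') \<le> 1" by simp
  moreover have "e face_of (K \<inter> K')" by (rule face_of_subset[OF eK(1) esub]) simp
  moreover have "convex (K \<inter> K')" using convex_element K(1) K'(1) by (simp add: convex_Int)
  ultimately have "e = K \<inter> K'" using face_of_aff_dim_lt[of "K \<inter> K'" e] eK(2) by fastforce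
  then have "e edge_of K'" using f(2) eK(2) unfolding edge_of_def by simp
  then show thesis using that K'(1) ne by blast
qed

text \<open>A third adjacent element would have a normal opposite to two normals that are themselves
  opposite, so a unit vector would equal its own negative.\<close>

lemma adjacent_interior_edge:
  assumes "e \<in> interior_edges \<Omega> T" "K \<in> adjacent T e"
  obtains K' where "adjacent T e = {K, K'}" "K' \<noteq> K" "outward_normal K' e = - outward_normal K e"
proof -
  have K: "K \<in> T" "e edge_of K" using assms(2) by (auto simp: adjacent_def)
  obtain x where x: "x \<in> rel_interior e" using edge_rel_interior_ne[OF K(2)] by blast
  moreover have "rel_interior e \<subseteq> \<Omega>" using assms(1) by (simp add: interior_edges_def)
  ultimately obtain K' where K': "K' \<in> T" "e edge_of K'" "K' \<noteq> K"
    using shared_edgeI[OF K] by blast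
  have opp: "outward_normal K' e = - outward_normal K e"
    using opposite_normals K K' by blast
  have "L = K \<or> L = K'" if L: "L \<in> T" "e edge_of L" for L
  proof (rule ccontr)
    assume "\<not> ?thesis"
    then have "outward_normal L e = - outward_normal K e" "outward_normal L e = - outward_normal K' e"
      using opposite_normals L K K' by blast+
    then have "outward_normal K e = - outward_normal K e" using opp by simp
    then have "outward_normal K e = 0" by (metis add.right_inverse scaleR_2 scaleR_eq_0_iff zero_neq_numeral)
    then show False using edge_normal_unit[OF K] by simp
  qed
  then have "adjacent T e = {K, K'}" using K K' by (auto simp: adjacent_def)
  then show thesis using that K' opp by blast
qed

text \<open>All or nothing: one relative interior point of the edge in \<Omega> produces a second
  element, and a second element puts the whole relative interior into \<Omega>. An edge that is not
  interior therefore misses \<Omega> altogether, being the closure of its relative interior.\<close>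

lemma adjacent_outer_edge:
  assumes "e \<in> mesh_edges T" "e \<notin> interior_edges \<Omega> T"
  obtains K where "adjacent T e = {K}" "e \<in> boundary_edges \<Omega> T"
proof -
  obtain K where K: "K \<in> T" "e edge_of K" using assms(1) by (auto simp: mesh_edges_def)
  have nsub: "\<not> rel_interior e \<subseteq> \<Omega>" using assms by (simp add: interior_edges_def)
  have disj: "rel_interior e \<inter> \<Omega> = {}"
  proof (rule ccontr)
    assume "rel_interior e \<inter> \<Omega> \<noteq> {}"
    then obtain K' where "K' \<in> T" "e edge_of K'" "K' \<noteq> K"
      using shared_edgeI[OF K] by blast
    then show False using shared_edge_interior K nsub by blast
  qed
  have "convex e" "closed e"
    using K convex_element closed_element face_of_imp_convex face_of_imp_closed unfolding edge_of_def by blast+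
  then have "e = closure (rel_interior e)" by (simp add: convex_closure_rel_interior)
  moreover have "closure (rel_interior e) \<inter> \<Omega> = {}"
    using disj open_domain by (metis inf_commute open_Int_closure_eq_empty)
  moreover have "e \<subseteq> closure \<Omega>"
    using K element_subset face_of_imp_subset unfolding edge_of_def by blast
  ultimately have "e \<subseteq> frontier \<Omega>" using open_domain by (auto simp: frontier_def interior_open)
  then have "e \<in> boundary_edges \<Omega> T" using assms(1) by (simp add: boundary_edges_def)
  moreover have "adjacent T e = {K}"
    using K shared_edge_interior nsub by (auto simp: adjacent_def)
  ultimately show thesis using that by blast
qed

text \<open>The two kinds of edges are defined independently, one through \<Omega> and one through
  its frontier; only the geometry of the mesh makes them complementary.\<close>

lemma boundary_edges_eq: "boundary_edges \<Omega> T = mesh_edges T - interior_edges \<Omega> T"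
proof
  show "mesh_edges T - interior_edges \<Omega> T \<subseteq> boundary_edges \<Omega> T"
    using adjacent_outer_edge by blast
  show "boundary_edges \<Omega> T \<subseteq> mesh_edges T - interior_edges \<Omega> T"
  proof
    fix e assume e: "e \<in> boundary_edges \<Omega> T"
    then obtain K where "e edge_of K" by (auto simp: boundary_edges_def mesh_edges_def)
    then obtain x where "x \<in> rel_interior e" using edge_rel_interior_ne by blast
    moreover have "\<Omega> \<inter> frontier \<Omega> = {}" using open_domain by (auto simp: frontier_def interior_open)
    ultimately have "\<not> rel_interior e \<subseteq> \<Omega>" using e rel_interior_subset by (force simp: boundary_edges_def)
    then show "e \<in> mesh_edges T - interior_edges \<Omega> T"
      using e by (simp add: boundary_edges_def interior_edges_def)
  qed
qed

lemma finite_edges_of: 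
  assumes "K \<in> T"
  shows "finite {e. e edge_of K}"
proof -
  obtain a b c d where "a < b" "c < d" "K = {a..b} \<times> {c..d}" by (rule element_rectangle[OF assms])
  then have "{e. e edge_of K} = rectangle_edges a b c d" using edge_of_rectangle_iff by blast
  then show ?thesis by (simp add: rectangle_edges_def)
qed

lemma finite_mesh_edges: "finite (mesh_edges T)"
proof -
  have "mesh_edges T = (\<Union>K\<in>T. {e. e edge_of K})" by (auto simp: mesh_edges_def)
  then show ?thesis using finite_mesh finite_edges_of by simp
qed

text \<open>Double counting of incidences, used to collect the boundary fluxes of all elements edge
  by edge.\<close>

lemma sum_elements_edges:
  "(\<Sum>K\<in>T. \<Sum>e | e edge_of K. f K e) = (\<Sum>e\<in>mesh_edges T. \<Sum>K\<in>adjacent T e. f K e)"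
proof -
  have "(\<Sum>K\<in>T. \<Sum>e | e edge_of K. f K e) = (\<Sum>K\<in>T. \<Sum>e | e \<in> mesh_edges T \<and> e edge_of K. f K e)"
    by (intro sum.cong refl) (auto simp: mesh_edges_def)
  also have "\<dots> = (\<Sum>e\<in>mesh_edges T. \<Sum>K | K \<in> T \<and> e edge_of K. f K e)"
    by (rule sum.swap_restrict[OF finite_mesh finite_mesh_edges])
  finally show ?thesis by (simp add: adjacent_def)
qed

end

subsection \<open>The divergence theorem on a rectangle\<close>

text \<open>The forms integrate with respect to the completed measure \<open>lebesgue\<close>,
  whereas the Fubini arguments run over \<open>lborel\<close>; this is the passage between the
  two.\<close>

lemma set_integrable_lebesgue_of_lborel:
  fixes f :: "'a::euclidean_space \<Rightarrow> real"
  assumes "set_integrable lborel A f"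
  shows "set_integrable lebesgue A f" "(LINT x:A|lebesgue. f x) = (LINT x:A|lborel. f x)"
  using assms unfolding set_integrable_def set_lebesgue_integral_def
  by (simp_all add: integrable_completion integral_completion borel_measurable_integrable)

lemma set_integrable_continuous_compact:
  fixes f :: "'a::euclidean_space \<Rightarrow> real"
  assumes "compact S" "continuous_on S f" "A \<subseteq> S" "A \<in> sets borel"
  shows "set_integrable lborel A f"
proof -
  have "set_integrable lborel S f"
    using borel_integrable_compact[OF assms(1,2)] by (simp add: set_integrable_def)
  then show ?thesis by (rule set_integrable_subset) (use assms in auto)
qed

lemma affine_Icc:
  fixes c d t :: real
  assumes "c < d" "t \<in> {0..1}"
  shows "c + t * (d - c) \<in> {c..d}"
proof -
  define s where "s = t * (d - c)"
  have "0 \<le> s" "s \<le> d - c"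
    using assms mult_left_le_one_le[of "d - c" t] by (auto simp: s_def)
  then show ?thesis by (simp flip: s_def)
qed

text \<open>The affine substitution behind edge integrals; \<open>d - c\<close> is both its Jacobian
  and the length of the edge.\<close>

lemma LINT_affine_Icc:
  fixes g :: "real \<Rightarrow> real"
  assumes "c < d" "continuous_on {c..d} g"
  shows "(d - c) * (LINT t:{0..1}|lebesgue. g (c + t * (d - c))) = (LINT y:{c..d}|lborel. g y)"
proof -
  have "continuous_on {0..1} (\<lambda>t. g (c + t * (d - c)))"
  proof (rule continuous_on_compose2[OF assms(2)])
    show "(\<lambda>t. c + t * (d - c)) ` {0..1} \<subseteq> {c..d}"
      by (rule image_subsetI) (rule affine_Icc[OF assms(1)])
  qed (intro continuous_intros)
  then have "(LINT t:{0..1}|lebesgue. g (c + t * (d - c))) = (LINT t:{0..1}|lborel. g (c + t * (d - c)))"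
    by (intro set_integrable_lebesgue_of_lborel(2) set_integrable_continuous_compact[of "{0..1}"]) auto
  also have "\<dots> = (\<integral>t. indicator {c..d} (c + (d - c) * t) * g (c + (d - c) * t) \<partial>lborel)"
    unfolding set_lebesgue_integral_def
  proof (intro Bochner_Integration.integral_cong refl)
    fix t
    have "c + (d - c) * t \<in> {c..d} \<longleftrightarrow> t \<in> {0..1}"
    proof -
      have "c + (d - c) * t \<le> d \<longleftrightarrow> (d - c) * t \<le> (d - c) * 1"
        by (simp only: mult_1_right le_diff_eq add.commute[of c])
      also have "\<dots> \<longleftrightarrow> t \<le> 1" using assms(1) by (intro mult_le_cancel_left_pos) simp
      finally show ?thesis using assms(1) by (simp add: zero_le_mult_iff conj_commute)
    qed
    then show "indicator {0..1} t *\<^sub>R g (c + t * (d - c)) =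
        indicator {c..d} (c + (d - c) * t) * g (c + (d - c) * t)"
      by (simp add: indicator_def mult.commute)
  qed
  finally show ?thesis
    using assms(1) lborel_integral_real_affine[of "d - c" "\<lambda>y. indicator {c..d} y * g y" c]
    by (simp add: set_lebesgue_integral_def)
qed

lemma rectangle_edge_bounds:
  fixes a b c d :: real
  assumes "a \<le> b" "c \<le> d"
  shows "interval_lowerbound ({a} \<times> {c..d}) = (a, c)" "interval_upperbound ({a} \<times> {c..d}) = (a, d)"
    "interval_lowerbound ({a..b} \<times> {c}) = (a, c)" "interval_upperbound ({a..b} \<times> {c}) = (b, c)"
proof -
  have 1: "{a} \<times> {c..d} = cbox (a, c) (a, d)" and 2: "{a..b} \<times> {c} = cbox (a, c) (b, c)"
    by (simp_all add: cbox_Pair_eq)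
  show "interval_lowerbound ({a} \<times> {c..d}) = (a, c)" "interval_upperbound ({a} \<times> {c..d}) = (a, d)"
    unfolding 1 using assms by (subst interval_lowerbound interval_upperbound; auto simp: Basis_prod_def)+
  show "interval_lowerbound ({a..b} \<times> {c}) = (a, c)" "interval_upperbound ({a..b} \<times> {c}) = (b, c)"
    unfolding 2 using assms by (subst interval_lowerbound interval_upperbound; auto simp: Basis_prod_def)+
qed

lemma edge_param_rectangle:
  fixes a b c d :: real
  assumes "a \<le> b" "c \<le> d"
  shows "edge_param ({a} \<times> {c..d}) t = (a, c + t * (d - c))"
    "edge_param ({a..b} \<times> {c}) t = (a + t * (b - a), c)"
  by (simp_all add: edge_param_def rectangle_edge_bounds[OF assms] linepath_def algebra_simps)

lemma edge_integral_rectangle: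
  fixes a b c d :: real
  shows "c < d \<Longrightarrow> continuous_on {c..d} (\<lambda>y. f (a, y)) \<Longrightarrow>
      edge_integral ({a} \<times> {c..d}) f = (LINT y:{c..d}|lborel. f (a, y))"
    "a < b \<Longrightarrow> continuous_on {a..b} (\<lambda>x. f (x, c)) \<Longrightarrow>
      edge_integral ({a..b} \<times> {c}) f = (LINT x:{a..b}|lborel. f (x, c))"
proof -
  show "edge_integral ({a} \<times> {c..d}) f = (LINT y:{c..d}|lborel. f (a, y))"
    if "c < d" "continuous_on {c..d} (\<lambda>y. f (a, y))"
    using LINT_affine_Icc[OF that] that rectangle_edge_bounds(1,2)[of a a c d] edge_param_rectangle(1)[of a a c d]
    by (simp add: edge_integral_def dist_Pair_Pair dist_real_def)
  show "edge_integral ({a..b} \<times> {c}) f = (LINT x:{a..b}|lborel. f (x, c))"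
    if "a < b" "continuous_on {a..b} (\<lambda>x. f (x, c))"
    using LINT_affine_Icc[OF that] that rectangle_edge_bounds(3,4)[of a b c c] edge_param_rectangle(2)[of a b c c]
    by (simp add: edge_integral_def dist_Pair_Pair dist_real_def)
qed

section \<open>The fundamental theorem along lines and Fubini's theorem\<close>

lemma LINT_FTC_except_finite:
  fixes f f' :: "real \<Rightarrow> real"
  assumes "a < b" "finite N" "continuous_on {a..b} f" "set_integrable lborel {a..b} f'"
    "\<And>x. x \<in> {a<..<b} - N \<Longrightarrow> (f has_real_derivative f' x) (at x)"
  shows "(LINT x:{a..b}|lborel. f' x) = f b - f a"
proof -
  have "(f' has_integral (f b - f a)) {a..b}"
    by (rule fundamental_theorem_of_calculus_interior_strong[OF assms(2)])
      (use assms in \<open>auto simp: has_real_derivative_iff_has_vector_derivative\<close>)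
  then show ?thesis
    using set_borel_integral_eq_integral(2)[OF assms(4)] by (simp add: integral_unique)
qed

lemma AE_lborel_finite:
  fixes N :: "'a::euclidean_space set"
  assumes "finite N"
  shows "AE x in lborel. x \<notin> N"
  using assms finite_imp_null_set_lborel AE_not_in by blast

text \<open>By Fubini the integral is computed on horizontal lines. Almost every line has height
  outside \<open>N\<close> and an integrable slice; on it \<open>F\<close> is continuous and
  differentiable off finitely many points, so the fundamental theorem leaves the two end
  values.\<close>

lemma rectangle_FTC_fst:
  fixes F G :: "plane \<Rightarrow> real"
  assumes "a < b" "finite N" "continuous_on ({a..b} \<times> {c..d}) F"
    and G: "set_integrable lborel ({a..b} \<times> {c..d}) G"
    and deriv: "\<And>x y. x \<in> {a<..<b} - N \<Longrightarrow> y \<in> {c..d} - N \<Longrightarrow> ((\<lambda>s. F (s, y)) has_real_derivative G (x, y)) (at x)"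
  shows "(LINT p:{a..b} \<times> {c..d}|lborel. G p) = (LINT y:{c..d}|lborel. F (b, y) - F (a, y))"
proof -
  define H where "H x y = indicator ({a..b} \<times> {c..d}) (x, y) * G (x, y)" for x y
  have int: "integrable (lborel \<Otimes>\<^sub>M lborel) (case_prod H)"
    using G unfolding set_integrable_def lborel_prod H_def by (simp add: case_prod_unfold)
  have line: "(\<integral>x. H x y \<partial>lborel) = indicator {c..d} y * (F (b, y) - F (a, y))"
    if y: "y \<notin> N" "integrable lborel (\<lambda>x. H x y)" for y
  proof (cases "y \<in> {c..d}")
    case True
    then have H: "H x y = indicator {a..b} x * G (x, y)" for x
      by (auto simp: H_def indicator_def)
    have "(LINT x:{a..b}|lborel. G (x, y)) = F (b, y) - F (a, y)"
    proof (rule LINT_FTC_except_finite[OF assms(1,2)])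
      show "continuous_on {a..b} (\<lambda>s. F (s, y))"
        by (rule continuous_on_compose2[OF assms(3)]) (use True in \<open>auto intro!: continuous_intros\<close>)
      show "set_integrable lborel {a..b} (\<lambda>x. G (x, y))"
        using y(2) by (simp add: H set_integrable_def)
    qed (use deriv True y in auto)
    then show ?thesis using True by (simp add: H set_lebesgue_integral_def)
  next
    case False
    then have "H x y = 0" for x by (auto simp: H_def)
    then show ?thesis using False by simp
  qed
  have "AE y in lborel. (\<integral>x. H x y \<partial>lborel) = indicator {c..d} y * (F (b, y) - F (a, y))"
    using AE_lborel_finite[OF assms(2)] lborel_pair.AE_integrable_snd[OF int] by eventually_elim (rule line)
  then have "(\<integral>y. \<integral>x. H x y \<partial>lborel \<partial>lborel) = (\<integral>y. indicator {c..d} y * (F (b, y) - F (a, y)) \<partial>lborel)"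
  proof (rule integral_cong_AE[rotated 2])
    show "(\<lambda>y. \<integral>x. H x y \<partial>lborel) \<in> borel_measurable lborel"
      using lborel_pair.integrable_snd[OF int] by (rule borel_measurable_integrable)
    have "continuous_on {c..d} (\<lambda>y. F (b, y) - F (a, y))"
      by (intro continuous_on_diff continuous_on_compose2[OF assms(3)])
        (use assms(1) in \<open>auto intro!: continuous_intros\<close>)
    then have "set_integrable lborel {c..d} (\<lambda>y. F (b, y) - F (a, y))"
      by (intro set_integrable_continuous_compact[of "{c..d}"]) auto
    then show "(\<lambda>y. indicator {c..d} y * (F (b, y) - F (a, y))) \<in> borel_measurable lborel"
      unfolding set_integrable_def by (simp add: borel_measurable_integrable)
  qed
  moreover have "(\<integral>y. \<integral>x. H x y \<partial>lborel \<partial>lborel) = (LINT p:{a..b} \<times> {c..d}|lborel. G p)"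
    using lborel_pair.integral_snd[OF int]
    by (simp add: set_lebesgue_integral_def lborel_prod H_def case_prod_unfold)
  ultimately show ?thesis by (simp add: set_lebesgue_integral_def)
qed

text \<open>The same argument on vertical lines, with the other order of integration.\<close>

lemma rectangle_FTC_snd:
  fixes F G :: "plane \<Rightarrow> real"
  assumes "c < d" "finite N" "continuous_on ({a..b} \<times> {c..d}) F"
    and G: "set_integrable lborel ({a..b} \<times> {c..d}) G"
    and deriv: "\<And>x y. x \<in> {a..b} - N \<Longrightarrow> y \<in> {c<..<d} - N \<Longrightarrow> ((\<lambda>s. F (x, s)) has_real_derivative G (x, y)) (at y)"
  shows "(LINT p:{a..b} \<times> {c..d}|lborel. G p) = (LINT x:{a..b}|lborel. F (x, d) - F (x, c))"
proof -
  define H where "H x y = indicator ({a..b} \<times> {c..d}) (x, y) * G (x, y)" for x y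
  have int: "integrable (lborel \<Otimes>\<^sub>M lborel) (case_prod H)"
    using G unfolding set_integrable_def lborel_prod H_def by (simp add: case_prod_unfold)
  have line: "(\<integral>y. H x y \<partial>lborel) = indicator {a..b} x * (F (x, d) - F (x, c))"
    if x: "x \<notin> N" "integrable lborel (\<lambda>y. H x y)" for x
  proof (cases "x \<in> {a..b}")
    case True
    then have H: "H x y = indicator {c..d} y * G (x, y)" for y
      by (auto simp: H_def indicator_def)
    have "(LINT y:{c..d}|lborel. G (x, y)) = F (x, d) - F (x, c)"
    proof (rule LINT_FTC_except_finite[OF assms(1,2)])
      show "continuous_on {c..d} (\<lambda>s. F (x, s))"
        by (rule continuous_on_compose2[OF assms(3)]) (use True in \<open>auto intro!: continuous_intros\<close>)
      show "set_integrable lborel {c..d} (\<lambda>y. G (x, y))"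
        using x(2) by (simp add: H set_integrable_def)
    qed (use deriv True x in auto)
    then show ?thesis using True by (simp add: H set_lebesgue_integral_def)
  next
    case False
    then have "H x y = 0" for y by (auto simp: H_def)
    then show ?thesis using False by simp
  qed
  have "AE x in lborel. (\<integral>y. H x y \<partial>lborel) = indicator {a..b} x * (F (x, d) - F (x, c))"
    using AE_lborel_finite[OF assms(2)] lborel_pair.AE_integrable_fst[OF int] by eventually_elim (rule line)
  then have "(\<integral>x. \<integral>y. H x y \<partial>lborel \<partial>lborel) = (\<integral>x. indicator {a..b} x * (F (x, d) - F (x, c)) \<partial>lborel)"
  proof (rule integral_cong_AE[rotated 2])
    show "(\<lambda>x. \<integral>y. H x y \<partial>lborel) \<in> borel_measurable lborel"
      using lborel_pair.integrable_fst[OF int] by (rule borel_measurable_integrable)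
    have "continuous_on {a..b} (\<lambda>x. F (x, d) - F (x, c))"
      by (intro continuous_on_diff continuous_on_compose2[OF assms(3)])
        (use assms(1) in \<open>auto intro!: continuous_intros\<close>)
    then have "set_integrable lborel {a..b} (\<lambda>x. F (x, d) - F (x, c))"
      by (intro set_integrable_continuous_compact[of "{a..b}"]) auto
    then show "(\<lambda>x. indicator {a..b} x * (F (x, d) - F (x, c))) \<in> borel_measurable lborel"
      unfolding set_integrable_def by (simp add: borel_measurable_integrable)
  qed
  moreover have "(\<integral>x. \<integral>y. H x y \<partial>lborel \<partial>lborel) = (LINT p:{a..b} \<times> {c..d}|lborel. G p)"
    using lborel_pair.integral_fst[OF int]
    by (simp add: set_lebesgue_integral_def lborel_prod H_def case_prod_unfold)
  ultimately show ?thesis by (simp add: set_lebesgue_integral_def)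
qed

text \<open>
  The function only needs to be differentiable off finitely many grid lines: almost every line
  parallel to an axis meets them in finitely many points, and there the one-dimensional fundamental
  theorem applies. So the fine mesh need not be conforming.
\<close>

lemma rectangle_divergence:
  fixes F :: "plane \<Rightarrow> real" and G :: "plane \<Rightarrow> plane \<Rightarrow> real"
  assumes "a < b" "c < d" and K: "K = {a..b} \<times> {c..d}" and "finite N" and contF: "continuous_on K F"
    and G: "\<And>v. set_integrable lborel K (\<lambda>p. G p v)" and lin: "\<And>p. linear (G p)"
    and deriv: "\<And>x y. (x, y) \<in> interior K \<Longrightarrow> x \<notin> N \<Longrightarrow> y \<notin> N \<Longrightarrow> (F has_derivative G (x, y)) (at (x, y))"
  shows "(LINT p:K|lborel. G p v) = (\<Sum>e | e edge_of K. edge_integral e (\<lambda>x. F x * (v \<bullet> outward_normal K e)))"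
proof -
  \<comment> \<open>The coordinates of the sides are added so that a point of the closed rectangle
    with both coordinates off \<open>M\<close> is an interior point.\<close>
  define M where "M = N \<union> {a, b, c, d}"
  have finM: "finite M" using \<open>finite N\<close> by (simp add: M_def)
  have int: "(x, y) \<in> interior K" if "x \<in> {a..b} - M" "y \<in> {c..d} - M" for x y
    using that by (auto simp: K interior_Times M_def)
  have d1: "((\<lambda>s. F (s, y)) has_real_derivative G (x, y) (1, 0)) (at x)"
    if "x \<in> {a<..<b} - M" "y \<in> {c..d} - M" for x y
  proof -
    have "(F has_derivative G (x, y)) (at (x, y))"
      by (rule deriv[OF int]) (use that in \<open>auto simp: M_def\<close>)
    moreover have "((\<lambda>s. (s, y)) has_derivative (\<lambda>h. (h, 0))) (at x)"
      by (auto intro!: derivative_eq_intros)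
    ultimately have "((\<lambda>s. F (s, y)) has_derivative (\<lambda>h. G (x, y) (h, 0))) (at x)"
      by (rule has_derivative_compose[rotated])
    moreover have "(\<lambda>h. G (x, y) (h, 0)) = (*) (G (x, y) (1, 0))"
    proof
      fix h
      have "(h, 0) = h *\<^sub>R ((1, 0) :: plane)" by simp
      then show "G (x, y) (h, 0) = G (x, y) (1, 0) * h"
        by (simp only: linear_scale[OF lin] real_scaleR_def mult.commute)
    qed
    ultimately show ?thesis by (simp only: has_field_derivative_def)
  qed
  have d2: "((\<lambda>s. F (x, s)) has_real_derivative G (x, y) (0, 1)) (at y)"
    if "x \<in> {a..b} - M" "y \<in> {c<..<d} - M" for x y
  proof -
    have "(F has_derivative G (x, y)) (at (x, y))"
      by (rule deriv[OF int]) (use that in \<open>auto simp: M_def\<close>)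
    moreover have "((\<lambda>s. (x, s)) has_derivative (\<lambda>h. (0, h))) (at y)"
      by (auto intro!: derivative_eq_intros)
    ultimately have "((\<lambda>s. F (x, s)) has_derivative (\<lambda>h. G (x, y) (0, h))) (at y)"
      by (rule has_derivative_compose[rotated])
    moreover have "(\<lambda>h. G (x, y) (0, h)) = (*) (G (x, y) (0, 1))"
    proof
      fix h
      have "(0, h) = h *\<^sub>R ((0, 1) :: plane)" by simp
      then show "G (x, y) (0, h) = G (x, y) (0, 1) * h"
        by (simp only: linear_scale[OF lin] real_scaleR_def mult.commute)
    qed
    ultimately show ?thesis by (simp only: has_field_derivative_def)
  qed
  \<comment> \<open>Linearity reduces the derivative along \<open>v\<close> to the two axis
    derivatives, each covered by one of the line arguments.\<close>
  have Gv: "G p v = fst v * G p (1, 0) + snd v * G p (0, 1)" for p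
  proof -
    have "v = fst v *\<^sub>R (1, 0) + snd v *\<^sub>R (0, 1)" by (simp add: prod_eq_iff)
    then have "G p v = G p (fst v *\<^sub>R (1, 0) + snd v *\<^sub>R (0, 1))" by (rule arg_cong)
    also have "\<dots> = fst v *\<^sub>R G p (1, 0) + snd v *\<^sub>R G p (0, 1)"
      by (simp only: linear_add[OF lin] linear_scale[OF lin])
    finally show ?thesis by simp
  qed
  have contx: "continuous_on {a..b} (\<lambda>x. F (x, s))" if "s \<in> {c..d}" for s
    by (rule continuous_on_compose2[OF contF]) (use that in \<open>auto simp: K intro!: continuous_intros\<close>)
  have conty: "continuous_on {c..d} (\<lambda>y. F (s, y))" if "s \<in> {a..b}" for s
    by (rule continuous_on_compose2[OF contF]) (use that in \<open>auto simp: K intro!: continuous_intros\<close>)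
  have intx: "set_integrable lborel {a..b} (\<lambda>x. F (x, s))" if "s \<in> {c..d}" for s
    using contx[OF that] by (intro set_integrable_continuous_compact[of "{a..b}"]) auto
  have inty: "set_integrable lborel {c..d} (\<lambda>y. F (s, y))" if "s \<in> {a..b}" for s
    using conty[OF that] by (intro set_integrable_continuous_compact[of "{c..d}"]) auto
  have "(LINT p:K|lborel. G p v) = fst v * (LINT p:K|lborel. G p (1, 0)) + snd v * (LINT p:K|lborel. G p (0, 1))"
    unfolding Gv[abs_def] using G by (subst set_integral_add) (auto intro: set_integrable_mult_right)
  also have "(LINT p:K|lborel. G p (1, 0)) = (LINT y:{c..d}|lborel. F (b, y) - F (a, y))"
    using rectangle_FTC_fst[OF assms(1) finM] contF G d1 unfolding K by blast
  also have "\<dots> = (LINT y:{c..d}|lborel. F (b, y)) - (LINT y:{c..d}|lborel. F (a, y))"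
    using inty assms(1) by (intro set_integral_diff) auto
  also have "(LINT p:K|lborel. G p (0, 1)) = (LINT x:{a..b}|lborel. F (x, d) - F (x, c))"
    using rectangle_FTC_snd[OF assms(2) finM] contF G d2 unfolding K by blast
  also have "\<dots> = (LINT x:{a..b}|lborel. F (x, d)) - (LINT x:{a..b}|lborel. F (x, c))"
    using intx assms(2) by (intro set_integral_diff) auto
  finally have lhs: "(LINT p:K|lborel. G p v) =
      fst v * ((LINT y:{c..d}|lborel. F (b, y)) - (LINT y:{c..d}|lborel. F (a, y)))
    + snd v * ((LINT x:{a..b}|lborel. F (x, d)) - (LINT x:{a..b}|lborel. F (x, c)))" .
  have edges: "{e. e edge_of K} = {{a} \<times> {c..d}, {b} \<times> {c..d}, {a..b} \<times> {c}, {a..b} \<times> {d}}"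
    using edge_of_rectangle_iff[OF assms(1,2)] by (auto simp: K rectangle_edges_def)
  have ev: "edge_integral ({s} \<times> {c..d}) (\<lambda>x. F x * k) = (LINT y:{c..d}|lborel. F (s, y)) * k"
    if "s \<in> {a..b}" for s k
    by (subst edge_integral_rectangle(1)[OF assms(2)]) (auto intro!: continuous_intros conty that)
  have eh: "edge_integral ({a..b} \<times> {s}) (\<lambda>x. F x * k) = (LINT x:{a..b}|lborel. F (x, s)) * k"
    if "s \<in> {c..d}" for s k
    by (subst edge_integral_rectangle(2)[OF assms(1)]) (auto intro!: continuous_intros contx that)
  show ?thesis
    unfolding lhs edges
    using rectangle_edges_distinct[OF assms(1,2)] assms(1,2) outward_normal_rectangle[OF assms(1,2)]
    using ev[of a "- fst v"] eh[of c "- snd v"]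
    by (simp add: K ev eh inner_prod_def algebra_simps)
qed

subsection \<open>The fine space and its traces\<close>

text \<open>The product is dominated by the sum of the two squares.\<close>

lemma square_integrable_mult:
  assumes "square_integrable_on S f" "square_integrable_on S g"
  shows "set_integrable lebesgue S (\<lambda>x. f x * g x)"
  unfolding set_integrable_def
proof (rule Bochner_Integration.integrable_bound)
  show "integrable lebesgue (\<lambda>x. indicator S x *\<^sub>R (f x)\<^sup>2 + indicator S x *\<^sub>R (g x)\<^sup>2)"
    using assms by (simp add: square_integrable_on_def set_integrable_def)
  have "(\<lambda>x. indicator S x *\<^sub>R (f x * g x)) = (\<lambda>x. (indicator S x *\<^sub>R f x) * (indicator S x *\<^sub>R g x))"
    by (auto simp: indicator_def)
  then show "(\<lambda>x. indicator S x *\<^sub>R (f x * g x)) \<in> borel_measurable lebesgue"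
    using assms by (simp only: square_integrable_on_def set_borel_measurable_def borel_measurable_times)
  have "\<bar>s * t\<bar> \<le> s\<^sup>2 + t\<^sup>2" for s t :: real
  proof -
    have "2 * (s * t) \<le> s\<^sup>2 + t\<^sup>2" "- (2 * (s * t)) \<le> s\<^sup>2 + t\<^sup>2"
      using sum_squares_bound[of s t] sum_squares_bound[of s "- t"] by (simp_all add: algebra_simps)
    then show ?thesis by (simp only: abs_le_iff) linarith
  qed
  then show "AE x in lebesgue. norm (indicator S x *\<^sub>R (f x * g x))
      \<le> norm (indicator S x *\<^sub>R (f x)\<^sup>2 + indicator S x *\<^sub>R (g x)\<^sup>2)"
    by (intro AE_I2) (auto simp: indicator_def)
qed

lemma square_integrable_lincomb:
  assumes "square_integrable_on S f" "square_integrable_on S g"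
  shows "square_integrable_on S (\<lambda>x. f x + c * g x)"
proof -
  have "(\<lambda>x. (f x + c * g x)\<^sup>2) = (\<lambda>x. (f x)\<^sup>2 + (2 * c) * (f x * g x) + c\<^sup>2 * (g x)\<^sup>2)"
    by (auto simp: power2_eq_square algebra_simps)
  moreover have "set_integrable lebesgue S (\<lambda>x. (f x)\<^sup>2 + (2 * c) * (f x * g x) + c\<^sup>2 * (g x)\<^sup>2)"
    using assms square_integrable_mult[OF assms]
    by (intro set_integral_add set_integrable_mult_right) (auto simp: square_integrable_on_def)
  moreover have "(\<lambda>x. indicator S x *\<^sub>R (f x + c * g x)) = (\<lambda>x. indicator S x *\<^sub>R f x + c * (indicator S x *\<^sub>R g x))"
    by (auto simp: algebra_simps)
  moreover have "(\<lambda>x. indicator S x *\<^sub>R f x + c * (indicator S x *\<^sub>R g x)) \<in> borel_measurable lebesgue"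
    using assms unfolding square_integrable_on_def set_borel_measurable_def
    by (intro borel_measurable_add borel_measurable_times borel_measurable_const) auto
  ultimately show ?thesis
    by (simp only: square_integrable_on_def set_borel_measurable_def)
qed

text \<open>\<open>Lim\<close> is meaningful only where a limit exists along a nontrivial filter.
  The continuous extension \<open>f\<close> provides the limit, and density of the interior in
  \<open>K\<close> makes \<open>x\<close> a limit point of it.\<close>

lemma trace_from_eq:
  assumes "closure (interior K) = K" "continuous_on K f" "\<And>y. y \<in> interior K \<Longrightarrow> w y = f y" "x \<in> K"
  shows "trace_from K w x = f x"
proof -
  have "(f \<longlongrightarrow> f x) (at x within interior K)"
    using assms(2,4) interior_subset unfolding continuous_on_def by (meson tendsto_within_subset)
  moreover have "eventually (\<lambda>y. f y = w y) (at x within interior K)"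
    using assms(3) by (auto simp: eventually_at_filter)
  ultimately have "(w \<longlongrightarrow> f x) (at x within interior K)"
    by (rule Lim_transform_eventually)
  moreover have "x islimpt interior K"
  proof (cases "x \<in> interior K")
    case True
    then show ?thesis using interior_limit_point[of x "interior K"] by (simp only: interior_interior)
  next
    case False
    then have "interior K - {x} = interior K" by blast
    with assms(1,4) show ?thesis by (simp only: islimpt_in_closure)
  qed
  then have "at x within interior K \<noteq> bot" by (simp only: trivial_limit_within not_not simp_thms)
  ultimately show ?thesis unfolding trace_from_def by (rule tendsto_Lim[rotated])
qed

lemma bilinear_poly_has_derivative:
  assumes "q \<in> bilinear_polys"
  obtains g where "continuous_on UNIV q" "\<And>x. (q has_derivative g x) (at x)" "\<And>v. continuous_on UNIV (\<lambda>x. g x v)"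
proof -
  obtain a b c d where q: "q = (\<lambda>(x, y). a + b * x + c * y + d * x * y)"
    using assms unfolding bilinear_polys_def by blast
  define g where "g = (\<lambda>(p::plane) (v::plane). b * fst v + c * snd v + d * (fst p * snd v + fst v * snd p))"
  show thesis
  proof (rule that)
    show "continuous_on UNIV q"
      unfolding q case_prod_unfold by (intro continuous_intros)
    show "(q has_derivative g x) (at x)" for x
      unfolding q case_prod_unfold g_def by (auto intro!: derivative_eq_intros simp: algebra_simps)
    show "continuous_on UNIV (\<lambda>x. g x v)" for v
      unfolding g_def by (intro continuous_intros)
  qed
qed

section \<open>Calculus of edge integrals\<close>

definition edge_integrable :: "plane set \<Rightarrow> (plane \<Rightarrow> real) \<Rightarrow> bool" where
  "edge_integrable e f \<longleftrightarrow> set_integrable lebesgue {0..1} (\<lambda>t. f (edge_param e t))"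

lemma edge_integral_add:
  assumes "edge_integrable e f" "edge_integrable e g"
  shows "edge_integral e (\<lambda>x. f x + g x) = edge_integral e f + edge_integral e g"
  using assms unfolding edge_integrable_def edge_integral_def
  by (simp add: set_integral_add(2) algebra_simps)

lemma edge_integral_cmult: "edge_integral e (\<lambda>x. c * f x) = c * edge_integral e f"
  unfolding edge_integral_def by simp

lemma edge_integrable_add:
  "edge_integrable e f \<Longrightarrow> edge_integrable e g \<Longrightarrow> edge_integrable e (\<lambda>x. f x + g x)"
  unfolding edge_integrable_def by (rule set_integral_add(1))

lemma edge_integrable_cmult: "edge_integrable e f \<Longrightarrow> edge_integrable e (\<lambda>x. c * f x)"
  unfolding edge_integrable_def by (rule set_integrable_mult_right) 

lemma edge_integral_mono:
  assumes "edge_integrable e f" "edge_integrable e g"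
    and "\<And>t. t \<in> {0..1} \<Longrightarrow> f (edge_param e t) \<le> g (edge_param e t)"
  shows "edge_integral e f \<le> edge_integral e g"
  using assms unfolding edge_integrable_def edge_integral_def
  by (intro mult_left_mono set_integral_mono) auto

lemma edge_integral_nonneg:
  assumes "\<And>t. t \<in> {0..1} \<Longrightarrow> 0 \<le> f (edge_param e t)"
  shows "0 \<le> edge_integral e f"
  using assms unfolding edge_integral_def set_lebesgue_integral_def
  by (intro mult_nonneg_nonneg Bochner_Integration.integral_nonneg) (auto simp: indicator_def)

lemma edge_integral_cong:
  assumes "\<And>t. t \<in> {0..1} \<Longrightarrow> f (edge_param e t) = g (edge_param e t)"
  shows "edge_integral e f = edge_integral e g"
  using assms unfolding edge_integral_def set_lebesgue_integral_def
  by (intro arg_cong2[where f = "(*)"] Bochner_Integration.integral_cong) (auto simp: indicator_def)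

section \<open>Fine functions, their traces and derivatives\<close>

locale refined_mesh = coarse_mesh \<Omega> TH for \<Omega> TH +
  fixes Th :: "plane set set"
  assumes fine_mesh: "rectangular_mesh \<Omega> Th" and refines: "mesh_refines Th TH"
begin

lemma finite_fine: "finite Th"
  and Union_fine: "\<Union>Th = closure \<Omega>"
  and interior_fine_ne: "\<tau> \<in> Th \<Longrightarrow> interior \<tau> \<noteq> {}"
  and disjoint_fine: "\<tau> \<in> Th \<Longrightarrow> \<tau>' \<in> Th \<Longrightarrow> \<tau> \<noteq> \<tau>' \<Longrightarrow> interior \<tau> \<inter> interior \<tau>' = {}"
  using fine_mesh unfolding rectangular_mesh_def by (auto dest: division_ofD)

lemma compact_fine: "\<tau> \<in> Th \<Longrightarrow> compact \<tau>"
  by (metis rectangular_mesh_rectangle[OF fine_mesh] compact_Times compact_Icc)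

lemma fine_element_unique:
  assumes "\<tau> \<in> Th" "K \<in> TH" "K' \<in> TH" "\<tau> \<subseteq> K" "interior \<tau> \<inter> interior K' \<noteq> {}"
  shows "K' = K"
  using disjoint_interiors[OF assms(2,3)] interior_mono[OF assms(4)] assms(5) by blast

text \<open>A fine element has nonempty interior, so it cannot lie in two coarse elements with
  disjoint interiors; refinement puts it into at least one.\<close>

lemma sum_fine: "(\<Sum>\<tau>\<in>Th. f \<tau>) = (\<Sum>K\<in>TH. \<Sum>\<tau> | \<tau> \<in> Th \<and> \<tau> \<subseteq> K. f \<tau>)"
proof -
  have "Th = (\<Union>K\<in>TH. {\<tau> \<in> Th. \<tau> \<subseteq> K})" using refines by (auto simp: mesh_refines_def)
  then have "(\<Sum>\<tau>\<in>Th. f \<tau>) = (\<Sum>\<tau>\<in>(\<Union>K\<in>TH. {\<tau> \<in> Th. \<tau> \<subseteq> K}). f \<tau>)"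
    by (rule arg_cong[where f = "sum f"])
  also have "\<dots> = (\<Sum>K\<in>TH. \<Sum>\<tau> | \<tau> \<in> Th \<and> \<tau> \<subseteq> K. f \<tau>)"
  proof (rule sum.UNION_disjoint)
    show "\<forall>K\<in>TH. \<forall>K'\<in>TH. K \<noteq> K' \<longrightarrow> {\<tau> \<in> Th. \<tau> \<subseteq> K} \<inter> {\<tau> \<in> Th. \<tau> \<subseteq> K'} = {}"
    proof (intro ballI impI)
      fix K K' assume K: "K \<in> TH" "K' \<in> TH" "K \<noteq> K'"
      have False if "\<tau> \<in> Th" "\<tau> \<subseteq> K" "\<tau> \<subseteq> K'" for \<tau>
        using fine_element_unique[OF that(1) K(1,2) that(2)] interior_mono[OF that(3)] interior_fine_ne[OF that(1)] K(3)
        by blast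
      then show "{\<tau> \<in> Th. \<tau> \<subseteq> K} \<inter> {\<tau> \<in> Th. \<tau> \<subseteq> K'} = {}" by blast
    qed
  qed (use finite_mesh finite_fine in auto)
  finally show ?thesis .
qed

abbreviation Vh :: "(plane \<Rightarrow> real) set" where "Vh \<equiv> fine_space \<Omega> TH Th"

lemma fine_bilinear: "w \<in> Vh \<Longrightarrow> \<tau> \<in> Th \<Longrightarrow> \<exists>q\<in>bilinear_polys. \<forall>x\<in>interior \<tau>. w x = q x"
  and fine_continuous: "w \<in> Vh \<Longrightarrow> K \<in> TH \<Longrightarrow> \<exists>f. continuous_on K f \<and> (\<forall>x\<in>interior K. w x = f x)"
  and fine_square_integrable: "w \<in> Vh \<Longrightarrow> square_integrable_on \<Omega> w"
  by (simp_all add: fine_space_def)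

text \<open>The trace serves as the canonical continuous extension of a fine function to the closed
  element. Edge terms are computed from it, since the values of \<open>w\<close> itself on coarse
  edges are arbitrary.\<close>

lemma continuous_trace:
  assumes "w \<in> Vh" "K \<in> TH"
  shows "continuous_on K (trace_from K w)" "\<And>x. x \<in> interior K \<Longrightarrow> trace_from K w x = w x"
proof -
  obtain f where f: "continuous_on K f" "\<And>x. x \<in> interior K \<Longrightarrow> w x = f x"
    using fine_continuous[OF assms] by blast
  have eq: "trace_from K w x = f x" if "x \<in> K" for x
    by (rule trace_from_eq[OF closure_interior_element[OF assms(2)] f(1) _ that]) (rule f(2))
  show "continuous_on K (trace_from K w)"
    by (rule continuous_on_eq[OF f(1)]) (simp add: eq)
  show "trace_from K w x = w x" if "x \<in> interior K" for x
  proof -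
    have "x \<in> K" using that interior_subset by blast
    from eq[OF this] f(2)[OF that] show ?thesis by (rule trans[OF _ sym])
  qed
qed

lemma fine_lincomb:
  assumes "u \<in> Vh" "w \<in> Vh"
  shows "(\<lambda>x. u x + c * w x) \<in> Vh"
  unfolding fine_space_def
proof (intro CollectI conjI ballI)
  show "square_integrable_on \<Omega> (\<lambda>x. u x + c * w x)"
    by (rule square_integrable_lincomb[OF fine_square_integrable[OF assms(1)] fine_square_integrable[OF assms(2)]])
next
  fix \<tau> assume "\<tau> \<in> Th"
  then obtain q r where q: "q \<in> bilinear_polys" "\<forall>x\<in>interior \<tau>. u x = q x"
    and r: "r \<in> bilinear_polys" "\<forall>x\<in>interior \<tau>. w x = r x"
    using fine_bilinear[OF assms(1)] fine_bilinear[OF assms(2)] by blast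
  obtain q0 q1 q2 q3 where q': "q = (\<lambda>(x, y). q0 + q1 * x + q2 * y + q3 * x * y)"
    using q(1) by (auto simp: bilinear_polys_def)
  obtain r0 r1 r2 r3 where r': "r = (\<lambda>(x, y). r0 + r1 * x + r2 * y + r3 * x * y)"
    using r(1) by (auto simp: bilinear_polys_def)
  from q' r' have "(\<lambda>x. q x + c * r x) =
      (\<lambda>(x, y). (q0 + c * r0) + (q1 + c * r1) * x + (q2 + c * r2) * y + (q3 + c * r3) * x * y)"
    by (simp add: fun_eq_iff algebra_simps)
  then have "(\<lambda>x. q x + c * r x) \<in> bilinear_polys"
    unfolding bilinear_polys_def by blast
  then show "\<exists>q\<in>bilinear_polys. \<forall>x\<in>interior \<tau>. u x + c * w x = q x"
    using q(2) r(2) by (intro bexI[of _ "\<lambda>x. q x + c * r x"]) auto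
next
  fix K assume K: "K \<in> TH"
  have "continuous_on K (\<lambda>x. trace_from K u x + c * trace_from K w x)"
    by (intro continuous_intros continuous_trace(1)[OF assms(1) K] continuous_trace(1)[OF assms(2) K])
  moreover have "\<forall>x\<in>interior K. u x + c * w x = trace_from K u x + c * trace_from K w x"
    using continuous_trace(2)[OF assms(1) K] continuous_trace(2)[OF assms(2) K] by simp
  ultimately show "\<exists>f. continuous_on K f \<and> (\<forall>x\<in>interior K. u x + c * w x = f x)" by blast
qed

lemma trace_lincomb:
  assumes "u \<in> Vh" "w \<in> Vh" "K \<in> TH" "x \<in> K"
  shows "trace_from K (\<lambda>x. u x + c * w x) x = trace_from K u x + c * trace_from K w x"
proof (rule trace_from_eq[OF closure_interior_element[OF assms(3)] _ _ assms(4)])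
  show "continuous_on K (\<lambda>x. trace_from K u x + c * trace_from K w x)"
    by (intro continuous_intros continuous_trace(1)[OF assms(1,3)] continuous_trace(1)[OF assms(2,3)])
  show "u y + c * w y = trace_from K u y + c * trace_from K w y" if "y \<in> interior K" for y
    using continuous_trace(2)[OF assms(1,3) that] continuous_trace(2)[OF assms(2,3) that] by simp
qed

lemma fine_has_derivative:
  assumes "w \<in> Vh" "\<tau> \<in> Th"
  obtains q g where "continuous_on UNIV q" "\<And>x. x \<in> interior \<tau> \<Longrightarrow> w x = q x"
    "\<And>x. x \<in> interior \<tau> \<Longrightarrow> (w has_derivative g x) (at x)" "\<And>v. continuous_on UNIV (\<lambda>x. g x v)"
proof -
  obtain q where q: "q \<in> bilinear_polys" "\<And>x. x \<in> interior \<tau> \<Longrightarrow> w x = q x"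
    using fine_bilinear[OF assms] by blast
  obtain g where g: "continuous_on UNIV q" "\<And>x. (q has_derivative g x) (at x)" "\<And>v. continuous_on UNIV (\<lambda>x. g x v)"
    using bilinear_poly_has_derivative[OF q(1)] by blast
  have "(w has_derivative g x) (at x)" if "x \<in> interior \<tau>" for x
    by (rule has_derivative_transform_within_open[OF g(2) open_interior that]) (simp add: q(2))
  then show thesis using that g q(2) by blast
qed

lemma fine_differentiable:
  assumes "w \<in> Vh" "\<tau> \<in> Th" "x \<in> interior \<tau>"
  shows "(w has_derivative frechet_derivative w (at x)) (at x)"
  using fine_has_derivative[OF assms(1,2)] assms(3) by (metis differentiableI frechet_derivative_works)

lemma fine_derivative_lincomb:
  assumes "u \<in> Vh" "w \<in> Vh" "\<tau> \<in> Th" "x \<in> interior \<tau>"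
  shows "frechet_derivative (\<lambda>x. u x + c * w x) (at x) v
    = frechet_derivative u (at x) v + c * frechet_derivative w (at x) v"
proof -
  have "((\<lambda>x. u x + c * w x) has_derivative
      (\<lambda>v. frechet_derivative u (at x) v + c * frechet_derivative w (at x) v)) (at x)"
    using fine_differentiable assms by (intro derivative_intros) auto
  from frechet_derivative_at[OF this] show ?thesis by metis
qed

text \<open>On the interior of a fine element the integrand agrees with a function that is
  continuous on the whole compact element.\<close>

lemma transport_integrable:
  assumes "u \<in> Vh" "w \<in> Vh" "\<tau> \<in> Th"
  shows "set_integrable lborel (interior \<tau>) (\<lambda>x. u x * frechet_derivative w (at x) v)"
proof -
  obtain q g where q: "continuous_on UNIV q" "\<And>x. x \<in> interior \<tau> \<Longrightarrow> u x = q x"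
    using fine_has_derivative[OF assms(1,3)] by metis
  obtain g where g: "\<And>x. x \<in> interior \<tau> \<Longrightarrow> (w has_derivative g x) (at x)" "continuous_on UNIV (\<lambda>x. g x v)"
    using fine_has_derivative[OF assms(2,3)] by metis
  have "continuous_on \<tau> (\<lambda>x. q x * g x v)"
    by (intro continuous_on_mult continuous_on_subset[OF q(1)] continuous_on_subset[OF g(2)]) auto
  then have "set_integrable lborel (interior \<tau>) (\<lambda>x. q x * g x v)"
    by (intro set_integrable_continuous_compact[OF compact_fine[OF assms(3)]] interior_subset) auto
  moreover have "q x * g x v = u x * frechet_derivative w (at x) v" if "x \<in> interior \<tau>" for x
    using frechet_derivative_at[OF g(1)[OF that]] q(2)[OF that] by simp
  ultimately show ?thesis by (simp cong: set_integrable_cong)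
qed

lemma edge_param_in:
  assumes "K \<in> TH" "e edge_of K" "t \<in> {0..1}"
  shows "edge_param e t \<in> e" "edge_param e t \<in> K"
proof -
  obtain a b c d where K: "a < b" "c < d" "K = {a..b} \<times> {c..d}" by (rule element_rectangle[OF assms(1)])
  have le: "a + t * (b - a) \<in> {a..b}" "c + t * (d - c) \<in> {c..d}"
    by (rule affine_Icc K assms(3))+
  have "e \<in> rectangle_edges a b c d" using assms(2) edge_of_rectangle_iff K by blast
  then show "edge_param e t \<in> e"
    using K(1,2) le edge_param_rectangle[of a b c d] edge_param_rectangle[of b b c d] edge_param_rectangle[of a b d d]
    unfolding rectangle_edges_def by auto
  then show "edge_param e t \<in> K" using assms(2) face_of_imp_subset unfolding edge_of_def by blast
qed

lemma edge_integrable_continuous: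
  assumes "K \<in> TH" "e edge_of K" "continuous_on e f"
  shows "edge_integrable e f"
proof -
  have "continuous_on {0..1} (\<lambda>t. f (edge_param e t))"
    by (rule continuous_on_compose2[OF assms(3)])
      (use edge_param_in[OF assms(1,2)] in \<open>auto simp: edge_param_def continuous_on_linepath\<close>)
  then have "set_integrable lborel {0..1} (\<lambda>t. f (edge_param e t))"
    by (intro set_integrable_continuous_compact[of "{0..1}"]) auto
  then show ?thesis
    unfolding edge_integrable_def by (rule set_integrable_lebesgue_of_lborel)
qed

lemma continuous_trace_edge:
  assumes "w \<in> Vh" "K \<in> TH" "e edge_of K"
  shows "continuous_on e (trace_from K w)"
  using continuous_trace(1)[OF assms(1,2)] assms(3) face_of_imp_subset continuous_on_subset
  unfolding edge_of_def by blast

text \<open>The divergence theorem applied to the square of the trace, whose derivative is twice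
  \<open>w\<close> times that of \<open>w\<close>. The trace is used because it is continuous up to
  the boundary of the element and across its fine grid lines.\<close>

lemma element_energy:
  assumes w: "w \<in> Vh" and K: "K \<in> TH"
  shows "(\<Sum>\<tau> | \<tau> \<in> Th \<and> \<tau> \<subseteq> K. LINT x:interior \<tau>|lebesgue. w x * frechet_derivative w (at x) v)
    = 1/2 * (\<Sum>e | e edge_of K. edge_integral e (\<lambda>x. (trace_from K w x)\<^sup>2 * (v \<bullet> outward_normal K e)))"
proof -
  let ?TK = "{\<tau>. \<tau> \<in> Th \<and> \<tau> \<subseteq> K}"
  obtain a b c d where abcd: "a < b" "c < d" "K = {a..b} \<times> {c..d}" by (rule element_rectangle[OF K])
  \<comment> \<open>The witness collects the coordinates of the four sides: off these, a point of
    the fine element is interior.\<close>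
  have "\<exists>N. finite N \<and> (\<forall>p\<in>\<tau>. fst p \<notin> N \<longrightarrow> snd p \<notin> N \<longrightarrow> p \<in> interior \<tau>)" if \<tau>: "\<tau> \<in> Th" for \<tau>
  proof -
    obtain a b c d where "\<tau> = {a..b} \<times> {c..d}" using rectangular_mesh_rectangle[OF fine_mesh \<tau>] by metis
    then show ?thesis by (intro exI[of _ "{a, b, c, d}"]) (auto simp: interior_Times)
  qed
  then obtain N where N: "\<And>\<tau>. \<tau> \<in> Th \<Longrightarrow> finite (N \<tau>)"
    "\<And>\<tau> p. \<tau> \<in> Th \<Longrightarrow> p \<in> \<tau> \<Longrightarrow> fst p \<notin> N \<tau> \<Longrightarrow> snd p \<notin> N \<tau> \<Longrightarrow> p \<in> interior \<tau>"
    by metis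
  define D where "D = (\<lambda>p v. 2 * (w p * frechet_derivative w (at p) v))"
  \<comment> \<open>Cutting off outside the fine interiors makes \<open>G p\<close> linear at every
    \<open>p\<close>, including points where \<open>w\<close> is not differentiable and
    \<open>frechet_derivative\<close> has no meaning.\<close>
  define G where "G = (\<lambda>p v. \<Sum>\<tau>\<in>?TK. indicator (interior \<tau>) p * D p v)"
  have intD: "set_integrable lborel (interior \<tau>) (\<lambda>p. D p v)" if "\<tau> \<in> Th" for \<tau> v
    unfolding D_def using transport_integrable[OF w w that] by (intro set_integrable_mult_right) auto
  have linD: "linear (D p)" if "\<tau> \<in> Th" "p \<in> interior \<tau>" for \<tau> p
  proof -
    have "linear (frechet_derivative w (at p))"
      using fine_differentiable[OF w that] by (rule has_derivative_linear)
    then show ?thesis by (simp add: D_def linear_iff algebra_simps)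
  qed
  have ind: "indicator K p * (indicator (interior \<tau>) p * z) = indicator (interior \<tau>) p * z"
    if "\<tau> \<in> ?TK" for \<tau> p and z :: real
    using that interior_subset by (fastforce simp: indicator_def)
  have "(LINT p:K|lborel. G p v) = (\<Sum>e | e edge_of K. edge_integral e (\<lambda>x. (trace_from K w x)\<^sup>2 * (v \<bullet> outward_normal K e)))"
  proof (rule rectangle_divergence[OF abcd, where N = "\<Union>\<tau>\<in>Th. N \<tau>"])
    show "finite (\<Union>\<tau>\<in>Th. N \<tau>)" using finite_fine N(1) by blast
    show "continuous_on K (\<lambda>x. (trace_from K w x)\<^sup>2)"
      by (intro continuous_intros continuous_trace w K)
    show "set_integrable lborel K (\<lambda>p. G p v)" for v
    proof -
      have "integrable lborel (\<lambda>p. \<Sum>\<tau>\<in>?TK. indicator (interior \<tau>) p * D p v)"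
        using intD by (intro Bochner_Integration.integrable_sum) (auto simp: set_integrable_def)
      then show ?thesis
        by (simp add: set_integrable_def G_def sum_distrib_left ind)
    qed
    show "linear (G p)" for p
      unfolding G_def
    proof (rule linear_compose_sum, rule ballI)
      fix \<tau> assume "\<tau> \<in> ?TK"
      then show "linear (\<lambda>v. indicator (interior \<tau>) p * D p v)"
        using linD[of \<tau> p] by (cases "p \<in> interior \<tau>") (auto simp: linear_zero)
    qed
    fix x y assume p: "(x, y) \<in> interior K" "x \<notin> (\<Union>\<tau>\<in>Th. N \<tau>)" "y \<notin> (\<Union>\<tau>\<in>Th. N \<tau>)"
    let ?p = "(x, y)"
    have "?p \<in> closure \<Omega>" using p(1) element_subset[OF K] interior_subset by blast
    then obtain \<tau> where \<tau>: "\<tau> \<in> Th" "?p \<in> \<tau>" using Union_fine by blast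
    then have pint: "?p \<in> interior \<tau>" using N(2) p by auto
    obtain K' where K': "K' \<in> TH" "\<tau> \<subseteq> K'" using refines \<tau>(1) by (auto simp: mesh_refines_def)
    \<comment> \<open>The fine element found at the point must belong to \<open>K\<close>: it lies
      in some coarse element, and its interior meets that of \<open>K\<close>.\<close>
    then have "K = K'" using fine_element_unique[OF \<tau>(1) K'(1) K K'(2)] pint p(1) by blast
    then have \<tau>K: "\<tau> \<in> ?TK" using \<tau> K' by simp
    have "G ?p v = D ?p v" for v
    proof -
      have "G ?p v = (\<Sum>\<sigma>\<in>{\<tau>}. indicator (interior \<sigma>) ?p * D ?p v)"
        unfolding G_def
        by (rule sum.mono_neutral_right) (use \<tau>K finite_fine disjoint_fine pint in \<open>auto simp: indicator_def\<close>)
      then show ?thesis using pint by simp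
    qed
    then have Geq: "G ?p = D ?p" by blast
    have "((\<lambda>x. (w x)\<^sup>2) has_derivative D ?p) (at ?p)"
      unfolding D_def using fine_differentiable[OF w \<tau>(1) pint]
      by (auto intro!: derivative_eq_intros)
    then show "((\<lambda>x. (trace_from K w x)\<^sup>2) has_derivative G ?p) (at ?p)"
      unfolding Geq
      by (rule has_derivative_transform_within_open[OF _ open_interior p(1)]) (simp add: continuous_trace(2)[OF w K])
  qed
  moreover have "(LINT p:K|lborel. G p v) = (\<Sum>\<tau>\<in>?TK. LINT p:interior \<tau>|lborel. D p v)"
  proof -
    have "(LINT p:K|lborel. G p v) = (\<integral>p. (\<Sum>\<tau>\<in>?TK. indicator (interior \<tau>) p * D p v) \<partial>lborel)"
      by (simp add: set_lebesgue_integral_def G_def sum_distrib_left ind)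
    also have "\<dots> = (\<Sum>\<tau>\<in>?TK. \<integral>p. indicator (interior \<tau>) p * D p v \<partial>lborel)"
      by (rule Bochner_Integration.integral_sum) (use intD in \<open>auto simp: set_integrable_def\<close>)
    finally show ?thesis by (simp add: set_lebesgue_integral_def)
  qed
  moreover have "(LINT p:interior \<tau>|lborel. D p v) = 2 * (LINT x:interior \<tau>|lebesgue. w x * frechet_derivative w (at x) v)"
    if "\<tau> \<in> ?TK" for \<tau>
    using set_integrable_lebesgue_of_lborel(2)[OF transport_integrable[OF w w, of \<tau> v]] that by (simp add: D_def)
  ultimately show ?thesis by (simp flip: sum_distrib_left)
qed

end

subsection \<open>The energy identity\<close>

text \<open>Integrability is needed because the integral of a nonintegrable function is 0 by
  convention and so not additive. The identity is asked only on the parametrised edge, where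
  linearity of traces is available.\<close>

lemma edge_integral_lincomb:
  assumes "edge_integrable e f" "edge_integrable e g"
    and "\<And>t. t \<in> {0..1} \<Longrightarrow> h (edge_param e t) = f (edge_param e t) + c * g (edge_param e t)"
  shows "edge_integral e h = edge_integral e f + c * edge_integral e g"
proof -
  have "edge_integral e h = edge_integral e (\<lambda>x. f x + c * g x)"
    by (rule edge_integral_cong) (rule assms(3))
  also have "\<dots> = edge_integral e f + c * edge_integral e g"
    using assms by (simp add: edge_integral_add edge_integral_cmult edge_integrable_cmult)
  finally show ?thesis .
qed

lemma set_integral_lincomb:
  fixes f g h :: "'a \<Rightarrow> real"
  assumes "A \<in> sets M" "set_integrable M A f" "set_integrable M A g"
    and "\<And>x. x \<in> A \<Longrightarrow> h x = f x + c * g x"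
  shows "(LINT x:A|M. h x) = (LINT x:A|M. f x) + c * (LINT x:A|M. g x)"
proof -
  have "(LINT x:A|M. h x) = (LINT x:A|M. f x + c * g x)"
    using assms(1,4) by (intro set_lebesgue_integral_cong) auto
  also have "\<dots> = (LINT x:A|M. f x) + c * (LINT x:A|M. g x)"
    using assms(2,3) by (subst set_integral_add) (auto intro: set_integrable_mult_right)
  finally show ?thesis .
qed

context refined_mesh
begin

text \<open>Replaces \<open>the_elem\<close> and the branches of \<open>jump\<close> and
  \<open>edge_normal\<close> by two concrete elements: \<open>K\<close> upwind, \<open>K'\<close>
  downwind, one normal up to sign.\<close>

lemma interior_edgeE:
  assumes e: "e \<in> interior_edges \<Omega> TH" and U: "upwind_choice \<Omega> TH v U"
  obtains K K' n where "U e = K" "K \<in> TH" "e edge_of K" "K' \<in> TH" "e edge_of K'" "adjacent TH e = {K, K'}" "K \<noteq> K'"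
    "outward_normal K e = n" "outward_normal K' e = - n" "norm n = 1" "v \<bullet> n \<ge> 0"
    "upwind_trace U e = trace_from K" "downwind_trace TH U e = trace_from K'"
    "\<And>w x. jump \<Omega> TH U e w x = (trace_from K w x - trace_from K' w x) *\<^sub>R n"
    "edge_normal \<Omega> TH U e = n"
proof -
  have K: "U e \<in> adjacent TH e" "v \<bullet> outward_normal (U e) e \<ge> 0"
    using U e by (auto simp: upwind_choice_def)
  obtain K' where K': "adjacent TH e = {U e, K'}" "K' \<noteq> U e" "outward_normal K' e = - outward_normal (U e) e"
    by (rule adjacent_interior_edge[OF e K(1)])
  have mem: "U e \<in> TH" "e edge_of U e" "K' \<in> TH" "e edge_of K'"
    using K(1) K'(1) by (auto simp: adjacent_def)
  have "adjacent TH e - {U e} = {K'}" using K' by auto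
  then have down: "downwind_trace TH U e = trace_from K'" by (simp add: downwind_trace_def fun_eq_iff)
  show thesis
  proof (rule that[of "U e" K' "outward_normal (U e) e"])
    show "jump \<Omega> TH U e w x = (trace_from (U e) w x - trace_from K' w x) *\<^sub>R outward_normal (U e) e" for w x
      using e by (simp add: jump_def down upwind_trace_def upwind_normal_def algebra_simps)
    show "upwind_trace U e = trace_from (U e)" by (simp add: upwind_trace_def fun_eq_iff)
    show "edge_normal \<Omega> TH U e = outward_normal (U e) e" using e by (simp add: edge_normal_def upwind_normal_def)
  qed (use mem K K' down edge_normal_unit in auto)
qed

text \<open>The one-element counterpart: the edge is not interior, so the boundary branches of
  \<open>jump\<close> and \<open>edge_normal\<close> apply, and its adjacent element is
  unique.\<close>

lemma boundary_edgeE: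
  assumes e: "e \<in> boundary_edges \<Omega> TH"
  obtains K n where "K \<in> TH" "e edge_of K" "adjacent TH e = {K}" "outward_normal K e = n" "norm n = 1"
    "boundary_normal TH e = n" "boundary_trace TH e = trace_from K"
    "\<And>U w x. jump \<Omega> TH U e w x = trace_from K w x *\<^sub>R n" "\<And>U. edge_normal \<Omega> TH U e = n"
proof -
  have ne: "e \<in> mesh_edges TH" "e \<notin> interior_edges \<Omega> TH" using e by (simp_all add: boundary_edges_eq)
  obtain K where K: "adjacent TH e = {K}" by (rule adjacent_outer_edge[OF ne])
  then have mem: "K \<in> TH" "e edge_of K" by (auto simp: adjacent_def)
  have n: "boundary_normal TH e = outward_normal K e" by (simp add: boundary_normal_def K)
  have tr: "boundary_trace TH e = trace_from K" by (simp add: boundary_trace_def K fun_eq_iff)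
  show thesis
    by (rule that[OF mem K refl edge_normal_unit[OF mem] n tr]) (use ne n tr in \<open>auto simp: jump_def edge_normal_def\<close>)
qed

lemma edge_integrable_trace:
  assumes "u \<in> Vh" "w \<in> Vh" "K \<in> TH" "K' \<in> TH" "e edge_of K" "e edge_of K'"
  shows "edge_integrable e (\<lambda>x. trace_from K u x * trace_from K' w x * s)"
  by (rule edge_integrable_continuous[OF assms(3,5)])
    (intro continuous_intros continuous_trace_edge assms)

lemma interior_edges_subset: "interior_edges \<Omega> TH \<subseteq> mesh_edges TH"
  by (auto simp: interior_edges_def)

lemma sum_mesh_edges:
  "(\<Sum>e\<in>mesh_edges TH. f e) = (\<Sum>e\<in>interior_edges \<Omega> TH. f e) + (\<Sum>e\<in>boundary_edges \<Omega> TH. f e)"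
  unfolding boundary_edges_eq
  using sum.subset_diff[OF interior_edges_subset finite_mesh_edges] by (simp add: add.commute)

section \<open>Energy of the transport form in terms of jumps\<close>

definition jump_energy where
  "jump_energy v U w e = edge_integral e (\<lambda>x. \<bar>v \<bullet> edge_normal \<Omega> TH U e\<bar> * (norm (jump \<Omega> TH U e w x))\<^sup>2)"

lemma jump_energy_nonneg: "0 \<le> jump_energy v U w e"
  unfolding jump_energy_def by (rule edge_integral_nonneg) simp

lemma jump_energy_interior:
  assumes "w \<in> Vh" "e \<in> interior_edges \<Omega> TH" "upwind_choice \<Omega> TH v U"
  shows "edge_integral e (\<lambda>x. upwind_trace U e w x * (jump \<Omega> TH U e w x \<bullet> v))
    - 1/2 * (\<Sum>K\<in>adjacent TH e. edge_integral e (\<lambda>x. (trace_from K w x)\<^sup>2 * (v \<bullet> outward_normal K e)))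
    = 1/2 * jump_energy v U w e"
proof -
  obtain K K' n where E: "U e = K" "K \<in> TH" "e edge_of K" "K' \<in> TH" "e edge_of K'" "adjacent TH e = {K, K'}" "K \<noteq> K'"
    "outward_normal K e = n" "outward_normal K' e = - n" "norm n = 1" "v \<bullet> n \<ge> 0"
    "upwind_trace U e = trace_from K" "downwind_trace TH U e = trace_from K'"
    "\<And>w x. jump \<Omega> TH U e w x = (trace_from K w x - trace_from K' w x) *\<^sub>R n"
    "edge_normal \<Omega> TH U e = n"
    using interior_edgeE[OF assms(2,3)] by metis
  let ?p = "trace_from K w" and ?m = "trace_from K' w"
  define s where "s = v \<bullet> n"
  \<comment> \<open>Expressed through these three integrals the claim is
    \<open>A - B - (A - C) / 2 = (A - 2 * B + C) / 2\<close>.\<close>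
  define A where "A = edge_integral e (\<lambda>x. ?p x * ?p x * s)"
  define B where "B = edge_integral e (\<lambda>x. ?p x * ?m x * s)"
  define C where "C = edge_integral e (\<lambda>x. ?m x * ?m x * s)"
  note pp = edge_integrable_trace[OF assms(1,1) E(2,2,3,3), of s]
    and pm = edge_integrable_trace[OF assms(1,1) E(2,4,3,5), of s]
    and mm = edge_integrable_trace[OF assms(1,1) E(4,4,5,5), of s]
  have "edge_integral e (\<lambda>x. upwind_trace U e w x * (jump \<Omega> TH U e w x \<bullet> v)) = A + (- 1) * B"
    unfolding A_def B_def
    by (rule edge_integral_lincomb[OF pp pm])
      (simp only: E(12,14) s_def inner_scaleR_left inner_commute[of n v], simp add: algebra_simps)
  moreover have "edge_integral e (\<lambda>x. (?p x)\<^sup>2 * (v \<bullet> outward_normal K e)) = A"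
    unfolding A_def by (rule edge_integral_cong) (simp only: E(8) s_def power2_eq_square)
  moreover have "edge_integral e (\<lambda>x. (?m x)\<^sup>2 * (v \<bullet> outward_normal K' e)) = (- 1) * C"
    unfolding C_def edge_integral_cmult[symmetric]
    by (rule edge_integral_cong) (simp add: E(9) s_def power2_eq_square inner_minus_right)
  moreover have "jump_energy v U w e = (A + (- 2) * B) + 1 * C"
  proof -
    have "jump_energy v U w e = edge_integral e (\<lambda>x. ?p x * ?p x * s + (- 2) * (?p x * ?m x * s)) + 1 * C"
      unfolding jump_energy_def C_def
      by (rule edge_integral_lincomb[OF edge_integrable_add[OF pp edge_integrable_cmult[OF pm]] mm])
        (simp only: E(10,14,15) norm_scaleR mult_1_right power2_abs abs_of_nonneg[OF E(11)] s_def,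
          simp add: power2_eq_square algebra_simps)
    also have "edge_integral e (\<lambda>x. ?p x * ?p x * s + (- 2) * (?p x * ?m x * s)) = A + (- 2) * B"
      unfolding A_def B_def by (rule edge_integral_lincomb[OF pp pm]) (rule refl)
    finally show ?thesis .
  qed
  moreover have "(\<Sum>L\<in>adjacent TH e. edge_integral e (\<lambda>x. (trace_from L w x)\<^sup>2 * (v \<bullet> outward_normal L e)))
      = edge_integral e (\<lambda>x. (?p x)\<^sup>2 * (v \<bullet> outward_normal K e)) + edge_integral e (\<lambda>x. (?m x)\<^sup>2 * (v \<bullet> outward_normal K' e))"
    using E(6,7) by simp
  ultimately show ?thesis by linarith
qed

text \<open>With \<open>s = v \<bullet> n\<close>, the outflow term turns \<open>- s / 2\<close>
  into \<open>s / 2\<close> when \<open>s\<close> is positive; on inflow and tangential edges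
  \<open>- s / 2\<close> is already half the absolute value.\<close>

lemma jump_energy_boundary:
  assumes "w \<in> Vh" "e \<in> boundary_edges \<Omega> TH"
  shows "(if e \<in> outflow_edges \<Omega> TH v
      then edge_integral e (\<lambda>x. boundary_trace TH e w x * boundary_trace TH e w x * (v \<bullet> boundary_normal TH e)) else 0)
    - 1/2 * (\<Sum>K\<in>adjacent TH e. edge_integral e (\<lambda>x. (trace_from K w x)\<^sup>2 * (v \<bullet> outward_normal K e)))
    = 1/2 * jump_energy v U w e"
proof -
  obtain K n where E: "K \<in> TH" "e edge_of K" "adjacent TH e = {K}" "outward_normal K e = n" "norm n = 1"
    "boundary_normal TH e = n" "boundary_trace TH e = trace_from K"
    "\<And>U w x. jump \<Omega> TH U e w x = trace_from K w x *\<^sub>R n" "\<And>U. edge_normal \<Omega> TH U e = n"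
    using boundary_edgeE[OF assms(2)] by metis
  define A where "A = edge_integral e (\<lambda>x. trace_from K w x * trace_from K w x)"
  have A: "edge_integral e (\<lambda>x. trace_from K w x * trace_from K w x * s) = s * A"
    "edge_integral e (\<lambda>x. s * (trace_from K w x * trace_from K w x)) = s * A" for s
    unfolding A_def edge_integral_cmult[symmetric] by (simp_all add: mult.commute)
  have J: "jump_energy v U w e = \<bar>v \<bullet> n\<bar> * A"
    unfolding jump_energy_def A_def edge_integral_cmult[symmetric]
    by (rule edge_integral_cong) (simp add: E power2_eq_square)
  have "e \<in> outflow_edges \<Omega> TH v \<longleftrightarrow> v \<bullet> n > 0"
    using assms(2) E(6) by (simp add: outflow_edges_def)
  then show ?thesis
    by (simp add: E J power2_eq_square A abs_if)
qed

lemma transport_energy: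
  assumes w: "w \<in> Vh" and U: "upwind_choice \<Omega> TH v U"
  shows "transport_form_component \<Omega> TH Th v U w w = 1/2 * (\<Sum>e\<in>mesh_edges TH. jump_energy v U w e)"
proof -
  define L where "L K e = edge_integral e (\<lambda>x. (trace_from K w x)\<^sup>2 * (v \<bullet> outward_normal K e))" for K e
  define I where "I e = edge_integral e (\<lambda>x. upwind_trace U e w x * (jump \<Omega> TH U e w x \<bullet> v))" for e
  define O' where "O' e = edge_integral e (\<lambda>x. boundary_trace TH e w x * boundary_trace TH e w x * (v \<bullet> boundary_normal TH e))" for e
  have "(\<Sum>\<tau>\<in>Th. LINT x:interior \<tau>|lebesgue. w x * frechet_derivative w (at x) v)
      = 1/2 * (\<Sum>K\<in>TH. \<Sum>e | e edge_of K. L K e)"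
    unfolding sum_fine L_def sum_distrib_left[symmetric] by (subst sum_distrib_left) (intro sum.cong refl element_energy w)
  also have "\<dots> = 1/2 * (\<Sum>e\<in>mesh_edges TH. \<Sum>K\<in>adjacent TH e. L K e)"
    unfolding sum_elements_edges ..
  finally have vol: "(\<Sum>\<tau>\<in>Th. LINT x:interior \<tau>|lebesgue. w x * frechet_derivative w (at x) v)
      = (\<Sum>e\<in>interior_edges \<Omega> TH. 1/2 * (\<Sum>K\<in>adjacent TH e. L K e)) + (\<Sum>e\<in>boundary_edges \<Omega> TH. 1/2 * (\<Sum>K\<in>adjacent TH e. L K e))"
    by (simp only: sum_mesh_edges distrib_left sum_distrib_left[symmetric])
  have fin: "finite (boundary_edges \<Omega> TH)" using finite_mesh_edges by (simp add: boundary_edges_eq)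
  \<comment> \<open>Extending the outflow sum by zero to all boundary edges allows a comparison edge
    by edge.\<close>
  have "(\<Sum>e\<in>outflow_edges \<Omega> TH v. O' e) = (\<Sum>e\<in>boundary_edges \<Omega> TH. if e \<in> outflow_edges \<Omega> TH v then O' e else 0)"
    using sum.inter_restrict[OF fin, of O' "outflow_edges \<Omega> TH v"]
    by (simp add: Int_absorb1 outflow_edges_def Collect_conj_eq flip: inf.assoc) 
  then have "transport_form_component \<Omega> TH Th v U w w
      = (\<Sum>e\<in>interior_edges \<Omega> TH. I e - 1/2 * (\<Sum>K\<in>adjacent TH e. L K e))
      + (\<Sum>e\<in>boundary_edges \<Omega> TH. (if e \<in> outflow_edges \<Omega> TH v then O' e else 0) - 1/2 * (\<Sum>K\<in>adjacent TH e. L K e))"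
    unfolding transport_form_component_def vol I_def[symmetric] O'_def[symmetric]
    by (simp add: sum_subtractf)
  also have "(\<Sum>e\<in>interior_edges \<Omega> TH. I e - 1/2 * (\<Sum>K\<in>adjacent TH e. L K e)) = (\<Sum>e\<in>interior_edges \<Omega> TH. 1/2 * jump_energy v U w e)"
    unfolding I_def L_def by (intro sum.cong refl jump_energy_interior w U)
  also have "(\<Sum>e\<in>boundary_edges \<Omega> TH. (if e \<in> outflow_edges \<Omega> TH v then O' e else 0) - 1/2 * (\<Sum>K\<in>adjacent TH e. L K e))
      = (\<Sum>e\<in>boundary_edges \<Omega> TH. 1/2 * jump_energy v U w e)"
    unfolding O'_def L_def by (intro sum.cong refl jump_energy_boundary w)
  finally show ?thesis by (simp only: sum_mesh_edges distrib_left sum_distrib_left)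
qed

section \<open>Bilinearity of the transport form\<close>

lemma transport_interior_term_integrable:
  assumes "u \<in> Vh" "w \<in> Vh" "e \<in> interior_edges \<Omega> TH" "upwind_choice \<Omega> TH v U"
  shows "edge_integrable e (\<lambda>x. upwind_trace U e u x * (jump \<Omega> TH U e w x \<bullet> v))"
proof -
  obtain K K' n where E: "K \<in> TH" "e edge_of K" "K' \<in> TH" "e edge_of K'"
    "upwind_trace U e = trace_from K"
    "\<And>w x. jump \<Omega> TH U e w x = (trace_from K w x - trace_from K' w x) *\<^sub>R n"
    using interior_edgeE[OF assms(3,4)] by metis
  show ?thesis
    unfolding E(5,6)
    by (rule edge_integrable_continuous[OF E(1,2)]) (intro continuous_intros continuous_trace_edge assms E)
qed

lemma interior_traces_lincomb:
  assumes "u \<in> Vh" "w \<in> Vh" "e \<in> interior_edges \<Omega> TH" "upwind_choice \<Omega> TH v U" "t \<in> {0..1}"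
  shows "upwind_trace U e (\<lambda>x. u x + c * w x) (edge_param e t)
      = upwind_trace U e u (edge_param e t) + c * upwind_trace U e w (edge_param e t)"
    "jump \<Omega> TH U e (\<lambda>x. u x + c * w x) (edge_param e t) \<bullet> v
      = jump \<Omega> TH U e u (edge_param e t) \<bullet> v + c * (jump \<Omega> TH U e w (edge_param e t) \<bullet> v)"
proof -
  obtain K K' n where E: "K \<in> TH" "e edge_of K" "K' \<in> TH" "e edge_of K'"
    "upwind_trace U e = trace_from K"
    "\<And>w x. jump \<Omega> TH U e w x = (trace_from K w x - trace_from K' w x) *\<^sub>R n"
    using interior_edgeE[OF assms(3,4)] by metis
  have "trace_from L (\<lambda>x. u x + c * w x) (edge_param e t)
      = trace_from L u (edge_param e t) + c * trace_from L w (edge_param e t)" if "L \<in> TH" "e edge_of L" for L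
    by (rule trace_lincomb[OF assms(1,2) that(1) edge_param_in(2)[OF that assms(5)]])
  then show "upwind_trace U e (\<lambda>x. u x + c * w x) (edge_param e t)
      = upwind_trace U e u (edge_param e t) + c * upwind_trace U e w (edge_param e t)"
    "jump \<Omega> TH U e (\<lambda>x. u x + c * w x) (edge_param e t) \<bullet> v
      = jump \<Omega> TH U e u (edge_param e t) \<bullet> v + c * (jump \<Omega> TH U e w (edge_param e t) \<bullet> v)"
    unfolding E(5,6) using E(1-4) by (simp_all add: algebra_simps)
qed

lemma boundary_trace_facts:
  assumes "u \<in> Vh" "w \<in> Vh" "e \<in> boundary_edges \<Omega> TH"
  shows "continuous_on e (boundary_trace TH e u)"
    "edge_integrable e (\<lambda>x. boundary_trace TH e u x * boundary_trace TH e w x * s)"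
    "t \<in> {0..1} \<Longrightarrow> boundary_trace TH e (\<lambda>x. u x + c * w x) (edge_param e t)
      = boundary_trace TH e u (edge_param e t) + c * boundary_trace TH e w (edge_param e t)"
proof -
  obtain K where E: "K \<in> TH" "e edge_of K" "boundary_trace TH e = trace_from K"
    using boundary_edgeE[OF assms(3)] by metis
  show "continuous_on e (boundary_trace TH e u)"
    unfolding E(3) by (rule continuous_trace_edge[OF assms(1) E(1,2)])
  show "edge_integrable e (\<lambda>x. boundary_trace TH e u x * boundary_trace TH e w x * s)"
    unfolding E(3) by (rule edge_integrable_trace[OF assms(1,2) E(1,1,2,2)])
  show "boundary_trace TH e (\<lambda>x. u x + c * w x) (edge_param e t)
      = boundary_trace TH e u (edge_param e t) + c * boundary_trace TH e w (edge_param e t)" if "t \<in> {0..1}"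
    unfolding E(3) by (rule trace_lincomb[OF assms(1,2) E(1) edge_param_in(2)[OF E(1,2) that]])
qed

lemma transport_lincomb:
  assumes u: "u \<in> Vh" and u': "u' \<in> Vh" and w: "w \<in> Vh" and U: "upwind_choice \<Omega> TH v U"
  shows "transport_form_component \<Omega> TH Th v U (\<lambda>x. u x + c * u' x) w
      = transport_form_component \<Omega> TH Th v U u w + c * transport_form_component \<Omega> TH Th v U u' w" (is ?left)
    "transport_form_component \<Omega> TH Th v U w (\<lambda>x. u x + c * u' x)
      = transport_form_component \<Omega> TH Th v U w u + c * transport_form_component \<Omega> TH Th v U w u'" (is ?right)
proof -
  have out: "e \<in> boundary_edges \<Omega> TH" if "e \<in> outflow_edges \<Omega> TH v" for e
    using that by (simp add: outflow_edges_def)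
  note int = set_integrable_lebesgue_of_lborel(1)[OF transport_integrable]
  show ?left
  proof -
    have 1: "(LINT x:interior \<tau>|lebesgue. (u x + c * u' x) * frechet_derivative w (at x) v)
      = (LINT x:interior \<tau>|lebesgue. u x * frechet_derivative w (at x) v) + c * (LINT x:interior \<tau>|lebesgue. u' x * frechet_derivative w (at x) v)"
      if "\<tau> \<in> Th" for \<tau>
      by (rule set_integral_lincomb) (use int u u' w that in \<open>auto simp: algebra_simps\<close>)
    have 2: "edge_integral e (\<lambda>x. upwind_trace U e (\<lambda>x. u x + c * u' x) x * (jump \<Omega> TH U e w x \<bullet> v))
      = edge_integral e (\<lambda>x. upwind_trace U e u x * (jump \<Omega> TH U e w x \<bullet> v))
      + c * edge_integral e (\<lambda>x. upwind_trace U e u' x * (jump \<Omega> TH U e w x \<bullet> v))"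
      if "e \<in> interior_edges \<Omega> TH" for e
      by (rule edge_integral_lincomb[OF transport_interior_term_integrable[OF u w that U]
            transport_interior_term_integrable[OF u' w that U]])
        (simp add: interior_traces_lincomb(1)[OF u u' that U] algebra_simps)
    have 3: "edge_integral e (\<lambda>x. boundary_trace TH e (\<lambda>x. u x + c * u' x) x * boundary_trace TH e w x * (v \<bullet> boundary_normal TH e))
      = edge_integral e (\<lambda>x. boundary_trace TH e u x * boundary_trace TH e w x * (v \<bullet> boundary_normal TH e))
      + c * edge_integral e (\<lambda>x. boundary_trace TH e u' x * boundary_trace TH e w x * (v \<bullet> boundary_normal TH e))"
      if "e \<in> outflow_edges \<Omega> TH v" for e
      by (rule edge_integral_lincomb[OF boundary_trace_facts(2)[OF u w out[OF that]] boundary_trace_facts(2)[OF u' w out[OF that]]])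
        (simp add: boundary_trace_facts(3)[OF u u' out[OF that]] algebra_simps)
    show ?thesis
      unfolding transport_form_component_def
      by (simp only: 1 2 3 sum.distrib sum_distrib_left[symmetric] cong: sum.cong) (simp only: algebra_simps)
  qed
  show ?right
  proof -
    have 1: "(LINT x:interior \<tau>|lebesgue. w x * frechet_derivative (\<lambda>x. u x + c * u' x) (at x) v)
      = (LINT x:interior \<tau>|lebesgue. w x * frechet_derivative u (at x) v) + c * (LINT x:interior \<tau>|lebesgue. w x * frechet_derivative u' (at x) v)"
      if "\<tau> \<in> Th" for \<tau>
      by (rule set_integral_lincomb) (use int u u' w that in \<open>auto simp: fine_derivative_lincomb algebra_simps\<close>)
    have 2: "edge_integral e (\<lambda>x. upwind_trace U e w x * (jump \<Omega> TH U e (\<lambda>x. u x + c * u' x) x \<bullet> v))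
      = edge_integral e (\<lambda>x. upwind_trace U e w x * (jump \<Omega> TH U e u x \<bullet> v))
      + c * edge_integral e (\<lambda>x. upwind_trace U e w x * (jump \<Omega> TH U e u' x \<bullet> v))"
      if "e \<in> interior_edges \<Omega> TH" for e
      by (rule edge_integral_lincomb[OF transport_interior_term_integrable[OF w u that U]
            transport_interior_term_integrable[OF w u' that U]])
        (simp add: interior_traces_lincomb(2)[OF u u' that U] algebra_simps)
    have 3: "edge_integral e (\<lambda>x. boundary_trace TH e w x * boundary_trace TH e (\<lambda>x. u x + c * u' x) x * (v \<bullet> boundary_normal TH e))
      = edge_integral e (\<lambda>x. boundary_trace TH e w x * boundary_trace TH e u x * (v \<bullet> boundary_normal TH e))
      + c * edge_integral e (\<lambda>x. boundary_trace TH e w x * boundary_trace TH e u' x * (v \<bullet> boundary_normal TH e))"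
      if "e \<in> outflow_edges \<Omega> TH v" for e
      by (rule edge_integral_lincomb[OF boundary_trace_facts(2)[OF w u out[OF that]] boundary_trace_facts(2)[OF w u' out[OF that]]])
        (simp add: boundary_trace_facts(3)[OF u u' out[OF that]] algebra_simps)
    show ?thesis
      unfolding transport_form_component_def
      by (simp only: 1 2 3 sum.distrib sum_distrib_left[symmetric] cong: sum.cong) (simp only: algebra_simps)
  qed
qed

text \<open>The set where the continuous trace differs from zero is open in the element interior and
  negligible, hence empty. Continuity on the coarse element also covers points on fine grid
  lines.\<close>

lemma fine_zero_of_AE:
  assumes u: "u \<in> Vh" and ae: "AE x in lebesgue. x \<in> \<Omega> \<longrightarrow> u x = 0" and K: "K \<in> TH" and x: "x \<in> interior K"
  shows "u x = 0"
proof -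
  let ?N = "{x \<in> interior K. trace_from K u x \<noteq> 0}"
  have "continuous_on (interior K) (trace_from K u)"
    using continuous_trace(1)[OF u K] interior_subset by (rule continuous_on_subset)
  then have "open (interior K \<inter> trace_from K u -` (- {0}))"
    by (intro continuous_open_preimage) auto
  moreover have "?N = interior K \<inter> trace_from K u -` (- {0})" by auto
  ultimately have op: "open ?N" by simp
  have "AE x in lebesgue. x \<notin> ?N"
    using ae
  proof eventually_elim
    case (elim x)
    have "trace_from K u x = 0" if x: "x \<in> interior K"
    proof -
      have "x \<in> \<Omega>" using interior_element_subset[OF K] x by blast
      with elim have "u x = 0" by blast
      then show ?thesis by (simp only: continuous_trace(2)[OF u K x])
    qed
    then show ?case by blast
  qed
  moreover have "?N \<in> sets lebesgue" using op by (intro sets_completionI_sets) auto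
  ultimately have "negligible ?N" by (simp add: AE_iff_null_sets negligible_iff_null_sets)
  then have "?N = {}" using op open_not_negligible by blast
  then have "trace_from K u x = 0" using x by blast
  then show ?thesis using continuous_trace(2)[OF u K x] by simp
qed

lemma trace_zero:
  assumes "\<And>K x. K \<in> TH \<Longrightarrow> x \<in> interior K \<Longrightarrow> u x = 0" "K \<in> TH" "x \<in> K"
  shows "trace_from K u x = 0"
  by (rule trace_from_eq[OF closure_interior_element[OF assms(2)] _ _ assms(3)])
    (use assms in auto)

text \<open>Each term contains the test function \<open>u\<close> only through derivatives inside
  fine elements or through traces, and both depend only on its values in coarse interiors.\<close>

lemma transport_zero:
  assumes zero: "\<And>K x. K \<in> TH \<Longrightarrow> x \<in> interior K \<Longrightarrow> u x = 0" and U: "upwind_choice \<Omega> TH v U"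
  shows "transport_form_component \<Omega> TH Th v U w u = 0"
proof -
  have tr: "trace_from K u (edge_param e t) = 0" if "K \<in> TH" "e edge_of K" "t \<in> {0..1}" for K e t
    by (rule trace_zero[OF zero]) (use that edge_param_in in auto)
  have z: "edge_integral e f = 0" if "\<And>t. t \<in> {0..1} \<Longrightarrow> f (edge_param e t) = 0" for e f
    using edge_integral_cong[of f e "\<lambda>_. 0"] that by (simp add: edge_integral_def)
  have 1: "(LINT x:interior \<tau>|lebesgue. w x * frechet_derivative u (at x) v) = 0" if \<tau>: "\<tau> \<in> Th" for \<tau>
  proof -
    obtain K where K: "K \<in> TH" "\<tau> \<subseteq> K" using refines \<tau> by (auto simp: mesh_refines_def)
    have "frechet_derivative u (at x) v = 0" if x: "x \<in> interior \<tau>" for x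
    proof -
      have "(u has_derivative (\<lambda>_. 0)) (at x)"
        by (rule has_derivative_transform_within_open[OF has_derivative_const[of 0] open_interior x])
          (use zero[OF K(1)] interior_mono[OF K(2)] in auto)
      from frechet_derivative_at[OF this] show ?thesis by metis
    qed
    then have "(LINT x:interior \<tau>|lebesgue. w x * frechet_derivative u (at x) v) = (LINT x:interior \<tau>|lebesgue. 0)"
      by (intro set_lebesgue_integral_cong) auto
    then show ?thesis by simp
  qed
  have 2: "edge_integral e (\<lambda>x. upwind_trace U e w x * (jump \<Omega> TH U e u x \<bullet> v)) = 0"
    if e: "e \<in> interior_edges \<Omega> TH" for e
  proof -
    obtain K K' n where E: "K \<in> TH" "e edge_of K" "K' \<in> TH" "e edge_of K'"
      "\<And>w x. jump \<Omega> TH U e w x = (trace_from K w x - trace_from K' w x) *\<^sub>R n"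
      using interior_edgeE[OF e U] by metis
    show ?thesis by (rule z) (simp add: E tr)
  qed
  have 3: "edge_integral e (\<lambda>x. boundary_trace TH e w x * boundary_trace TH e u x * (v \<bullet> boundary_normal TH e)) = 0"
    if "e \<in> outflow_edges \<Omega> TH v" for e
  proof -
    have "e \<in> boundary_edges \<Omega> TH" using that by (simp add: outflow_edges_def)
    then obtain K where E: "K \<in> TH" "e edge_of K" "boundary_trace TH e = trace_from K"
      using boundary_edgeE by metis
    show ?thesis by (rule z) (simp add: E tr)
  qed
  show ?thesis unfolding transport_form_component_def by (simp add: 1 2 3)
qed

end

subsection \<open>The discrete problem\<close>

lemma scattering_nonneg:
  fixes \<alpha> z :: "'m::finite \<Rightarrow> real"
  assumes "\<And>i. 0 \<le> \<alpha> i" "(\<Sum>i\<in>UNIV. \<alpha> i) = 1"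
  shows "0 \<le> (\<Sum>i\<in>UNIV. \<Sum>j\<in>UNIV. scattering_coeff \<alpha> i j * z j * z i)"
proof -
  define m where "m = (\<Sum>i\<in>UNIV. \<alpha> i * z i)"
  have "(\<Sum>j\<in>UNIV. scattering_coeff \<alpha> i j * z j * z i) = \<alpha> i * (z i)\<^sup>2 - \<alpha> i * z i * m" for i
  proof -
    \<comment> \<open>The coefficient matrix is the diagonal matrix of the weights minus the
      rank-one matrix of their products; the rank-one part yields the mean \<open>m\<close>.\<close>
    have "scattering_coeff \<alpha> i j * z j * z i = (if j = i then \<alpha> i * (z i)\<^sup>2 else 0) - \<alpha> i * z i * (\<alpha> j * z j)" for j
      by (simp add: scattering_coeff_def power2_eq_square algebra_simps)
    then show ?thesis by (simp add: sum_subtractf m_def sum_distrib_left)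
  qed
  then have "(\<Sum>i\<in>UNIV. \<Sum>j\<in>UNIV. scattering_coeff \<alpha> i j * z j * z i) = (\<Sum>i\<in>UNIV. \<alpha> i * (z i)\<^sup>2) - m * m"
    by (simp add: sum_subtractf m_def sum_distrib_right)
  moreover have "(\<Sum>i\<in>UNIV. \<alpha> i * (z i - m)\<^sup>2) = (\<Sum>i\<in>UNIV. \<alpha> i * (z i)\<^sup>2) - m * m"
  proof -
    have "\<alpha> i * (z i - m)\<^sup>2 = \<alpha> i * (z i)\<^sup>2 - 2 * m * (\<alpha> i * z i) + m * m * \<alpha> i" for i
      by (simp add: power2_eq_square algebra_simps)
    then have "(\<Sum>i\<in>UNIV. \<alpha> i * (z i - m)\<^sup>2) = (\<Sum>i\<in>UNIV. \<alpha> i * (z i)\<^sup>2) - 2 * m * m + m * m * 1"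
      by (simp only: sum.distrib sum_subtractf sum_distrib_left[symmetric] m_def[symmetric] assms(2))
    then show ?thesis by simp
  qed
  moreover have "0 \<le> (\<Sum>i\<in>UNIV. \<alpha> i * (z i - m)\<^sup>2)" using assms(1) by (intro sum_nonneg) simp
  ultimately show ?thesis by simp
qed

text \<open>Linearity is relative to a set because the forms are linear only on functions with
  integrable terms and existing traces. The single combination covers additivity and
  homogeneity.\<close>

definition linear_functional_on :: "('m \<Rightarrow> 'a \<Rightarrow> real) set \<Rightarrow> (('m \<Rightarrow> 'a \<Rightarrow> real) \<Rightarrow> real) \<Rightarrow> bool" where
  "linear_functional_on W L \<longleftrightarrow> (\<forall>u\<in>W. \<forall>w\<in>W. \<forall>c. L (\<lambda>i x. u i x + c * w i x) = L u + c * L w)"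

lemma linear_functional_onD:
  "linear_functional_on W L \<Longrightarrow> u \<in> W \<Longrightarrow> w \<in> W \<Longrightarrow> L (\<lambda>i x. u i x + c * w i x) = L u + c * L w"
  by (simp add: linear_functional_on_def)

text \<open>Membership and expansion are proved in one induction, since splitting off a summand by
  linearity requires the partial sum to lie in \<open>W\<close>.\<close>

lemma linear_functional_on_span:
  assumes "finite P" "\<And>p. p \<in> P \<Longrightarrow> \<phi> p \<in> W" and zero: "(\<lambda>_ _. 0) \<in> W"
    and closed: "\<And>u w c. u \<in> W \<Longrightarrow> w \<in> W \<Longrightarrow> (\<lambda>i x. u i x + c * w i x) \<in> W"
  shows "(\<lambda>i x. \<Sum>p\<in>P. c p * \<phi> p i x) \<in> W \<and> (\<forall>L. linear_functional_on W L \<longrightarrow>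
    L (\<lambda>i x. \<Sum>p\<in>P. c p * \<phi> p i x) = (\<Sum>p\<in>P. c p * L (\<phi> p)))"
  using assms(1,2)
proof (induction P rule: finite_induct)
  case empty
  \<comment> \<open>Combining zero with itself gives \<open>L 0 = L 0 + L 0\<close>.\<close>
  have "L (\<lambda>_ _. 0) = 0" if "linear_functional_on W L" for L
    using linear_functional_onD[OF that zero zero, of 1] by simp
  then show ?case using zero by simp
next
  case (insert r P)
  let ?s = "\<lambda>i x. \<Sum>p\<in>P. c p * \<phi> p i x"
  have IH: "?s \<in> W" "\<And>L. linear_functional_on W L \<Longrightarrow> L ?s = (\<Sum>p\<in>P. c p * L (\<phi> p))"
    using insert by blast+
  have eq: "(\<lambda>i x. \<Sum>p\<in>insert r P. c p * \<phi> p i x) = (\<lambda>i x. ?s i x + c r * \<phi> r i x)"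
    using insert.hyps by (simp add: add.commute)
  have r: "\<phi> r \<in> W" using insert.prems by blast
  have "L (\<lambda>i x. ?s i x + c r * \<phi> r i x) = L ?s + c r * L (\<phi> r)" if "linear_functional_on W L" for L
    by (rule linear_functional_onD[OF that IH(1) r])
  then show ?case
    unfolding eq using closed[OF IH(1) r] IH(2) insert.hyps by (simp add: add.commute)
qed

section \<open>The full bilinear form and the inflow data\<close>

locale transport_problem = refined_mesh \<Omega> TH Th for \<Omega> TH Th +
  fixes v :: "'m::finite \<Rightarrow> plane" and \<alpha> :: "'m \<Rightarrow> real" and U :: "'m \<Rightarrow> plane set \<Rightarrow> plane set"
    and \<epsilon> c0 :: real and a :: "plane \<Rightarrow> real" and g :: "'m \<Rightarrow> plane \<Rightarrow> real"
  assumes weight_pos: "\<And>i. \<alpha> i > 0" and weight_sum: "(\<Sum>i\<in>UNIV. \<alpha> i) = 1"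
    and upwind: "\<And>i. upwind_choice \<Omega> TH (v i) (U i)"
    and eps_pos: "\<epsilon> > 0" and a_measurable: "set_borel_measurable lebesgue \<Omega> a"
    and c0_pos: "0 < c0" and a_ge: "\<And>x. x \<in> \<Omega> \<Longrightarrow> c0 \<le> a x"
    and inflow_data: "\<And>i e. e \<in> inflow_edges \<Omega> TH (v i) \<Longrightarrow> edge_square_integrable e (g i)"
begin

definition W :: "('m \<Rightarrow> plane \<Rightarrow> real) set" where "W = {u. \<forall>i. u i \<in> Vh}"

definition form where
  "form u w = transport_form \<Omega> TH Th v U \<alpha> u w + scattering_form \<Omega> \<alpha> \<epsilon> a u w"

definition scatter where
  "scatter u w x = (\<Sum>i\<in>UNIV. \<Sum>j\<in>UNIV. scattering_coeff \<alpha> i j * u j x * w i x)"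
  for u w :: "'m \<Rightarrow> plane \<Rightarrow> real"

lemma scattering_form_eq:
  "scattering_form \<Omega> \<alpha> \<epsilon> a u w = (LINT x:\<Omega>|lebesgue. 1 / (\<epsilon> * a x) * scatter u w x)
    + (\<Sum>i\<in>UNIV. \<alpha> i * (LINT x:\<Omega>|lebesgue. \<epsilon> * u i x * w i x))"
  by (simp add: scattering_form_def scatter_def)

lemma WD: "u \<in> W \<Longrightarrow> u i \<in> Vh"
  by (simp add: W_def)

lemma W_lincomb: "u \<in> W \<Longrightarrow> w \<in> W \<Longrightarrow> (\<lambda>i x. u i x + c * w i x) \<in> W"
  using fine_lincomb by (simp add: W_def)

lemma W_zero: "(\<lambda>_ _. 0) \<in> W"
proof -
  have "(\<lambda>_. 0) \<in> bilinear_polys"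
    unfolding bilinear_polys_def by (intro CollectI exI[of _ 0]) auto
  then show ?thesis
    by (auto simp: W_def fine_space_def square_integrable_on_def set_borel_measurable_def set_integrable_def
        intro!: bexI[of _ "\<lambda>_. 0"] exI[of _ "\<lambda>_. 0"])
qed

lemma lebesgue_domain: "\<Omega> \<in> sets lebesgue"
  using open_domain by (intro sets_completionI_sets) auto

lemma product_integrable: "u \<in> W \<Longrightarrow> w \<in> W \<Longrightarrow> set_integrable lebesgue \<Omega> (\<lambda>x. u j x * w i x)"
  by (intro square_integrable_mult fine_square_integrable WD)

text \<open>The scattering integrand is a finite sum of products of square-integrable functions, and
  the lower bound on \<open>a\<close> bounds its weight by
  \<open>1 / (\<epsilon> * c0)\<close>.\<close>

lemma scatter_integrable:
  assumes "u \<in> W" "w \<in> W"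
  shows "set_integrable lebesgue \<Omega> (\<lambda>x. 1 / (\<epsilon> * a x) * scatter u w x)"
proof -
  have "integrable lebesgue (\<lambda>x. indicator \<Omega> x *\<^sub>R (k * (u j x * w i x)))" for k i j
    using set_integrable_mult_right[OF product_integrable[OF assms]] by (simp only: set_integrable_def)
  then have "set_integrable lebesgue \<Omega> (scatter u w)"
    unfolding scatter_def[abs_def] mult.assoc set_integrable_def scaleR_sum_right
    by (intro Bochner_Integration.integrable_sum)
  then have int: "integrable lebesgue (\<lambda>x. indicator \<Omega> x * scatter u w x)"
    by (simp add: set_integrable_def)
  show ?thesis
    unfolding set_integrable_def
  proof (rule Bochner_Integration.integrable_bound)
    show "integrable lebesgue (\<lambda>x. 1 / (\<epsilon> * c0) * (indicator \<Omega> x * scatter u w x))"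
      using int by (rule integrable_mult_right)
    \<comment> \<open>\<open>a\<close> is measurable on \<Omega> only, so the indicator is moved
      into the denominator as well; outside \<Omega> the other factor vanishes.\<close>
    have "(\<lambda>x. indicator \<Omega> x *\<^sub>R (1 / (\<epsilon> * a x) * scatter u w x))
        = (\<lambda>x. 1 / (\<epsilon> * (indicator \<Omega> x *\<^sub>R a x)) * (indicator \<Omega> x * scatter u w x))"
      by (auto simp: indicator_def)
    moreover have "(\<lambda>x. 1 / (\<epsilon> * (indicator \<Omega> x *\<^sub>R a x)) * (indicator \<Omega> x * scatter u w x)) \<in> borel_measurable lebesgue"
      by (rule borel_measurable_times[OF _ borel_measurable_integrable[OF int]])
        (intro borel_measurable_times borel_measurable_divide borel_measurable_const
          a_measurable[unfolded set_borel_measurable_def])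
    ultimately show "(\<lambda>x. indicator \<Omega> x *\<^sub>R (1 / (\<epsilon> * a x) * scatter u w x)) \<in> borel_measurable lebesgue"
      by simp
    show "AE x in lebesgue. norm (indicator \<Omega> x *\<^sub>R (1 / (\<epsilon> * a x) * scatter u w x))
        \<le> norm (1 / (\<epsilon> * c0) * (indicator \<Omega> x * scatter u w x))"
    proof (rule AE_I2)
      fix x
      show "norm (indicator \<Omega> x *\<^sub>R (1 / (\<epsilon> * a x) * scatter u w x))
        \<le> norm (1 / (\<epsilon> * c0) * (indicator \<Omega> x * scatter u w x))"
      proof (cases "x \<in> \<Omega>")
        case True
        have pos: "0 < \<epsilon> * c0" "\<epsilon> * c0 \<le> \<epsilon> * a x" using eps_pos c0_pos a_ge[OF True] by auto
        then have "\<bar>1 / (\<epsilon> * a x)\<bar> * \<bar>scatter u w x\<bar> \<le> \<bar>1 / (\<epsilon> * c0)\<bar> * \<bar>scatter u w x\<bar>"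
          by (intro mult_right_mono) (auto simp: frac_le)
        then show ?thesis using True by (simp only: indicator_simps scaleR_one mult_1_left real_norm_def abs_mult)
      qed simp
    qed
  qed
qed

lemma scatter_lincomb:
  "scatter (\<lambda>i x. u i x + c * u' i x) w x = scatter u w x + c * scatter u' w x"
  "scatter w (\<lambda>i x. u i x + c * u' i x) x = scatter w u x + c * scatter w u' x"
  by (simp_all add: scatter_def algebra_simps sum.distrib sum_distrib_left)

lemma scattering_lincomb:
  assumes u: "u \<in> W" and u': "u' \<in> W" and w: "w \<in> W"
  shows "scattering_form \<Omega> \<alpha> \<epsilon> a (\<lambda>i x. u i x + c * u' i x) w
      = scattering_form \<Omega> \<alpha> \<epsilon> a u w + c * scattering_form \<Omega> \<alpha> \<epsilon> a u' w" (is ?left)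
    "scattering_form \<Omega> \<alpha> \<epsilon> a w (\<lambda>i x. u i x + c * u' i x)
      = scattering_form \<Omega> \<alpha> \<epsilon> a w u + c * scattering_form \<Omega> \<alpha> \<epsilon> a w u'" (is ?right)
proof -
  have int: "set_integrable lebesgue \<Omega> (\<lambda>x. \<epsilon> * y i x * z i x)" if "y \<in> W" "z \<in> W" for y z i
    using set_integrable_mult_right[OF product_integrable[OF that]] by (simp add: mult.assoc)
  show ?left
  proof -
    have 1: "(LINT x:\<Omega>|lebesgue. 1 / (\<epsilon> * a x) * scatter (\<lambda>i x. u i x + c * u' i x) w x)
      = (LINT x:\<Omega>|lebesgue. 1 / (\<epsilon> * a x) * scatter u w x) + c * (LINT x:\<Omega>|lebesgue. 1 / (\<epsilon> * a x) * scatter u' w x)"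
      by (rule set_integral_lincomb[OF lebesgue_domain scatter_integrable[OF u w] scatter_integrable[OF u' w]])
        (simp only: scatter_lincomb distrib_left mult.left_commute)
    have 2: "(LINT x:\<Omega>|lebesgue. \<epsilon> * (u i x + c * u' i x) * w i x)
      = (LINT x:\<Omega>|lebesgue. \<epsilon> * u i x * w i x) + c * (LINT x:\<Omega>|lebesgue. \<epsilon> * u' i x * w i x)" for i
      by (rule set_integral_lincomb[OF lebesgue_domain int[OF u w] int[OF u' w]]) (simp only: algebra_simps)
    show ?thesis
      unfolding scattering_form_eq 1 2 by (simp add: distrib_left sum.distrib sum_distrib_left mult.left_commute)
  qed
  show ?right
  proof -
    have 1: "(LINT x:\<Omega>|lebesgue. 1 / (\<epsilon> * a x) * scatter w (\<lambda>i x. u i x + c * u' i x) x)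
      = (LINT x:\<Omega>|lebesgue. 1 / (\<epsilon> * a x) * scatter w u x) + c * (LINT x:\<Omega>|lebesgue. 1 / (\<epsilon> * a x) * scatter w u' x)"
      by (rule set_integral_lincomb[OF lebesgue_domain scatter_integrable[OF w u] scatter_integrable[OF w u']])
        (simp only: scatter_lincomb distrib_left mult.left_commute)
    have 2: "(LINT x:\<Omega>|lebesgue. \<epsilon> * w i x * (u i x + c * u' i x))
      = (LINT x:\<Omega>|lebesgue. \<epsilon> * w i x * u i x) + c * (LINT x:\<Omega>|lebesgue. \<epsilon> * w i x * u' i x)" for i
      by (rule set_integral_lincomb[OF lebesgue_domain int[OF w u] int[OF w u']]) (simp only: algebra_simps)
    show ?thesis
      unfolding scattering_form_eq 1 2 by (simp add: distrib_left sum.distrib sum_distrib_left mult.left_commute)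
  qed
qed

lemma form_linear:
  assumes "w \<in> W"
  shows "linear_functional_on W (\<lambda>u. form u w)" "linear_functional_on W (form w)"
  unfolding linear_functional_on_def form_def transport_form_def
  using assms upwind
  by (auto simp: scattering_lincomb transport_lincomb WD sum.distrib sum_distrib_left algebra_simps)

lemma inflow_boundary: "e \<in> inflow_edges \<Omega> TH (v i) \<Longrightarrow> e \<in> boundary_edges \<Omega> TH"
  by (simp add: inflow_edges_def)

text \<open>The data are merely square integrable along the edge; the trace is continuous there,
  hence square integrable too.\<close>

lemma inflow_term_integrable:
  assumes "w \<in> Vh" "e \<in> inflow_edges \<Omega> TH (v i)"
  shows "edge_integrable e (\<lambda>x. g i x * boundary_trace TH e w x * s)"
proof -
  obtain K where K: "K \<in> TH" "e edge_of K" using boundary_edgeE[OF inflow_boundary[OF assms(2)]] by metis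
  have "square_integrable_on {0..1} (\<lambda>t. boundary_trace TH e w (edge_param e t))"
  proof -
    have ct: "continuous_on {0..1} (\<lambda>t. boundary_trace TH e w (edge_param e t))"
      by (rule continuous_on_compose2[OF boundary_trace_facts(1)[OF assms(1,1) inflow_boundary[OF assms(2)]]])
        (use edge_param_in[OF K] in \<open>auto simp: edge_param_def continuous_on_linepath\<close>)
    then have "set_integrable lebesgue {0..1} (\<lambda>t. boundary_trace TH e w (edge_param e t))"
      "set_integrable lebesgue {0..1} (\<lambda>t. (boundary_trace TH e w (edge_param e t))\<^sup>2)"
      by (auto intro!: set_integrable_lebesgue_of_lborel(1) set_integrable_continuous_compact[of "{0..1}"] continuous_intros)
    then show ?thesis
      by (simp add: square_integrable_on_def set_borel_measurable_def set_integrable_def borel_measurable_integrable)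
  qed
  then have "set_integrable lebesgue {0..1} (\<lambda>t. g i (edge_param e t) * boundary_trace TH e w (edge_param e t))"
    using inflow_data[OF assms(2)] unfolding edge_square_integrable_def by (rule square_integrable_mult[rotated])
  then show ?thesis unfolding edge_integrable_def by (rule set_integrable_mult_left)
qed

lemma inflow_linear: "linear_functional_on W (inflow_functional \<Omega> TH v \<alpha> g)"
  unfolding linear_functional_on_def
proof (intro ballI allI)
  fix u w c assume u: "u \<in> W" and w: "w \<in> W"
  have "edge_integral e (\<lambda>x. g i x * boundary_trace TH e (\<lambda>x. u i x + c * w i x) x * (v i \<bullet> boundary_normal TH e))
      = edge_integral e (\<lambda>x. g i x * boundary_trace TH e (u i) x * (v i \<bullet> boundary_normal TH e))
      + c * edge_integral e (\<lambda>x. g i x * boundary_trace TH e (w i) x * (v i \<bullet> boundary_normal TH e))"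
    if e: "e \<in> inflow_edges \<Omega> TH (v i)" for i e
    by (rule edge_integral_lincomb[OF inflow_term_integrable[OF WD[OF u] e] inflow_term_integrable[OF WD[OF w] e]])
      (simp add: boundary_trace_facts(3)[OF WD[OF u] WD[OF w] inflow_boundary[OF e]] algebra_simps)
  then show "inflow_functional \<Omega> TH v \<alpha> g (\<lambda>i x. u i x + c * w i x)
      = inflow_functional \<Omega> TH v \<alpha> g u + c * inflow_functional \<Omega> TH v \<alpha> g w"
    by (simp add: inflow_functional_def sum.distrib sum_distrib_left[symmetric] distrib_left)
      (simp add: sum.distrib sum_distrib_left algebra_simps)
qed

lemma form_energy:
  assumes "u \<in> W"
  shows "form u u = (\<Sum>i\<in>UNIV. \<alpha> i * (1/2 * (\<Sum>e\<in>mesh_edges TH. jump_energy (v i) (U i) (u i) e)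
      + (LINT x:\<Omega>|lebesgue. \<epsilon> * (u i x)\<^sup>2))) + (LINT x:\<Omega>|lebesgue. 1 / (\<epsilon> * a x) * scatter u u x)"
  unfolding form_def transport_form_def scattering_form_eq
  by (simp add: transport_energy[OF WD[OF assms] upwind] power2_eq_square mult.assoc distrib_left sum.distrib)

lemma scatter_integral_nonneg: "0 \<le> (LINT x:\<Omega>|lebesgue. 1 / (\<epsilon> * a x) * scatter u u x)"
  unfolding set_lebesgue_integral_def
proof (rule Bochner_Integration.integral_nonneg)
  fix x
  have "0 \<le> scatter u u x"
    unfolding scatter_def using weight_pos weight_sum by (intro scattering_nonneg) (auto intro: less_imp_le)
  moreover have "0 \<le> 1 / (\<epsilon> * a x)" if "x \<in> \<Omega>" using a_ge[OF that] c0_pos eps_pos by simp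
  ultimately show "0 \<le> indicator \<Omega> x *\<^sub>R (1 / (\<epsilon> * a x) * scatter u u x)" by (simp add: indicator_def)
qed

text \<open>All summands of the energy are nonnegative, so each vanishes; positive weights and
  positive \<epsilon> then isolate the integral of each squared component.\<close>

lemma form_definite:
  assumes u: "u \<in> W" and 0: "form u u = 0"
  shows "AE x in lebesgue. x \<in> \<Omega> \<longrightarrow> u i x = 0"
proof -
  let ?E = "\<lambda>i. 1/2 * (\<Sum>e\<in>mesh_edges TH. jump_energy (v i) (U i) (u i) e)"
  let ?I = "\<lambda>i. LINT x:\<Omega>|lebesgue. \<epsilon> * (u i x)\<^sup>2"
  have E: "0 \<le> ?E i" for i by (simp add: sum_nonneg jump_energy_nonneg)
  have I: "0 \<le> ?I i" for i
    unfolding set_lebesgue_integral_def using eps_pos by (intro Bochner_Integration.integral_nonneg) simp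
  have nn: "0 \<le> \<alpha> i * (?E i + ?I i)" for i
    using E I weight_pos[of i] by (intro mult_nonneg_nonneg add_nonneg_nonneg) (auto intro: less_imp_le)
  then have "0 \<le> (\<Sum>i\<in>UNIV. \<alpha> i * (?E i + ?I i))" by (intro sum_nonneg)
  then have "(\<Sum>i\<in>UNIV. \<alpha> i * (?E i + ?I i)) = 0"
    using form_energy[OF u] 0 scatter_integral_nonneg[of u] by linarith
  then have "\<alpha> i * (?E i + ?I i) = 0"
    using nn sum_nonneg_eq_0_iff[of UNIV "\<lambda>i. \<alpha> i * (?E i + ?I i)"] by simp
  then have "?E i + ?I i = 0" using weight_pos[of i] by simp
  then have "?I i = 0" using E[of i] I[of i] by linarith
  moreover have "integrable lebesgue (\<lambda>x. indicator \<Omega> x *\<^sub>R (\<epsilon> * (u i x)\<^sup>2))"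
    using set_integrable_mult_right[OF product_integrable[OF u u, of i i], of \<epsilon>]
    by (simp add: set_integrable_def power2_eq_square)
  moreover have "AE x in lebesgue. 0 \<le> indicator \<Omega> x *\<^sub>R (\<epsilon> * (u i x)\<^sup>2)" using eps_pos by simp
  ultimately have "AE x in lebesgue. indicator \<Omega> x *\<^sub>R (\<epsilon> * (u i x)\<^sup>2) = 0"
    unfolding set_lebesgue_integral_def using integral_nonneg_eq_0_iff_AE by blast
  then show ?thesis by eventually_elim (use eps_pos in \<open>auto simp: indicator_def split: if_splits\<close>)
qed

text \<open>Supplies the two hypotheses of \<open>finite_system_solvable\<close>: an isotropic
  function is null, and as a test function it is seen neither by the form nor by the data.\<close>

lemma form_null:
  assumes u: "u \<in> W" and 0: "form u u = 0"
  shows "form w u = 0" "inflow_functional \<Omega> TH v \<alpha> g u = 0"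
proof -
  note ae = form_definite[OF u 0]
  have zero: "u i x = 0" if "K \<in> TH" "x \<in> interior K" for i K x
    by (rule fine_zero_of_AE[OF WD[OF u] ae that])
  have "transport_form_component \<Omega> TH Th (v i) (U i) (w i) (u i) = 0" for i
    using zero upwind by (rule transport_zero)
  then have 1: "transport_form \<Omega> TH Th v U \<alpha> w u = 0" by (simp add: transport_form_def)
  \<comment> \<open>The scattering term couples the components, so they must vanish simultaneously
    almost everywhere; there are finitely many.\<close>
  have all: "AE x in lebesgue. \<forall>i\<in>UNIV. x \<in> \<Omega> \<longrightarrow> u i x = 0"
    by (rule AE_finite_allI) (use ae in auto)
  have "(LINT x:\<Omega>|lebesgue. 1 / (\<epsilon> * a x) * scatter w u x) = 0"
    unfolding set_lebesgue_integral_def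
    by (rule integral_eq_zero_AE) (use all in eventually_elim, auto simp: scatter_def indicator_def)
  moreover have "(LINT x:\<Omega>|lebesgue. \<epsilon> * w i x * u i x) = 0" for i
    unfolding set_lebesgue_integral_def
    by (rule integral_eq_zero_AE) (use ae[of i] in eventually_elim, auto simp: indicator_def)
  ultimately have 2: "scattering_form \<Omega> \<alpha> \<epsilon> a w u = 0" by (simp add: scattering_form_eq)
  show "form w u = 0" by (simp add: form_def 1 2)
  have "edge_integral e (\<lambda>x. g i x * boundary_trace TH e (u i) x * (v i \<bullet> boundary_normal TH e)) = 0"
    if e: "e \<in> inflow_edges \<Omega> TH (v i)" for i e
  proof -
    obtain K where K: "K \<in> TH" "e edge_of K" "boundary_trace TH e = trace_from K"
      using boundary_edgeE[OF inflow_boundary[OF e]] by metis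
    have "edge_integral e (\<lambda>x. g i x * boundary_trace TH e (u i) x * (v i \<bullet> boundary_normal TH e)) = edge_integral e (\<lambda>_. 0)"
      by (rule edge_integral_cong) (use trace_zero[OF zero K(1) edge_param_in(2)[OF K(1,2)]] in \<open>simp add: K(3)\<close>)
    then show ?thesis by (simp add: edge_integral_def)
  qed
  then show "inflow_functional \<Omega> TH v \<alpha> g u = 0" by (simp add: inflow_functional_def)
qed

text \<open>The trace part produced by Young's inequality is, on an inflow edge, exactly a quarter
  of the jump energy, so the energy identity can absorb it.\<close>

lemma inflow_functional_le:
  assumes u: "u \<in> W"
  shows "inflow_functional \<Omega> TH v \<alpha> g u \<le> (\<Sum>i\<in>UNIV. \<alpha> i *
      ((\<Sum>e\<in>inflow_edges \<Omega> TH (v i). edge_integral e (\<lambda>x. \<bar>v i \<bullet> boundary_normal TH e\<bar> * (g i x)\<^sup>2))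
      + 1/4 * (\<Sum>e\<in>mesh_edges TH. jump_energy (v i) (U i) (u i) e)))"
proof -
  have term_le: "- edge_integral e (\<lambda>x. g i x * boundary_trace TH e (u i) x * (v i \<bullet> boundary_normal TH e))
      \<le> edge_integral e (\<lambda>x. \<bar>v i \<bullet> boundary_normal TH e\<bar> * (g i x)\<^sup>2) + 1/4 * jump_energy (v i) (U i) (u i) e"
    if e: "e \<in> inflow_edges \<Omega> TH (v i)" for i e
  proof -
    note eb = inflow_boundary[OF e]
    obtain K n where E: "K \<in> TH" "e edge_of K" "norm n = 1" "boundary_normal TH e = n" "boundary_trace TH e = trace_from K"
      "\<And>U w x. jump \<Omega> TH U e w x = trace_from K w x *\<^sub>R n" "\<And>U. edge_normal \<Omega> TH U e = n"
      using boundary_edgeE[OF eb] by metis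
    define s where "s = v i \<bullet> n"
    let ?t = "trace_from K (u i)"
    have s: "s < 0" using e by (simp add: inflow_edges_def E s_def)
    have "set_integrable lebesgue {0..1} (\<lambda>t. (g i (edge_param e t))\<^sup>2)"
      using inflow_data[OF e] by (simp add: edge_square_integrable_def square_integrable_on_def)
    then have G: "edge_integrable e (\<lambda>x. \<bar>s\<bar> * (g i x)\<^sup>2)"
      unfolding edge_integrable_def by (rule set_integrable_mult_right)
    have T: "edge_integrable e (\<lambda>x. ?t x * ?t x * \<bar>s\<bar>)"
      by (rule edge_integrable_trace[OF WD[OF u] WD[OF u] E(1,1,2,2)])
    have J: "jump_energy (v i) (U i) (u i) e = edge_integral e (\<lambda>x. ?t x * ?t x * \<bar>s\<bar>)"
      unfolding jump_energy_def by (rule edge_integral_cong) (simp add: E s_def power2_eq_square)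
    have "- edge_integral e (\<lambda>x. g i x * ?t x * s) = edge_integral e (\<lambda>x. - 1 * (g i x * ?t x * s))"
      by (simp only: edge_integral_cmult)
    also have "\<dots> \<le> edge_integral e (\<lambda>x. \<bar>s\<bar> * (g i x)\<^sup>2 + 1/4 * (?t x * ?t x * \<bar>s\<bar>))"
    proof (rule edge_integral_mono)
      show "edge_integrable e (\<lambda>x. - 1 * (g i x * ?t x * s))"
        using inflow_term_integrable[OF WD[OF u] e, where s = s] by (intro edge_integrable_cmult) (simp only: E)
      show "edge_integrable e (\<lambda>x. \<bar>s\<bar> * (g i x)\<^sup>2 + 1/4 * (?t x * ?t x * \<bar>s\<bar>))"
        by (intro edge_integrable_add edge_integrable_cmult G T)
      \<comment> \<open>The completed square is weighted by \<open>\<bar>s\<bar>\<close>, and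
        \<open>s < 0\<close> turns the left side into the mixed term. Its splitting gives
        \<open>z\<close> the factor 1/4, half of what the energy identity offers.\<close>
      have young: "- 1 * (y * z * s) \<le> \<bar>s\<bar> * y\<^sup>2 + 1/4 * (z * z * \<bar>s\<bar>)" for y z :: real
      proof -
        have "0 \<le> \<bar>s\<bar> * (y - z / 2)\<^sup>2" by simp
        also have "\<dots> = \<bar>s\<bar> * y\<^sup>2 + 1/4 * (z * z * \<bar>s\<bar>) - y * z * \<bar>s\<bar>"
          by (simp add: power2_eq_square algebra_simps)
        finally show ?thesis using s by simp
      qed
      show "- 1 * (g i (edge_param e t) * ?t (edge_param e t) * s)
        \<le> \<bar>s\<bar> * (g i (edge_param e t))\<^sup>2 + 1/4 * (?t (edge_param e t) * ?t (edge_param e t) * \<bar>s\<bar>)" for t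
        by (rule young)
    qed
    also have "\<dots> = edge_integral e (\<lambda>x. \<bar>s\<bar> * (g i x)\<^sup>2) + 1/4 * edge_integral e (\<lambda>x. ?t x * ?t x * \<bar>s\<bar>)"
      by (rule edge_integral_lincomb[OF G T]) (rule refl)
    finally show ?thesis unfolding J by (simp only: E s_def)
  qed
  have "- (\<Sum>e\<in>inflow_edges \<Omega> TH (v i). edge_integral e (\<lambda>x. g i x * boundary_trace TH e (u i) x * (v i \<bullet> boundary_normal TH e)))
      \<le> (\<Sum>e\<in>inflow_edges \<Omega> TH (v i). edge_integral e (\<lambda>x. \<bar>v i \<bullet> boundary_normal TH e\<bar> * (g i x)\<^sup>2))
      + 1/4 * (\<Sum>e\<in>mesh_edges TH. jump_energy (v i) (U i) (u i) e)" for i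
  proof -
    have "- (\<Sum>e\<in>inflow_edges \<Omega> TH (v i). edge_integral e (\<lambda>x. g i x * boundary_trace TH e (u i) x * (v i \<bullet> boundary_normal TH e)))
      \<le> (\<Sum>e\<in>inflow_edges \<Omega> TH (v i). edge_integral e (\<lambda>x. \<bar>v i \<bullet> boundary_normal TH e\<bar> * (g i x)\<^sup>2)
        + 1/4 * jump_energy (v i) (U i) (u i) e)"
      unfolding sum_negf[symmetric] by (intro sum_mono term_le)
    also have "\<dots> = (\<Sum>e\<in>inflow_edges \<Omega> TH (v i). edge_integral e (\<lambda>x. \<bar>v i \<bullet> boundary_normal TH e\<bar> * (g i x)\<^sup>2))
        + 1/4 * (\<Sum>e\<in>inflow_edges \<Omega> TH (v i). jump_energy (v i) (U i) (u i) e)"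
      by (simp only: sum.distrib sum_distrib_left)
    \<comment> \<open>Jump energies are nonnegative, so the sum may be enlarged to all
      edges.\<close>
    also have "(\<Sum>e\<in>inflow_edges \<Omega> TH (v i). jump_energy (v i) (U i) (u i) e) \<le> (\<Sum>e\<in>mesh_edges TH. jump_energy (v i) (U i) (u i) e)"
      by (rule sum_mono2[OF finite_mesh_edges]) (auto simp: inflow_edges_def boundary_edges_def jump_energy_nonneg)
    finally show ?thesis by simp
  qed
  then have "(\<Sum>i\<in>UNIV. \<alpha> i * - (\<Sum>e\<in>inflow_edges \<Omega> TH (v i). edge_integral e (\<lambda>x. g i x * boundary_trace TH e (u i) x * (v i \<bullet> boundary_normal TH e))))
      \<le> (\<Sum>i\<in>UNIV. \<alpha> i *
      ((\<Sum>e\<in>inflow_edges \<Omega> TH (v i). edge_integral e (\<lambda>x. \<bar>v i \<bullet> boundary_normal TH e\<bar> * (g i x)\<^sup>2))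
      + 1/4 * (\<Sum>e\<in>mesh_edges TH. jump_energy (v i) (U i) (u i) e)))"
    using weight_pos by (intro sum_mono mult_left_mono) (auto intro: less_imp_le)
  then show ?thesis by (simp only: inflow_functional_def mult_minus_right sum_negf)
qed

text \<open>The equation tested with \<open>u\<close> itself: the jump terms compare as 1/2 on the
  left against 1/4 on the right, and the difference 1/4 stays on the left.\<close>

lemma energy_estimate:
  assumes u: "u \<in> W" and eq: "form u u = inflow_functional \<Omega> TH v \<alpha> g u"
  shows "(\<Sum>i\<in>UNIV. \<alpha> i * (1/4 * (\<Sum>e\<in>mesh_edges TH. jump_energy (v i) (U i) (u i) e)
      + (LINT x:\<Omega>|lebesgue. \<epsilon> * (u i x)\<^sup>2))) + (LINT x:\<Omega>|lebesgue. 1 / (\<epsilon> * a x) * scatter u u x)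
    \<le> (\<Sum>i\<in>UNIV. \<alpha> i *
      (\<Sum>e\<in>inflow_edges \<Omega> TH (v i). edge_integral e (\<lambda>x. \<bar>v i \<bullet> boundary_normal TH e\<bar> * (g i x)\<^sup>2)))"
proof -
  define E I G where "E = (\<lambda>i. \<Sum>e\<in>mesh_edges TH. jump_energy (v i) (U i) (u i) e)"
    and "I = (\<lambda>i. LINT x:\<Omega>|lebesgue. \<epsilon> * (u i x)\<^sup>2)"
    and "G = (\<lambda>i. \<Sum>e\<in>inflow_edges \<Omega> TH (v i). edge_integral e (\<lambda>x. \<bar>v i \<bullet> boundary_normal TH e\<bar> * (g i x)\<^sup>2))"
  have split: "(\<Sum>i\<in>UNIV. \<alpha> i * (k * E i + X i)) = k * (\<Sum>i\<in>UNIV. \<alpha> i * E i) + (\<Sum>i\<in>UNIV. \<alpha> i * X i)"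
    "(\<Sum>i\<in>UNIV. \<alpha> i * (X i + k * E i)) = (\<Sum>i\<in>UNIV. \<alpha> i * X i) + k * (\<Sum>i\<in>UNIV. \<alpha> i * E i)" for k X
    by (simp_all add: distrib_left sum.distrib sum_distrib_left mult.left_commute)
  have "form u u \<le> (\<Sum>i\<in>UNIV. \<alpha> i * (G i + 1/4 * E i))"
    unfolding eq E_def G_def by (rule inflow_functional_le[OF u])
  moreover have "form u u = (\<Sum>i\<in>UNIV. \<alpha> i * (1/2 * E i + I i)) + (LINT x:\<Omega>|lebesgue. 1 / (\<epsilon> * a x) * scatter u u x)"
    unfolding E_def I_def by (rule form_energy[OF u])
  ultimately have "(\<Sum>i\<in>UNIV. \<alpha> i * (1/4 * E i + I i)) + (LINT x:\<Omega>|lebesgue. 1 / (\<epsilon> * a x) * scatter u u x)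
      \<le> (\<Sum>i\<in>UNIV. \<alpha> i * G i)"
    unfolding split by linarith
  then show ?thesis by (simp only: E_def I_def G_def)
qed

text \<open>Existence is the linear system for the coefficients with matrix
  \<open>form (\<phi> p) (\<phi> q)\<close>. Uniqueness concerns functions, not coefficients: the
  difference of two solutions is an admissible test function and has zero energy.\<close>

lemma discrete_problem:
  assumes P: "finite P" "\<And>p i. p \<in> P \<Longrightarrow> \<phi> p i \<in> Vh"
  shows "\<exists>u\<in>span_family P \<phi>. u \<in> W \<and> (\<forall>w\<in>span_family P \<phi>. form u w = inflow_functional \<Omega> TH v \<alpha> g w) \<and>
    (\<forall>u'\<in>span_family P \<phi>. (\<forall>w\<in>span_family P \<phi>. form u' w = inflow_functional \<Omega> TH v \<alpha> g w) \<longrightarrow>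
      (\<forall>i. AE x in lebesgue. x \<in> \<Omega> \<longrightarrow> u' i x = u i x))"
proof -
  let ?F = "inflow_functional \<Omega> TH v \<alpha> g"
  define comb where "comb c = (\<lambda>i x. \<Sum>p\<in>P. c p * \<phi> p i x)" for c
  have span: "span_family P \<phi> = range comb" by (auto simp: span_family_def comb_def)
  have \<phi>W: "\<phi> p \<in> W" if "p \<in> P" for p using P(2) that by (simp add: W_def)
  have combW: "comb c \<in> W" and lin: "linear_functional_on W L \<Longrightarrow> L (comb c) = (\<Sum>p\<in>P. c p * L (\<phi> p))" for c L
  proof -
    have "comb c \<in> W \<and> (\<forall>L. linear_functional_on W L \<longrightarrow> L (comb c) = (\<Sum>p\<in>P. c p * L (\<phi> p)))"
      unfolding comb_def by (rule linear_functional_on_span[OF P(1)]) (use \<phi>W W_zero W_lincomb in auto)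
    then show "comb c \<in> W" "linear_functional_on W L \<Longrightarrow> L (comb c) = (\<Sum>p\<in>P. c p * L (\<phi> p))" by blast+
  qed
  have form_comb: "form (comb c) w = (\<Sum>p\<in>P. c p * form (\<phi> p) w)" "form w (comb c) = (\<Sum>p\<in>P. c p * form w (\<phi> p))"
    if "w \<in> W" for c w
    using lin[OF form_linear(1)[OF that]] lin[OF form_linear(2)[OF that]] by auto
  \<comment> \<open>Identifies isotropic coefficient vectors with combinations of zero energy, the
    point where \<open>form_null\<close> enters the linear algebra.\<close>
  have form_combs: "(\<Sum>p\<in>P. \<Sum>q\<in>P. d p * form (\<phi> p) (\<phi> q) * d q) = form (comb d) (comb d)" for d
    by (simp add: form_comb(1)[OF combW] form_comb(2)[OF \<phi>W] sum_distrib_left mult_ac)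
  have "\<exists>c. \<forall>q\<in>P. (\<Sum>p\<in>P. c p * form (\<phi> p) (\<phi> q)) = ?F (\<phi> q)"
  proof (rule finite_system_solvable[OF P(1)])
    fix d
    assume "(\<Sum>p\<in>P. \<Sum>q\<in>P. d p * form (\<phi> p) (\<phi> q) * d q) = 0"
    then have 0: "form (comb d) (comb d) = 0" by (simp add: form_combs)
    show "\<forall>p\<in>P. (\<Sum>q\<in>P. form (\<phi> p) (\<phi> q) * d q) = 0"
      using form_null(1)[OF combW 0] form_comb(2)[OF \<phi>W, of _ d] by (simp add: mult.commute)
    show "(\<Sum>q\<in>P. ?F (\<phi> q) * d q) = 0"
      using form_null(2)[OF combW 0] lin[OF inflow_linear, of d] by (simp add: mult.commute)
  qed
  then obtain c where c: "\<And>q. q \<in> P \<Longrightarrow> (\<Sum>p\<in>P. c p * form (\<phi> p) (\<phi> q)) = ?F (\<phi> q)" by blast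
  have sol: "form (comb c) (comb d) = ?F (comb d)" for d
    by (simp add: form_comb(2)[OF combW] form_comb(1)[OF \<phi>W] c lin[OF inflow_linear])
  have uniq: "AE x in lebesgue. x \<in> \<Omega> \<longrightarrow> comb c' i x = comb c i x"
    if "\<And>d. form (comb c') (comb d) = ?F (comb d)" for c' i
  proof -
    \<comment> \<open>The difference of the solutions stays in the span; the factor
      \<open>- 1\<close> fits it to \<open>linear_functional_onD\<close>.\<close>
    define d where "d p = c' p + (- 1) * c p" for p
    have eq: "comb d = (\<lambda>i x. comb c' i x + (- 1) * comb c i x)"
      by (simp add: comb_def d_def fun_eq_iff algebra_simps sum_subtractf)
    have "form (comb d) (comb d) = form (comb c') (comb d) + (- 1) * form (comb c) (comb d)"
      using linear_functional_onD[OF form_linear(1)[OF combW[of d]] combW[of c'] combW[of c], of "- 1"]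
      by (simp only: eq[symmetric])
    then have "form (comb d) (comb d) = 0" using that sol by simp
    from form_definite[OF combW this, of i] show ?thesis
      by eventually_elim (simp add: eq)
  qed
  show ?thesis
    unfolding span
  proof (intro bexI[of _ "comb c"] conjI ballI impI allI)
    fix u' i
    assume "u' \<in> range comb" and *: "\<forall>w\<in>range comb. form u' w = ?F w"
    then obtain c' where c': "u' = comb c'" by (elim rangeE)
    have "form (comb c') (comb d) = ?F (comb d)" for d
      using bspec[OF * rangeI, of d] by (simp only: c')
    then show "AE x in lebesgue. x \<in> \<Omega> \<longrightarrow> u' i x = comb c i x"
      unfolding c' by (rule uniq)
  qed (use sol combW in \<open>auto elim!: rangeE\<close>)
qed

end

theorem theorem1:
  fixes \<Omega> :: "plane set" and TH Th :: "plane set set"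
    and v :: "'m::finite \<Rightarrow> plane" and \<alpha> :: "'m \<Rightarrow> real"
    and U :: "'m \<Rightarrow> plane set \<Rightarrow> plane set"
    and \<epsilon> c0 c1 :: real and a :: "plane \<Rightarrow> real"
    and \<phi> :: "'p \<Rightarrow> 'm \<Rightarrow> plane \<Rightarrow> real" and P :: "'p set"
    and V :: "('m \<Rightarrow> plane \<Rightarrow> real) set"
    and g :: "'m \<Rightarrow> plane \<Rightarrow> real"
  assumes "lipschitz_domain \<Omega>" and "bounded \<Omega>"
    and "rectangular_mesh \<Omega> TH" and "conforming TH"
    and "rectangular_mesh \<Omega> Th" and "mesh_refines Th TH"
    and "\<And>i. v i \<in> sphere 0 1"
    and "\<And>i. \<alpha> i > 0" and "(\<Sum>i\<in>UNIV. \<alpha> i) = 1"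
    and "\<And>i. upwind_choice \<Omega> TH (v i) (U i)"
    and "\<epsilon> > 0"
    and "set_borel_measurable lebesgue \<Omega> a"
    and "0 < c0" and "\<And>x. x \<in> \<Omega> \<Longrightarrow> c0 \<le> a x \<and> a x \<le> c1"
    and "finite P" and "\<And>p i. p \<in> P \<Longrightarrow> \<phi> p i \<in> fine_space \<Omega> TH Th"
    and "V = span_family P \<phi>"
    and "\<And>i e. e \<in> inflow_edges \<Omega> TH (v i) \<Longrightarrow> edge_square_integrable e (g i)"
  shows "\<exists>u. discrete_solution \<Omega> TH Th v U \<alpha> \<epsilon> a g V u \<and>
    (\<forall>u'. discrete_solution \<Omega> TH Th v U \<alpha> \<epsilon> a g V u' \<longrightarrow>
       (\<forall>i. AE x in lebesgue. x \<in> \<Omega> \<longrightarrow> u' i x = u i x)) \<and>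
    (\<Sum>i\<in>UNIV. \<alpha> i *
       (1/4 * (\<Sum>e\<in>mesh_edges TH. edge_integral e
                 (\<lambda>x. \<bar>v i \<bullet> edge_normal \<Omega> TH (U i) e\<bar> * (norm (jump \<Omega> TH (U i) e (u i) x))\<^sup>2))
        + (LINT x:\<Omega>|lebesgue. \<epsilon> * (u i x)\<^sup>2)))
    + (LINT x:\<Omega>|lebesgue. 1 / (\<epsilon> * a x) *
         (\<Sum>i\<in>UNIV. \<Sum>j\<in>UNIV. scattering_coeff \<alpha> i j * u j x * u i x))
    \<le> (\<Sum>i\<in>UNIV. \<alpha> i *
         (\<Sum>e\<in>inflow_edges \<Omega> TH (v i). edge_integral e
            (\<lambda>x. \<bar>v i \<bullet> boundary_normal TH e\<bar> * (g i x)\<^sup>2)))"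
proof -
  interpret transport_problem \<Omega> TH Th v \<alpha> U \<epsilon> c0 a g
    using assms by unfold_locales auto
  let ?V = "span_family P \<phi>"
  obtain u where u: "u \<in> ?V" "u \<in> W"
    and sol: "\<And>w. w \<in> ?V \<Longrightarrow> form u w = inflow_functional \<Omega> TH v \<alpha> g w"
    and uniq: "\<And>u' i. u' \<in> ?V \<Longrightarrow> (\<forall>w\<in>?V. form u' w = inflow_functional \<Omega> TH v \<alpha> g w) \<Longrightarrow>
      AE x in lebesgue. x \<in> \<Omega> \<longrightarrow> u' i x = u i x"
    using discrete_problem[where P = P and \<phi> = \<phi>, OF assms(15) assms(16)] by blast
  have ds: "discrete_solution \<Omega> TH Th v U \<alpha> \<epsilon> a g V y \<longleftrightarrow>
      y \<in> ?V \<and> (\<forall>w\<in>?V. form y w = inflow_functional \<Omega> TH v \<alpha> g w)" for y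
    by (simp add: discrete_solution_def form_def assms(17))
  show ?thesis
  proof (intro exI conjI)
    show "discrete_solution \<Omega> TH Th v U \<alpha> \<epsilon> a g V u" using u sol by (simp add: ds)
    show "\<forall>u'. discrete_solution \<Omega> TH Th v U \<alpha> \<epsilon> a g V u' \<longrightarrow> (\<forall>i. AE x in lebesgue. x \<in> \<Omega> \<longrightarrow> u' i x = u i x)"
      using uniq by (simp add: ds)
  qed (rule energy_estimate[OF u(2) sol[OF u(1)], unfolded jump_energy_def scatter_def])
qed

end
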